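(* Let $\mathcal{A}$ be a commutative $AW^*$-algebra, let $\mathcal{I}$ be an ideal in $\mathcal{A}$, and let $\mathbb{Y}$ be a solid space in $S(\mathcal{A})$. Then: (i) The Boolean algebra $P(s(\mathcal{I})\mathcal{A})$ of all projections from $s(\mathcal{I})\mathcal{A}$ is $\sigma$-distributive if and only if there are no non-zero band preserving derivations from $\mathcal{I}$ into $S(\mathcal{A})$. Respectively, if $\mathcal{A}$ is a commutative von Neumann algebra, then the Boolean algebra $P(s(\mathcal{I})\mathcal{A})$ is atomic if and only if there are no non-zero band preserving derivations from $\mathcal{I}$ into $S(\mathcal{A})$. (ii) There exists a non-zero band preserving derivation $\delta\colon\mathcal{I}\to\mathbb{Y}$ if and only if there exists a non-zero projection $p\leqslant s(\mathcal{I})s(\mathbb{Y})$ such that $p\mathbb{Y}=pS(\mathcal{A})$ and the Boolean algebra $P(p\mathcal{A})$ is not $\sigma$-distributive. (iii) If $\mathbb{Y}$ is a quasi-normed solid space in $S(\mathcal{A})$ (equipped with a monotone quasi-norm), or if $\mathbb{Y}\subset\mathcal{A}$, then any band preserving derivation $\delta$ from $\mathcal{I}$ into $\mathbb{Y}$ is trivial (identically zero).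
   Context: An $AW^*$-algebra is a $C^*$-algebra that is also a Baer $*$-algebra. For a commutative $AW^*$-algebra $\mathcal{A}$, the set $P(\mathcal{A})=\{p\in\mathcal{A}:p=p^*=p^2\}$ of projections is a complete Boolean algebra (order: $p\leqslant q$ iff $pq=p$), and $\mathcal{A}$ is $*$-isomorphic to the algebra $\mathbb{C}(Q)$ of continuous complex functions on the Stone space $Q$ of $P(\mathcal{A})$, with projections corresponding to characteristic functions of clopen sets. $S(\mathcal{A})$ is the $*$-algebra of measurable operators affiliated with $\mathcal{A}$; for commutative $\mathcal{A}$ it is $*$-isomorphic to, and is identified with, $L^0_{\mathbb{C}}(P(\mathcal{A}))=C_\infty(Q)\oplus iC_\infty(Q)$, with $\mathcal{A}=\mathbb{C}(Q)\subset S(\mathcal{A})$. Here $C_\infty(Q)$ is the algebra and vector lattice of all continuous $x:Q\to[-\infty,+\infty]$ taking the values $\pm\infty$ at most on a nowhere dense set (operations pointwise on a dense open set, extended by continuity). The modulus of $z\in S(\mathcal{A})$ is $|z|=(z^*z)^{1/2}\in C_\infty(Q)$. Support: for $z\in S(\mathcal{A})$, $s(z)=\mathbf{1}-\sup\{e\in P(\mathcal{A}):ez=0\}\in P(\mathcal{A})$; for non-empty $E\subset S(\mathcal{A})$, $s(E)=\sup\{s(z):z\in E\}$; $pE=\{pz:z\in E\}$. A $\sigma$-complete Boolean algebra is $\sigma$-distributive if $\bigvee_{n}\bigwedge_{m}e_{n,m}=\bigwedge_{\varphi\in\mathbb{N}^{\mathbb{N}}}\bigvee_{n}e_{n,\varphi(n)}$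 for every double sequence $\{e_{n,m}\}_{n,m\in\mathbb{N}}$ in it; it is atomic if every non-zero element dominates an atom (minimal non-zero element). (The one-element Boolean algebra is both.) A solid space in $S(\mathcal{A})$ is a non-zero complex linear subspace $\mathbb{Y}$ such that $x\in\mathbb{Y}$, $y\in S(\mathcal{A})$, $|y|\leqslant|x|$ imply $y\in\mathbb{Y}$ (then $ay\in\mathbb Y$ for $a\in\mathcal A$, $y\in\mathbb Y$). A quasi-norm on $\mathbb{Y}$ is a map $\|\cdot\|:\mathbb{Y}\to\mathbb{R}$ for which there is $C\geqslant1$ such that for all $x,y\in\mathbb{Y}$, $\alpha\in\mathbb{C}$: $\|x\|\geqslant0$, with $\|x\|=0$ iff $x=0$; $\|\alpha x\|=|\alpha|\|x\|$; $\|x+y\|\leqslant C(\|x\|+\|y\|)$. It is monotone if $|y|\leqslant|x|$ implies $\|y\|\leqslant\|x\|$. A quasi-normed solid space is a solid space with a monotone quasi-norm (completeness not required). An ideal in $\mathcal{A}$ is a complex subalgebra $\mathcal{I}\subset\mathcal{A}$ with $xa\in\mathcal{I}$ for all $x\in\mathcal{A}$, $a\in\mathcal{I}$ (no closedness assumed). A derivation $\delta:\mathcal{I}\to\mathbb{Y}$ (also for $\mathbb Y=S(\mathcal A)$) is a complex-linear map with $\delta(xy)=\delta(x)y+x\delta(y)$ for all $x,y\in\mathcal{I}$; it is band preserving if $s(\delta(x))\leqslant s(x)$ for all $x\in\mathcal{I}$. *)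

theory Defs
  imports "HOL-Algebra.Lattice" "HOL-Analysis.Analysis"
begin

section \<open>Commutative $AW^*$-algebras\<close>

class complex_banach = banach +
  fixes scaleC :: "complex \<Rightarrow> 'a \<Rightarrow> 'a"  (infixr \<open>*\<^sub>C\<close> 75)
  assumes scaleC_add_right: "c *\<^sub>C (x + y) = c *\<^sub>C x + c *\<^sub>C y"
    and scaleC_add_left: "(c + d) *\<^sub>C x = c *\<^sub>C x + d *\<^sub>C x"
    and scaleC_scaleC: "c *\<^sub>C (d *\<^sub>C x) = (c * d) *\<^sub>C x"
    and scaleC_of_real: "complex_of_real r *\<^sub>C x = r *\<^sub>R x"
    and norm_scaleC: "norm (c *\<^sub>C x) = cmod c * norm x"

text \<open>
  A Baer $*$-ring automatically has a unit (the annihilator of the empty set is generated by a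
  projection), so an $AW^*$-algebra is unital.  The library class \<^class>\<open>real_normed_algebra_1\<close>
  excludes exactly the zero algebra; there $S(A) = 0$ and no (non-zero) solid space exists.
\<close>

class comm_cstar_algebra = complex_banach + comm_ring_1 + real_normed_algebra_1 +
  fixes star :: "'a \<Rightarrow> 'a"
  assumes scaleC_mult_left: "(c *\<^sub>C x) * y = c *\<^sub>C (x * y)"
    and star_star: "star (star x) = x"
    and star_add: "star (x + y) = star x + star y"
    and star_mult: "star (x * y) = star y * star x"
    and star_scaleC: "star (c *\<^sub>C x) = cnj c *\<^sub>C star x"
    and cstar_identity: "norm (star x * x) = (norm x)\<^sup>2"

definition projection :: "'a::comm_cstar_algebra \<Rightarrow> bool"
  where "projection p \<longleftrightarrow> star p = p \<and> p * p = p"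

class comm_awstar_algebra = comm_cstar_algebra +
  assumes baer: "\<exists>p. star p = p \<and> p * p = p \<and> {x. \<forall>s\<in>S. s * x = 0} = {p * a | a. True}"


section \<open>Boolean algebras of projections\<close>

text \<open>\<open>projections B\<close> is the poset $P(B)$; it is used for $B = A$ and for $B = pA$.\<close>

definition projections :: "'a::comm_awstar_algebra set \<Rightarrow> 'a gorder"
  where "projections B = \<lparr>carrier = {p \<in> B. projection p}, eq = (=), le = (\<lambda>p q. p * q = p)\<rparr>"

text \<open>
  The library's bounds \<open>\<Squnion>\<close> and \<open>\<Sqinter>\<close> are unspecified when they do not exist.  The posets $P(pA)$ to
  which the next notions are applied are complete, so this case does not arise.
\<close>

definition sigma_distributive :: "('b, 'm) gorder_scheme \<Rightarrow> bool"
  where "sigma_distributive L \<longleftrightarrow>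
    (\<forall>e :: nat \<Rightarrow> nat \<Rightarrow> 'b. (\<forall>n m. e n m \<in> carrier L) \<longrightarrow>
      \<Squnion>\<^bsub>L\<^esub> {\<Sqinter>\<^bsub>L\<^esub> {e n m | m. True} | n. True}
        = \<Sqinter>\<^bsub>L\<^esub> {\<Squnion>\<^bsub>L\<^esub> {e n (\<phi> n) | n. True} | \<phi> :: nat \<Rightarrow> nat. True})"

definition atom :: "('b, 'm) gorder_scheme \<Rightarrow> 'b \<Rightarrow> bool"
  where "atom L a \<longleftrightarrow> a \<in> carrier L \<and> a \<noteq> \<bottom>\<^bsub>L\<^esub> \<and>
    (\<forall>b\<in>carrier L. b \<sqsubseteq>\<^bsub>L\<^esub> a \<longrightarrow> b = \<bottom>\<^bsub>L\<^esub> \<or> b = a)"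

definition atomic :: "('b, 'm) gorder_scheme \<Rightarrow> bool"
  where "atomic L \<longleftrightarrow> (\<forall>b\<in>carrier L. b \<noteq> \<bottom>\<^bsub>L\<^esub> \<longrightarrow> (\<exists>a. atom L a \<and> a \<sqsubseteq>\<^bsub>L\<^esub> b))"


section \<open>The Stone space $Q$ and the identification of $A$ with $C(Q)$\<close>

definition ultrafilter :: "'a::comm_awstar_algebra set \<Rightarrow> bool"
  where "ultrafilter U \<longleftrightarrow> U \<subseteq> {p. projection p} \<and> 1 \<in> U \<and> 0 \<notin> U \<and>
    (\<forall>p\<in>U. \<forall>q\<in>U. p * q \<in> U) \<and>
    (\<forall>p\<in>U. \<forall>q. projection q \<and> p * q = p \<longrightarrow> q \<in> U) \<and>
    (\<forall>p. projection p \<longrightarrow> p \<in> U \<or> 1 - p \<in> U)"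

definition stone_space :: "'a::comm_awstar_algebra set topology"
  where "stone_space = topology_generated_by {{U. ultrafilter U \<and> p \<in> U} | p. projection p}"

text \<open>Functions on $Q$ are total functions that are \<^const>\<open>undefined\<close> off $Q$.\<close>

definition stone_continuous :: "('a::comm_awstar_algebra set \<Rightarrow> 'b::topological_space) set"
  where "stone_continuous = {f \<in> extensional (topspace stone_space).
    continuous_map stone_space euclidean f}"

text \<open>
  The $*$-isomorphism of $A$ onto $C(Q)$ that sends each projection to the characteristic function
  of the corresponding clopen set.  There is exactly one.
\<close>

definition stone_iso :: "'a::comm_awstar_algebra \<Rightarrow> 'a set \<Rightarrow> complex"
  where "stone_iso = (SOME \<Phi>.
    bij_betw \<Phi> UNIV stone_continuous \<and>
    (\<forall>q\<in>topspace stone_space.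
      (\<forall>x y. \<Phi> (x + y) q = \<Phi> x q + \<Phi> y q) \<and>
      (\<forall>c x. \<Phi> (c *\<^sub>C x) q = c * \<Phi> x q) \<and>
      (\<forall>x y. \<Phi> (x * y) q = \<Phi> x q * \<Phi> y q) \<and>
      (\<forall>x. \<Phi> (star x) q = cnj (\<Phi> x q)) \<and>
      (\<forall>p. projection p \<longrightarrow> \<Phi> p q = (if p \<in> q then 1 else 0))))"


section \<open>The algebra $S(A) = C_\infty(Q) \oplus i\,C_\infty(Q)$\<close>

definition C_infty :: "('a::comm_awstar_algebra set \<Rightarrow> ereal) set"
  where "C_infty = {x \<in> stone_continuous.
    stone_space interior_of (stone_space closure_of {q \<in> topspace stone_space. \<bar>x q\<bar> = \<infinity>}) = {}}"

text \<open>The pair $(x, y)$ stands for $x + iy$.\<close>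

type_synonym 'a meas = "('a set \<Rightarrow> ereal) \<times> ('a set \<Rightarrow> ereal)"

definition S_alg :: "'a::comm_awstar_algebra meas set"
  where "S_alg = C_infty \<times> C_infty"

definition finite_at :: "'a meas \<Rightarrow> 'a set \<Rightarrow> bool"
  where "finite_at z q \<longleftrightarrow> \<bar>fst z q\<bar> \<noteq> \<infinity> \<and> \<bar>snd z q\<bar> \<noteq> \<infinity>"

text \<open>The value of $z$ at $q$; meaningful only where \<^term>\<open>finite_at z q\<close> holds.\<close>

definition val :: "'a meas \<Rightarrow> 'a set \<Rightarrow> complex"
  where "val z q = Complex (real_of_ereal (fst z q)) (real_of_ereal (snd z q))"

text \<open>The unique element of $S(A)$ that is finite and equal to \<open>f\<close> on some dense open set.\<close>

definition S_ext :: "('a::comm_awstar_algebra set \<Rightarrow> complex) \<Rightarrow> 'a meas"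
  where "S_ext f = (THE z. z \<in> S_alg \<and>
    (\<exists>D. openin stone_space D \<and> stone_space closure_of D = topspace stone_space \<and>
      (\<forall>q\<in>D. finite_at z q \<and> val z q = f q)))"

definition S_zero :: "'a::comm_awstar_algebra meas"
  where "S_zero = ((\<lambda>q\<in>topspace stone_space. 0), (\<lambda>q\<in>topspace stone_space. 0))"

definition S_add :: "'a::comm_awstar_algebra meas \<Rightarrow> 'a meas \<Rightarrow> 'a meas"
  where "S_add z w = S_ext (\<lambda>q. val z q + val w q)"

definition S_mult :: "'a::comm_awstar_algebra meas \<Rightarrow> 'a meas \<Rightarrow> 'a meas"
  where "S_mult z w = S_ext (\<lambda>q. val z q * val w q)"

definition S_scale :: "complex \<Rightarrow> 'a::comm_awstar_algebra meas \<Rightarrow> 'a meas"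
  where "S_scale c z = S_ext (\<lambda>q. c * val z q)"

definition S_star :: "'a::comm_awstar_algebra meas \<Rightarrow> 'a meas"
  where "S_star z = S_ext (\<lambda>q. cnj (val z q))"

text \<open>$|z| = (z^* z)^{1/2}$, as an element of $C_\infty(Q)$, where the order is pointwise.\<close>

definition S_abs :: "'a::comm_awstar_algebra meas \<Rightarrow> 'a set \<Rightarrow> ereal"
  where "S_abs z = fst (S_ext (\<lambda>q. complex_of_real (sqrt (Re (val (S_mult (S_star z) z) q)))))"

definition S_abs_le :: "'a::comm_awstar_algebra meas \<Rightarrow> 'a meas \<Rightarrow> bool"
  where "S_abs_le y x \<longleftrightarrow> (\<forall>q\<in>topspace stone_space. S_abs y q \<le> S_abs x q)"

definition emb :: "'a::comm_awstar_algebra \<Rightarrow> 'a meas"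
  where "emb a = ((\<lambda>q\<in>topspace stone_space. ereal (Re (stone_iso a q))),
                  (\<lambda>q\<in>topspace stone_space. ereal (Im (stone_iso a q))))"

definition supp :: "'a::comm_awstar_algebra meas \<Rightarrow> 'a"
  where "supp z = 1 - \<Squnion>\<^bsub>projections UNIV\<^esub> {e. projection e \<and> S_mult (emb e) z = S_zero}"

definition supp_set :: "'a::comm_awstar_algebra meas set \<Rightarrow> 'a"
  where "supp_set E = \<Squnion>\<^bsub>projections UNIV\<^esub> (supp ` E)"


section \<open>Ideals, solid spaces, derivations\<close>

definition ideal_of :: "'a::comm_awstar_algebra set \<Rightarrow> bool"
  where "ideal_of I \<longleftrightarrow> 0 \<in> I \<and> (\<forall>x\<in>I. \<forall>y\<in>I. x + y \<in> I) \<and> (\<forall>c. \<forall>x\<in>I. c *\<^sub>C x \<in> I) \<and>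
    (\<forall>x. \<forall>a\<in>I. x * a \<in> I)"

definition solid_space :: "'a::comm_awstar_algebra meas set \<Rightarrow> bool"
  where "solid_space Y \<longleftrightarrow> Y \<subseteq> S_alg \<and> S_zero \<in> Y \<and> (\<exists>y\<in>Y. y \<noteq> S_zero) \<and>
    (\<forall>x\<in>Y. \<forall>y\<in>Y. S_add x y \<in> Y) \<and> (\<forall>c. \<forall>x\<in>Y. S_scale c x \<in> Y) \<and>
    (\<forall>x\<in>Y. \<forall>y\<in>S_alg. S_abs_le y x \<longrightarrow> y \<in> Y)"

definition quasi_norm :: "'a::comm_awstar_algebra meas set \<Rightarrow> ('a meas \<Rightarrow> real) \<Rightarrow> bool"
  where "quasi_norm Y N \<longleftrightarrow>
    (\<exists>C\<ge>1. \<forall>x\<in>Y. \<forall>y\<in>Y. \<forall>\<alpha>. N x \<ge> 0 \<and> (N x = 0 \<longleftrightarrow> x = S_zero) \<and>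
      N (S_scale \<alpha> x) = cmod \<alpha> * N x \<and> N (S_add x y) \<le> C * (N x + N y))"

definition monotone_norm :: "'a::comm_awstar_algebra meas set \<Rightarrow> ('a meas \<Rightarrow> real) \<Rightarrow> bool"
  where "monotone_norm Y N \<longleftrightarrow> (\<forall>x\<in>Y. \<forall>y\<in>Y. S_abs_le y x \<longrightarrow> N y \<le> N x)"

text \<open>Only the values of \<open>\<delta>\<close> on \<open>I\<close> matter.\<close>

definition derivation ::
  "'a::comm_awstar_algebra set \<Rightarrow> 'a meas set \<Rightarrow> ('a \<Rightarrow> 'a meas) \<Rightarrow> bool"
  where "derivation I Y \<delta> \<longleftrightarrow> (\<forall>x\<in>I. \<delta> x \<in> Y) \<and>
    (\<forall>x\<in>I. \<forall>y\<in>I. \<delta> (x + y) = S_add (\<delta> x) (\<delta> y)) \<and>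
    (\<forall>c. \<forall>x\<in>I. \<delta> (c *\<^sub>C x) = S_scale c (\<delta> x)) \<and>
    (\<forall>x\<in>I. \<forall>y\<in>I. \<delta> (x * y) = S_add (S_mult (\<delta> x) (emb y)) (S_mult (emb x) (\<delta> y)))"

definition band_preserving :: "'a::comm_awstar_algebra set \<Rightarrow> ('a \<Rightarrow> 'a meas) \<Rightarrow> bool"
  where "band_preserving I \<delta> \<longleftrightarrow>
    (\<forall>x\<in>I. supp (\<delta> x) \<sqsubseteq>\<^bsub>projections UNIV\<^esub> supp (emb x))"

definition nonzero_on :: "'a::comm_awstar_algebra set \<Rightarrow> ('a \<Rightarrow> 'a meas) \<Rightarrow> bool"
  where "nonzero_on I \<delta> \<longleftrightarrow> (\<exists>x\<in>I. \<delta> x \<noteq> S_zero)"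


section \<open>Von Neumann algebras\<close>

class complex_hilbert = complex_banach +
  fixes cinner :: "'a \<Rightarrow> 'a \<Rightarrow> complex"
  assumes cinner_commute: "cinner x y = cnj (cinner y x)"
    and cinner_add_left: "cinner (x + y) z = cinner x z + cinner y z"
    and cinner_scaleC_left: "cinner (c *\<^sub>C x) y = c * cinner x y"
    and cinner_self: "cinner x x = complex_of_real ((norm x)\<^sup>2)"

text \<open>The type \<open>'h \<Rightarrow>\<^sub>L 'h\<close> consists of the bounded real-linear operators.\<close>

definition complex_ops :: "('h::complex_hilbert \<Rightarrow>\<^sub>L 'h) set"
  where "complex_ops = {T. \<forall>c x. blinfun_apply T (c *\<^sub>C x) = c *\<^sub>C blinfun_apply T x}"

definition is_adjoint :: "('h::complex_hilbert \<Rightarrow>\<^sub>L 'h) \<Rightarrow> ('h \<Rightarrow>\<^sub>L 'h) \<Rightarrow> bool"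
  where "is_adjoint T T' \<longleftrightarrow>
    (\<forall>x y. cinner (blinfun_apply T x) y = cinner x (blinfun_apply T' y))"

definition commutant :: "('h::complex_hilbert \<Rightarrow>\<^sub>L 'h) set \<Rightarrow> ('h \<Rightarrow>\<^sub>L 'h) set"
  where "commutant M = {T \<in> complex_ops. \<forall>R\<in>M. T o\<^sub>L R = R o\<^sub>L T}"

definition von_neumann_algebra :: "('h::complex_hilbert \<Rightarrow>\<^sub>L 'h) set \<Rightarrow> bool"
  where "von_neumann_algebra M \<longleftrightarrow> M \<subseteq> complex_ops \<and>
    (\<forall>T\<in>M. \<exists>T'\<in>M. is_adjoint T T') \<and> commutant (commutant M) = M"

definition star_iso_onto ::
  "('a::comm_cstar_algebra \<Rightarrow> ('h::complex_hilbert \<Rightarrow>\<^sub>L 'h)) \<Rightarrow> ('h \<Rightarrow>\<^sub>L 'h) set \<Rightarrow> bool"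
  where "star_iso_onto \<pi> M \<longleftrightarrow> bij_betw \<pi> UNIV M \<and>
    (\<forall>x y. \<pi> (x + y) = \<pi> x + \<pi> y) \<and>
    (\<forall>c x v. blinfun_apply (\<pi> (c *\<^sub>C x)) v = c *\<^sub>C blinfun_apply (\<pi> x) v) \<and>
    (\<forall>x y. \<pi> (x * y) = \<pi> x o\<^sub>L \<pi> y) \<and>
    (\<forall>x. is_adjoint (\<pi> x) (\<pi> (star x)))"

end

theory Submission
  imports Defs "HOL-Computational_Algebra.Polynomial"
begin

text \<open>
  Call a statement about points of the Stone space \<open>Q\<close> generic if it holds on a dense open set. Elements
  of \<open>S(A)\<close> are the functions that are generically finite and continuous, up to generic equality:
  since \<open>P(A)\<close> is complete, \<open>Q\<close> is extremally disconnected and such a function has a unique continuous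
  extension (\<open>S_ext\<close>). Seen in this way \<open>S(A)\<close> is a commutative von Neumann regular ring in which
  every compatible system of linear equations in one unknown is solvable. The identification of
  \<open>A\<close> with \<open>C(Q)\<close> that is used throughout rests on one spectral fact (\<open>bisection\<close>): a self-adjoint
  element is non-negative on some projection and non-positive on its complement.

  The link between distributivity and derivations are the locally constant elements. The algebra
  \<open>P(pA)\<close> is $\sigma$-distributive if and only if every \<open>x\<close> in \<open>A\<close> is locally constant below \<open>p\<close>, that is,
  each non-zero \<open>d \<le> p\<close> dominates a non-zero \<open>q\<close> on which \<open>x\<close> is constant
  (\<open>refinable_imp_locally_constant\<close>, \<open>locally_constant_imp_refinable\<close>). A band preserving
  derivation kills constants and commutes with projections, so it can only be non-zero where
  something is not locally constant.

  Suppose that \<open>a\<close> is constant on no non-zero part of \<open>d\<close>. Then on every part of \<open>d\<close> the element \<open>a\<close> is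
  transcendental over the ring of locally constant elements, because a root of a polynomial with
  constant coefficients takes only finitely many values. So there is a derivation on the ring
  generated by that ring and \<open>a\<close> which vanishes on locally constant elements and maps \<open>a\<close> to \<open>d\<close>. As
  for fields of characteristic zero, it extends to all of \<open>S(A)\<close> (\<open>derivation_extension\<close>); in place
  of the minimal polynomial over a field one takes, locally, a relation of least degree. Cut down
  by a projection \<open>p \<ge> d\<close>, the extension is a non-zero derivation on every ideal whose support dominates
  \<open>p\<close>, with values in \<open>pS(A)\<close>.

  Conversely, let \<open>\<delta>\<close> be a band preserving derivation with \<open>\<delta> x \<noteq> 0\<close>, and let \<open>e\<close> be a projection on which
  \<open>|x|\<close> and \<open>|\<delta> x|\<close> are bounded below. Then \<open>x\<close> is constant on no part of \<open>e\<close>. Moreover \<open>x\<close> can be approximated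
  so well by a locally constant element that the difference, multiplied by an arbitrarily large
  locally constant factor, is still bounded; its product with \<open>x\<close> lies in the ideal and has a
  derivative as large as one likes on \<open>e\<close> (\<open>derivative_dominates\<close>). By solidity the target space
  contains \<open>eS(A)\<close>. Neither \<open>A\<close> nor a space with a monotone quasi-norm contains \<open>eS(A)\<close>, since \<open>e\<close> splits into infinitely
  many non-zero pieces and \<open>eS(A)\<close> contains the sums of these pieces with arbitrary coefficients.

  In a von Neumann algebra each vector defines a completely additive measure on the projections
  (\<open>normality\<close>). Below a projection without atoms on which such a measure is strictly positive, there are
  for every \<open>n\<close> countably many disjoint pieces of measure at most a multiple of $2^{-n}$ with full
  supremum, and no non-zero projection lies, for every \<open>n\<close>, below one piece of the family number \<open>n\<close>. Hence
  $\sigma$-distributivity forces atomicity.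
\<close>

section \<open>Extension of derivations in regular rings\<close>

text \<open>Self-injective regular rings of characteristic zero. Self-injectivity is expressed by elements: a system \<open>a u = b\<close>,
  with \<open>(a, b)\<close> ranging over \<open>T\<close>, is solvable as soon as no annihilator and no pair of its equations
  excludes it.\<close>

class complete_regular_ring = comm_ring_1 +
  assumes regular: "\<exists>w. z * w * z = z"
    and solvable_system: "(\<And>a b c. (a, b) \<in> T \<Longrightarrow> c * a = 0 \<Longrightarrow> c * b = 0) \<Longrightarrow>
      (\<And>a b c d. (a, b) \<in> T \<Longrightarrow> (c, d) \<in> T \<Longrightarrow> a * d = c * b) \<Longrightarrow>
      \<exists>u. \<forall>(a, b)\<in>T. a * u = b"
    and nat_torsion_free: "of_nat (Suc n) * z = 0 \<Longrightarrow> z = 0"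

lemma support_idempotent:
  fixes z :: "'r::complete_regular_ring"
  assumes "z \<noteq> 0"
  obtains e w where "e * e = e" "e \<noteq> 0" "z * w = e" "z * e = z"
proof -
  obtain w where w: "z * w * z = z" using regular by blast
  have "z * w * (z * w) = z * w" using w by (metis mult.assoc)
  moreover have "z * w \<noteq> 0" using w assms by auto
  moreover have "z * (z * w) = z" using w by (simp add: mult_ac)
  ultimately show ?thesis using that by blast
qed

text \<open>The derivative is needed over rings with zero divisors, where it may lower the degree by more than one.\<close>

lift_definition formal_deriv :: "'r::comm_ring_1 poly \<Rightarrow> 'r poly"
  is "\<lambda>p n. of_nat (Suc n) * p (Suc n)"
  by (subst (asm) MOST_Suc_iff[symmetric]) (auto elim: MOST_mono)

lemma coeff_formal_deriv: "coeff (formal_deriv p) n = of_nat (Suc n) * coeff p (Suc n)"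
  by transfer simp

lemma formal_deriv_0 [simp]: "formal_deriv 0 = 0"
  by (rule poly_eqI) (simp add: coeff_formal_deriv)

lemma formal_deriv_pCons: "formal_deriv (pCons a p) = p + pCons 0 (formal_deriv p)"
  by (rule poly_eqI) (auto simp: coeff_formal_deriv coeff_pCons algebra_simps split: nat.split)

lemma formal_deriv_add: "formal_deriv (p + q) = formal_deriv p + formal_deriv q"
  by (rule poly_eqI) (simp add: coeff_formal_deriv algebra_simps)

lemma formal_deriv_uminus: "formal_deriv (- p) = - formal_deriv p"
  by (rule poly_eqI) (simp add: coeff_formal_deriv)

lemma formal_deriv_smult: "formal_deriv (smult c p) = smult c (formal_deriv p)"
  by (rule poly_eqI) (simp add: coeff_formal_deriv algebra_simps)

lemma formal_deriv_mult: "formal_deriv (p * q) = p * formal_deriv q + q * formal_deriv p"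
  by (induction p) (auto simp: formal_deriv_pCons formal_deriv_add formal_deriv_smult algebra_simps)

lemma degree_formal_deriv_le: "degree (formal_deriv p) \<le> degree p - 1"
  by (rule degree_le) (auto simp: coeff_formal_deriv coeff_eq_0 simp del: of_nat_Suc)

text \<open>A derivation \<open>D\<close> on a subring corresponds to a subring of the dual numbers, the set of pairs \<open>(a, D a)\<close>;
  the last clause says that the set is a graph. All idempotents belong to the subring, and a derivation
  annihilates them.\<close>

definition derivation_graph :: "('r::complete_regular_ring \<times> 'r) set \<Rightarrow> bool"
  where "derivation_graph G \<longleftrightarrow>
    (\<forall>e. e * e = e \<longrightarrow> (e, 0) \<in> G) \<and>
    (\<forall>a b c d. (a, b) \<in> G \<longrightarrow> (c, d) \<in> G \<longrightarrow> (a + c, b + d) \<in> G \<and> (a * c, a * d + b * c) \<in> G) \<and>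
    (\<forall>a b. (a, b) \<in> G \<longrightarrow> (- a, - b) \<in> G) \<and>
    (\<forall>b. (0, b) \<in> G \<longrightarrow> b = 0)"

text \<open>Polynomials over the dual numbers with coefficients in \<open>G\<close>, written as pairs.\<close>

definition graph_polys :: "('r::complete_regular_ring \<times> 'r) set \<Rightarrow> ('r poly \<times> 'r poly) set"
  where "graph_polys G = {(f, g). \<forall>i. (coeff f i, coeff g i) \<in> G}"

context
  fixes G :: "('r::complete_regular_ring \<times> 'r) set"
  assumes G: "derivation_graph G"
begin

lemma graph_idem: "e * e = e \<Longrightarrow> (e, 0) \<in> G"
  using G by (auto simp: derivation_graph_def)

lemma graph_add: "(a, b) \<in> G \<Longrightarrow> (c, d) \<in> G \<Longrightarrow> (a + c, b + d) \<in> G"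
  using G by (auto simp: derivation_graph_def)

lemma graph_mult: "(a, b) \<in> G \<Longrightarrow> (c, d) \<in> G \<Longrightarrow> (a * c, a * d + b * c) \<in> G"
  using G by (auto simp: derivation_graph_def)

lemma graph_uminus: "(a, b) \<in> G \<Longrightarrow> (- a, - b) \<in> G"
  using G by (auto simp: derivation_graph_def)

lemma graph_zero: "(0, 0) \<in> G" by (rule graph_idem) simp

lemma graph_one: "(1, 0) \<in> G" by (rule graph_idem) simp

lemma graph_diff: "(a, b) \<in> G \<Longrightarrow> (c, d) \<in> G \<Longrightarrow> (a - c, b - d) \<in> G"
  using graph_add[OF _ graph_uminus] by fastforce

lemma graph_unique: assumes "(a, b) \<in> G" "(a, c) \<in> G" shows "b = c"
proof -
  have "(0, b - c) \<in> G" using graph_diff[OF assms] by simp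
  then show ?thesis using G by (auto simp: derivation_graph_def)
qed

lemma graph_sum:
  assumes "\<And>i. i \<in> A \<Longrightarrow> (a i, b i) \<in> G" shows "(sum a A, sum b A) \<in> G"
  using assms
proof (induction A rule: infinite_finite_induct)
  case (insert x F)
  have "(a x + sum a F, b x + sum b F) \<in> G"
    by (rule graph_add) (use insert in auto)
  then show ?case using insert by simp
qed (auto simp: graph_zero)

lemma graph_of_nat: "(a, b) \<in> G \<Longrightarrow> (of_nat n * a, of_nat n * b) \<in> G"
  by (induction n) (auto simp: graph_zero algebra_simps intro: graph_add)

lemma graph_power: "(a, b) \<in> G \<Longrightarrow> \<exists>d. (a ^ n, d) \<in> G"
  by (induction n) (auto intro: graph_one graph_mult)

lemma graph_polysI: "(\<And>i. (coeff f i, coeff g i) \<in> G) \<Longrightarrow> (f, g) \<in> graph_polys G"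
  by (auto simp: graph_polys_def)

lemma graph_polysD: "(f, g) \<in> graph_polys G \<Longrightarrow> (coeff f i, coeff g i) \<in> G"
  by (auto simp: graph_polys_def)

lemma graph_polys_unique: "(f, g) \<in> graph_polys G \<Longrightarrow> (f, h) \<in> graph_polys G \<Longrightarrow> g = h"
  by (rule poly_eqI) (blast dest: graph_polysD intro: graph_unique)

lemma graph_polys_zero: "(0, 0) \<in> graph_polys G"
  by (rule graph_polysI) (simp add: graph_zero)

lemma graph_polys_add:
  "(f, g) \<in> graph_polys G \<Longrightarrow> (h, k) \<in> graph_polys G \<Longrightarrow> (f + h, g + k) \<in> graph_polys G"
  by (auto simp: graph_polys_def intro: graph_add)

lemma graph_polys_diff:
  "(f, g) \<in> graph_polys G \<Longrightarrow> (h, k) \<in> graph_polys G \<Longrightarrow> (f - h, g - k) \<in> graph_polys G"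
  by (auto simp: graph_polys_def intro: graph_diff)

lemma graph_polys_uminus:
  "(f, g) \<in> graph_polys G \<Longrightarrow> (- f, - g) \<in> graph_polys G"
  by (auto simp: graph_polys_def intro: graph_uminus)

lemma graph_polys_mult:
  assumes "(f, g) \<in> graph_polys G" "(h, k) \<in> graph_polys G"
  shows "(f * h, f * k + g * h) \<in> graph_polys G"
proof (rule graph_polysI)
  fix n
  have "((\<Sum>i\<le>n. coeff f i * coeff h (n - i)),
     (\<Sum>i\<le>n. coeff f i * coeff k (n - i) + coeff g i * coeff h (n - i))) \<in> G"
    by (intro graph_sum graph_mult graph_polysD assms)
  then show "(coeff (f * h) n, coeff (f * k + g * h) n) \<in> G"
    by (simp add: coeff_mult sum.distrib)
qed

lemma graph_polys_const: "(a, b) \<in> G \<Longrightarrow> ([:a:], [:b:]) \<in> graph_polys G"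
  by (rule graph_polysI) (auto simp: coeff_pCons graph_zero split: nat.split)

lemma graph_polys_X: "([:0, 1:], 0) \<in> graph_polys G"
  by (rule graph_polysI) (auto simp: coeff_pCons graph_zero graph_one split: nat.split)

lemma graph_polys_smult:
  assumes "(a, b) \<in> G" "(f, g) \<in> graph_polys G"
  shows "(smult a f, smult a g + smult b f) \<in> graph_polys G"
  using graph_polys_mult[OF graph_polys_const[OF assms(1)] assms(2)] by simp

lemma graph_polys_monom: "(a, b) \<in> G \<Longrightarrow> (monom a n, monom b n) \<in> graph_polys G"
  by (rule graph_polysI) (auto simp: graph_zero)

lemma graph_polys_deriv:
  "(f, g) \<in> graph_polys G \<Longrightarrow> (formal_deriv f, formal_deriv g) \<in> graph_polys G"
  by (rule graph_polysI) (simp add: coeff_formal_deriv graph_of_nat graph_polysD del: of_nat_Suc)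

lemma graph_polys_idem:
  assumes "e * e = e" "(f, g) \<in> graph_polys G"
  shows "(smult e f, smult e g) \<in> graph_polys G"
  using graph_polys_smult[OF graph_idem[OF assms(1)] assms(2)] by simp

text \<open>The values at the dual number \<open>(y, u)\<close> of the polynomials with coefficients in \<open>G\<close>.\<close>

definition adjoin :: "'r \<Rightarrow> 'r \<Rightarrow> ('r \<times> 'r) set"
  where "adjoin y u = {(poly f y, poly g y + poly (formal_deriv f) y * u) | f g. (f, g) \<in> graph_polys G}"

lemma adjoinI:
  "(f, g) \<in> graph_polys G \<Longrightarrow> a = poly f y \<Longrightarrow> b = poly g y + poly (formal_deriv f) y * u \<Longrightarrow>
    (a, b) \<in> adjoin y u"
  by (auto simp: adjoin_def)

lemma adjoin_graph:
  assumes "\<And>f g. (f, g) \<in> graph_polys G \<Longrightarrow> poly f y = 0 \<Longrightarrow> poly g y + poly (formal_deriv f) y * u = 0"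
  shows "derivation_graph (adjoin y u)" "G \<subseteq> adjoin y u" "(y, u) \<in> adjoin y u"
proof -
  show GA: "G \<subseteq> adjoin y u"
  proof
    fix z assume "z \<in> G"
    then obtain a b where z: "z = (a, b)" "(a, b) \<in> G" by (cases z) auto
    show "z \<in> adjoin y u" unfolding z(1)
      by (rule adjoinI[OF graph_polys_const[OF z(2)]]) (simp_all add: formal_deriv_pCons)
  qed
  show "(y, u) \<in> adjoin y u"
    by (rule adjoinI[OF graph_polys_X]) (simp_all add: formal_deriv_pCons)
  show "derivation_graph (adjoin y u)"
    unfolding derivation_graph_def
  proof (intro conjI allI impI)
    fix e :: 'r assume "e * e = e" then show "(e, 0) \<in> adjoin y u" using graph_idem GA by blast
  next
    fix a b c d assume "(a, b) \<in> adjoin y u" "(c, d) \<in> adjoin y u"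
    then obtain f g h k where *: "(f, g) \<in> graph_polys G" "(h, k) \<in> graph_polys G"
      "a = poly f y" "b = poly g y + poly (formal_deriv f) y * u"
      "c = poly h y" "d = poly k y + poly (formal_deriv h) y * u"
      by (auto simp: adjoin_def)
    show "(a + c, b + d) \<in> adjoin y u"
      using *(3-) by (intro adjoinI[OF graph_polys_add[OF *(1,2)]]) (simp_all add: formal_deriv_add algebra_simps)
    show "(a * c, a * d + b * c) \<in> adjoin y u"
      using *(3-) by (intro adjoinI[OF graph_polys_mult[OF *(1,2)]]) (simp_all add: formal_deriv_mult algebra_simps)
  next
    fix a b assume "(a, b) \<in> adjoin y u"
    then obtain f g where *: "(f, g) \<in> graph_polys G"
      "a = poly f y" "b = poly g y + poly (formal_deriv f) y * u"
      by (auto simp: adjoin_def)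
    show "(- a, - b) \<in> adjoin y u"
      using *(2-) by (intro adjoinI[OF graph_polys_uminus[OF *(1)]]) (simp_all add: formal_deriv_uminus algebra_simps)
  next
    fix b assume "(0, b) \<in> adjoin y u"
    then show "b = 0" using assms by (auto simp: adjoin_def)
  qed
qed

text \<open>An algebraic relation for \<open>y\<close> on the part \<open>e\<close>, with a leading coefficient that is invertible there.
  Over a field this is a polynomial equation; in a regular ring it exists only locally.\<close>

definition relation_on :: "'r \<Rightarrow> 'r \<Rightarrow> 'r poly \<Rightarrow> 'r poly \<Rightarrow> bool"
  where "relation_on y e f g \<longleftrightarrow> e * e = e \<and> e \<noteq> 0 \<and> (f, g) \<in> graph_polys G \<and>
    e * poly f y = 0 \<and> smult e f = f \<and> (\<exists>w. lead_coeff f * w = e)"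

definition minimal_relation :: "'r \<Rightarrow> 'r \<Rightarrow> 'r poly \<Rightarrow> 'r poly \<Rightarrow> bool"
  where "minimal_relation y e f g \<longleftrightarrow> relation_on y e f g \<and>
    (\<forall>e' f' g'. relation_on y e' f' g' \<longrightarrow> e' * e = e' \<longrightarrow> degree f \<le> degree f')"

text \<open>The support of the leading coefficient of \<open>e f\<close> is a part of \<open>e\<close> on which this coefficient is
  invertible.\<close>

lemma relation_exists:
  assumes e: "e * e = e" and f: "(f, g) \<in> graph_polys G" and z: "e * poly f y = 0"
    and nz: "smult e f \<noteq> 0"
  shows "\<exists>e' f' g'. relation_on y e' f' g' \<and> e' * e = e' \<and> degree f' \<le> degree (smult e f)"
proof -
  define c where "c = lead_coeff (smult e f)"
  have c0: "c \<noteq> 0" using nz unfolding c_def by (simp only: leading_coeff_0_iff not_False_eq_True)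
  have ec: "e * c = c" unfolding c_def using e by (simp add: mult.assoc[symmetric])
  obtain e' w where w: "e' * e' = e'" "e' \<noteq> 0" "c * w = e'" "c * e' = c"
    using support_idempotent[OF c0] by metis
  have e'e: "e' * e = e'" using w(3) ec by (metis mult.assoc mult.commute)
  have cf: "coeff (smult e' f) (degree (smult e f)) = c"
  proof -
    have "smult e' f = smult e' (smult e f)" using e'e by simp
    then have "coeff (smult e' f) (degree (smult e f)) = e' * c"
      unfolding c_def by (simp only: coeff_smult[of e'])
    also have "\<dots> = c" using mult.commute[of e' c] w(4) by (rule trans)
    finally show ?thesis .
  qed
  have "degree (smult e' f) \<le> degree (smult e f)"
  proof -
    have "smult e' f = smult e' (smult e f)" using e'e by simp
    then show ?thesis by (metis degree_smult_le)
  qed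
  moreover have "degree (smult e' f) \<ge> degree (smult e f)"
    using cf c0 by (intro le_degree) simp
  ultimately have deg: "degree (smult e' f) = degree (smult e f)" by simp
  have "relation_on y e' (smult e' f) (smult e' g)"
    unfolding relation_on_def
  proof (intro conjI)
    show "e' * poly (smult e' f) y = 0"
    proof -
      have "e' * poly (smult e' f) y = e' * (e' * e) * poly f y" using e'e by (simp add: mult.assoc)
      also have "\<dots> = e' * e' * (e * poly f y)" by (simp only: mult.assoc)
      finally show ?thesis using z by simp
    qed
    have "lead_coeff (smult e' f) = c" unfolding deg by (rule cf)
    then show "\<exists>w. lead_coeff (smult e' f) * w = e'" using w(3) by blast
  qed (use w graph_polys_idem[OF w(1) f] in auto)
  then show ?thesis using e'e deg by (intro exI conjI) auto
qed

lemma minimal_relation_exists: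
  assumes "e * e = e" "(f, g) \<in> graph_polys G" "e * poly f y = 0" "smult e f \<noteq> 0"
  shows "\<exists>e' f' g'. minimal_relation y e' f' g' \<and> e' * e = e'"
proof -
  define P where "P = (\<lambda>(e', f', g'). relation_on y e' f' g' \<and> e' * e = e')"
  define m where "m = (\<lambda>(e' :: 'r, f' :: 'r poly, g' :: 'r poly). degree f')"
  obtain t0 where "P t0" using relation_exists[OF assms] by (auto simp: P_def)
  then obtain t where t: "P t" "\<And>s. P s \<Longrightarrow> m t \<le> m s"
    using ex_has_least_nat[of P t0 m] by blast
  obtain e' f' g' where tt: "t = (e', f', g')" by (cases t)
  have "minimal_relation y e' f' g'"
    unfolding minimal_relation_def
  proof (intro conjI allI impI)
    show "relation_on y e' f' g'" using t(1) by (simp add: P_def tt)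
    fix e'' f'' g'' assume a: "relation_on y e'' f'' g''" "e'' * e' = e''"
    have "e'' * e = e''" using a t(1) by (simp add: P_def tt) (metis mult.assoc)
    then show "degree f' \<le> degree f''" using t(2)[of "(e'', f'', g'')"] a
      by (simp add: P_def m_def tt)
  qed
  then show ?thesis using t(1) by (auto simp: P_def tt)
qed

lemma minimal_relation_degree_pos:
  assumes "relation_on y e f g" shows "degree f \<noteq> 0"
proof
  assume d: "degree f = 0"
  then obtain c where f: "f = [:c:]" by (metis degree_eq_zeroE)
  obtain w where w: "c * w = e" using assms by (auto simp: relation_on_def f)
  have "e * c = 0" using assms by (simp add: relation_on_def f)
  then have "e = 0" using w assms by (metis mult.assoc mult_zero_left relation_on_def)
  then show False using assms by (simp add: relation_on_def)
qed

text \<open>Pseudo-division by a relation of least degree: a non-zero remainder would be a relation of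
  smaller degree on some part of \<open>e\<close>. It is stated for multiples of \<open>e\<close>, as the leading coefficient
  is invertible only there.\<close>

lemma minimal_relation_divides:
  assumes min: "minimal_relation y e f g"
    and h: "(h, k) \<in> graph_polys G" "e * poly h y = 0"
  shows "\<exists>m s t. (s, t) \<in> graph_polys G \<and> smult (e * lead_coeff f ^ m) h = f * s"
  using h
proof (induction "degree (smult e h)" arbitrary: h k rule: less_induct)
  case less
  define c where "c = lead_coeff f"
  have rel: "relation_on y e f g" using min by (simp add: minimal_relation_def)
  then have e: "e * e = e" "e \<noteq> 0" and f: "(f, g) \<in> graph_polys G" "smult e f = f"
    and fy: "e * poly f y = 0"
    by (auto simp: relation_on_def)
  have ec: "e * c = c" using f(2) unfolding c_def by (metis coeff_smult)
  show ?case
  proof (cases "smult e h = 0")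
    case True
    then show ?thesis using graph_polys_zero by (intro exI[of _ 0] exI conjI) auto
  next
    case nz: False
    define N where "N = degree (smult e h)"
    define n where "n = degree f"
    have nN: "n \<le> N"
    proof -
      obtain e' f' g' where "relation_on y e' f' g'" "e' * e = e'" "degree f' \<le> N"
        using relation_exists[OF e(1) less.prems(1) less.prems(2) nz] N_def by auto
      then show ?thesis using min unfolding minimal_relation_def n_def by fastforce
    qed
    have n0: "n \<noteq> 0" using minimal_relation_degree_pos[OF rel] by (simp add: n_def)
    define b where "b = coeff (smult e h) N"
    define q where "q = monom b (N - n)"
    obtain b' where b': "(b, b') \<in> G"
      using graph_polysD[OF graph_polys_idem[OF e(1) less.prems(1)]] b_def by blast
    have q: "(q, monom b' (N - n)) \<in> graph_polys G" unfolding q_def by (rule graph_polys_monom[OF b'])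
    have cG: "(c, coeff g n) \<in> G" using graph_polysD[OF f(1)] by (simp add: c_def n_def)
    define h' where "h' = smult c (smult e h) - q * f"
    obtain k' where k': "(h', k') \<in> graph_polys G"
      unfolding h'_def
      using graph_polys_diff[OF graph_polys_smult[OF cG graph_polys_idem[OF e(1) less.prems(1)]]
        graph_polys_mult[OF q f(1)]] by blast
    have eh': "smult e h' = h'"
    proof -
      have "smult e h' = smult (e * c * e) h - q * smult e f"
        unfolding h'_def by (simp add: smult_diff_right mult_ac)
      then show ?thesis using f(2) ec e by (simp add: h'_def mult_ac)
    qed
    have h'y: "e * poly h' y = 0"
    proof -
      have "e * poly h' y = e * c * e * poly h y - poly q y * (e * poly f y)"
        unfolding h'_def by (simp add: algebra_simps)
      also have "\<dots> = (e * c) * (e * poly h y) - poly q y * (e * poly f y)" by (simp add: mult_ac)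
      also have "\<dots> = 0" using fy less.prems(2) by simp
      finally show ?thesis .
    qed
    have N0: "N > 0" using nN n0 by simp
    have "degree (q * f) \<le> N"
    proof -
      have "degree (q * f) \<le> degree q + degree f" by (rule degree_mult_le)
      also have "\<dots> \<le> (N - n) + n" unfolding q_def n_def by (intro add_mono degree_monom_le order_refl)
      finally show ?thesis using nN by simp
    qed
    then have "degree h' \<le> N" unfolding h'_def
      unfolding N_def by (intro degree_diff_le degree_smult_le) (auto simp: N_def)
    moreover have "coeff h' N = 0"
    proof -
      have "coeff (q * f) N = b * coeff f n"
        unfolding q_def using nN by (simp add: coeff_monom_mult)
      then show ?thesis unfolding h'_def by (simp add: b_def c_def n_def N_def)
    qed
    ultimately have "degree h' < N" using N0
      by (metis degree_0 le_neq_implies_less leading_coeff_0_iff)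
    then have "degree (smult e h') < degree (smult e h)" using eh' by (simp add: N_def)
    from less.hyps[OF this k' h'y] obtain m s t where s: "(s, t) \<in> graph_polys G"
      "smult (e * lead_coeff f ^ m) h' = f * s" by blast
    obtain d where d: "(e * c ^ m, d) \<in> G"
      using graph_power[OF cG] graph_mult[OF graph_idem[OF e(1)]] by blast
    define s' where "s' = s + smult (e * c ^ m) q"
    have "\<exists>t'. (s', t') \<in> graph_polys G"
      unfolding s'_def using graph_polys_add[OF s(1) graph_polys_smult[OF d q]] by blast
    moreover have "smult (e * lead_coeff f ^ Suc m) h = f * s'"
    proof -
      have "smult (e * c ^ Suc m) h = smult (e * e * c ^ Suc m) h" using e by simp
      also have "\<dots> = smult (e * c ^ m) (smult c (smult e h))"
        by (simp add: mult_ac)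
      also have "\<dots> = smult (e * c ^ m) (h' + q * f)" by (simp add: h'_def)
      also have "\<dots> = f * s'" using s(2) by (simp add: s'_def c_def smult_add_right algebra_simps)
      finally show ?thesis by (simp add: c_def)
    qed
    ultimately show ?thesis by blast
  qed
qed

text \<open>Differentiating \<open>c\<^sup>m h = f s\<close> at a root of \<open>f\<close> and \<open>h\<close>: both the formal derivative at \<open>y\<close> and the value
  of the differentiated coefficients are those of \<open>f\<close>, multiplied by the same factor.\<close>

lemma minimal_relation_derivative:
  assumes min: "minimal_relation y e f g" and h: "(h, k) \<in> graph_polys G" "e * poly h y = 0"
  shows "\<exists>m s. e * lead_coeff f ^ m * poly (formal_deriv h) y = e * poly (formal_deriv f) y * s \<and>
    e * lead_coeff f ^ m * poly k y = e * poly g y * s"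
proof -
  define c where "c = lead_coeff f"
  have rel: "relation_on y e f g" using min by (simp add: minimal_relation_def)
  then have e: "e * e = e" "e \<noteq> 0" and f: "(f, g) \<in> graph_polys G" "smult e f = f"
    and fy: "e * poly f y = 0"
    by (auto simp: relation_on_def)
  obtain m s t where s: "(s, t) \<in> graph_polys G" "smult (e * c ^ m) h = f * s"
    using minimal_relation_divides[OF min h] c_def by blast
  have cG: "(c, coeff g (degree f)) \<in> G" using graph_polysD[OF f(1)] by (simp add: c_def)
  obtain d where d: "(e * c ^ m, d) \<in> G"
    using graph_power[OF cG] graph_mult[OF graph_idem[OF e(1)]] by blast
  have "smult (e * c ^ m) k + smult d h = f * t + g * s"
    using graph_polys_unique[OF graph_polys_smult[OF d h(1)]] graph_polys_mult[OF f(1) s(1)] s(2) by simp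
  then have "poly (smult (e * c ^ m) k + smult d h) y = poly (f * t + g * s) y" by simp
  then have "e * (e * c ^ m * poly k y + d * poly h y) = e * (poly f y * poly t y + poly g y * poly s y)"
    by simp
  then have "e * e * c ^ m * poly k y + d * (e * poly h y) = (e * poly f y) * poly t y + e * poly g y * poly s y"
    by (simp add: algebra_simps)
  then have 1: "e * c ^ m * poly k y = e * poly g y * poly s y" using e h(2) fy by simp
  have "formal_deriv (smult (e * c ^ m) h) = formal_deriv (f * s)" using s(2) by simp
  then have "poly (smult (e * c ^ m) (formal_deriv h)) y = poly (f * formal_deriv s + s * formal_deriv f) y"
    by (simp only: formal_deriv_smult formal_deriv_mult)
  then have "e * (e * c ^ m * poly (formal_deriv h) y) = e * (poly f y * poly (formal_deriv s) y + poly s y * poly (formal_deriv f) y)"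
    by simp
  then have "e * e * c ^ m * poly (formal_deriv h) y = (e * poly f y) * poly (formal_deriv s) y + e * poly (formal_deriv f) y * poly s y"
    by (simp add: algebra_simps)
  then have 2: "e * c ^ m * poly (formal_deriv h) y = e * poly (formal_deriv f) y * poly s y" using e fy by simp
  show ?thesis using 1 2 c_def by blast
qed

lemma lead_coeff_cancel:
  assumes "relation_on y e f g" "e * lead_coeff f ^ m * z = 0" shows "e * z = 0"
proof -
  obtain w where w: "lead_coeff f * w = e" using assms by (auto simp: relation_on_def)
  have e: "e * e = e" using assms by (auto simp: relation_on_def)
  have em: "e ^ Suc m = e" by (induction m) (auto simp: e)
  have "e * z = e ^ Suc m * z" by (simp only: em)
  also have "\<dots> = w ^ m * (e * lead_coeff f ^ m * z)" by (simp add: w[symmetric] power_mult_distrib mult_ac)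
  finally show ?thesis using assms(2) by simp
qed

lemma coeffwise_zero:
  assumes "e * e = e" "(h, k) \<in> graph_polys G" "smult e h = 0"
  shows "e * poly (formal_deriv h) y = 0" "e * poly k y = 0"
proof -
  have "formal_deriv (smult e h) = 0" using assms by simp
  then show "e * poly (formal_deriv h) y = 0" by (metis formal_deriv_smult poly_0 poly_smult)
  have "smult e k = 0"
    using graph_polys_unique[OF graph_polys_idem[OF assms(1,2)]] graph_polys_zero assms(3) by simp
  then show "e * poly k y = 0" by (metis poly_0 poly_smult)
qed

text \<open>In characteristic zero \<open>f'\<close> has degree one less than \<open>f\<close>, so that vanishing of \<open>f'(y)\<close> on a part of
  \<open>e\<close> would be a smaller relation.\<close>

lemma minimal_relation_separable:
  assumes min: "minimal_relation y e f g" and z: "e * z = z" "poly (formal_deriv f) y * z = 0"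
  shows "z = 0"
proof (rule ccontr)
  assume "z \<noteq> 0"
  then obtain e' w where w: "e' * e' = e'" "e' \<noteq> 0" "z * w = e'" "z * e' = z"
    using support_idempotent by metis
  have rel: "relation_on y e f g" using min by (simp add: minimal_relation_def)
  then have f: "(f, g) \<in> graph_polys G" by (auto simp: relation_on_def)
  obtain v where v: "lead_coeff f * v = e" using rel by (auto simp: relation_on_def)
  have e'e: "e' * e = e'" using w(3) z(1) by (metis mult.assoc mult.commute)
  have 0: "e' * poly (formal_deriv f) y = 0" using w(3) z(2) by (metis mult.assoc mult.commute mult_zero_right)
  obtain n where n: "degree f = Suc n" using minimal_relation_degree_pos[OF rel] by (cases "degree f") auto
  have "smult e' (formal_deriv f) \<noteq> 0"
  proof
    assume "smult e' (formal_deriv f) = 0"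
    then have "coeff (smult e' (formal_deriv f)) n = 0" by simp
    then have "of_nat (Suc n) * (e' * lead_coeff f) = 0"
      by (simp add: coeff_formal_deriv n mult_ac del: of_nat_Suc)
    then have "e' * lead_coeff f = 0" by (rule nat_torsion_free)
    then have "e' * e = 0" using v by (metis mult.assoc mult_zero_left)
    then show False using e'e w by simp
  qed
  then obtain e'' f'' g'' where r: "relation_on y e'' f'' g''" "e'' * e' = e''"
    "degree f'' \<le> degree (smult e' (formal_deriv f))"
    using relation_exists[OF w(1) graph_polys_deriv[OF f] 0] by blast
  have "e'' * e = e''" using r(2) e'e by (metis mult.assoc)
  then have "degree f \<le> degree f''" using min r(1) by (auto simp: minimal_relation_def)
  moreover have "degree f'' \<le> n"
    using r(3) degree_smult_le[of e' "formal_deriv f"] degree_formal_deriv_le[of f] n by simp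
  ultimately show False using n by simp
qed

text \<open>A value \<open>u\<close> of the derivation at \<open>y\<close> must solve \<open>f'(y) u = - g(y)\<close> for all relations \<open>f\<close> of \<open>y\<close>, where \<open>g\<close>
  differentiates the coefficients. These equations are compatible: locally all of them are multiples
  of the one that belongs to a relation of least degree.\<close>

lemma extension_value_exists:
  "\<exists>u. \<forall>f g. (f, g) \<in> graph_polys G \<longrightarrow> poly f y = 0 \<longrightarrow> poly g y + poly (formal_deriv f) y * u = 0"
proof -
  define T where "T = {(poly (formal_deriv f) y, - poly g y) | f g. (f, g) \<in> graph_polys G \<and> poly f y = 0}"
  have "\<exists>u. \<forall>(a, b)\<in>T. a * u = b"
  proof (rule solvable_system)
    fix a b c assume "(a, b) \<in> T" and ca: "c * a = 0"
    then obtain h k where h: "(h, k) \<in> graph_polys G" "poly h y = 0" "a = poly (formal_deriv h) y" "b = - poly k y"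
      by (auto simp: T_def)
    have "c * poly k y = 0"
    proof (rule ccontr)
      define z where "z = c * poly k y"
      assume "c * poly k y \<noteq> 0"
      then obtain e w where w: "e * e = e" "e \<noteq> 0" "z * w = e" "z * e = z"
        using support_idempotent z_def by metis
      have "smult e h \<noteq> 0"
      proof
        assume "smult e h = 0"
        then have "e * poly k y = 0" by (rule coeffwise_zero(2)[OF w(1) h(1)])
        then have "z * e = 0" by (simp add: z_def mult_ac)
        then show False using w by auto
      qed
      then obtain e1 f g where m: "minimal_relation y e1 f g" "e1 * e = e1"
        using minimal_relation_exists[OF w(1) h(1), of y] h(2) by auto
      have rel: "relation_on y e1 f g" using m by (simp add: minimal_relation_def)
      have e1: "e1 * e1 = e1" "e1 \<noteq> 0" using rel by (auto simp: relation_on_def)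
      obtain n s where s: "e1 * lead_coeff f ^ n * poly (formal_deriv h) y = e1 * poly (formal_deriv f) y * s"
        "e1 * lead_coeff f ^ n * poly k y = e1 * poly g y * s"
        using minimal_relation_derivative[OF m(1) h(1)] h(2) by auto
      have "e1 * s * c = 0"
      proof (rule minimal_relation_separable[OF m(1)])
        show "e1 * (e1 * s * c) = e1 * s * c" using e1 by (simp add: mult.assoc[symmetric])
        have "poly (formal_deriv f) y * (e1 * s * c) = c * (e1 * poly (formal_deriv f) y * s)" by (simp add: mult_ac)
        also have "\<dots> = e1 * lead_coeff f ^ n * (c * a)" unfolding s(1)[symmetric] h(3) by (simp only: mult_ac)
        finally show "poly (formal_deriv f) y * (e1 * s * c) = 0" using ca by simp
      qed
      then have "e1 * lead_coeff f ^ n * z = 0"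
        unfolding z_def using s(2) by (metis mult.assoc mult.commute mult_zero_right)
      then have "e1 * z = 0" by (rule lead_coeff_cancel[OF rel])
      then have "e1 * e = 0" using w(3) by (metis mult.assoc mult_zero_left)
      then show False using m(2) e1 by simp
    qed
    then show "c * b = 0" by (simp add: h)
  next
    fix a b c d assume "(a, b) \<in> T" "(c, d) \<in> T"
    then obtain h k h2 k2 where h: "(h, k) \<in> graph_polys G" "poly h y = 0" "a = poly (formal_deriv h) y" "b = - poly k y"
      and h2: "(h2, k2) \<in> graph_polys G" "poly h2 y = 0" "c = poly (formal_deriv h2) y" "d = - poly k2 y"
      by (auto simp: T_def)
    define z where "z = poly (formal_deriv h) y * poly k2 y - poly (formal_deriv h2) y * poly k y"
    have "z = 0"
    proof (rule ccontr)
      assume "z \<noteq> 0"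
      then obtain e w where w: "e * e = e" "e \<noteq> 0" "z * w = e" "z * e = z"
        using support_idempotent by metis
      have "smult e h \<noteq> 0"
      proof
        assume "smult e h = 0"
        then have "e * poly k y = 0" "e * poly (formal_deriv h) y = 0" using coeffwise_zero[OF w(1) h(1)] by auto
        moreover have "z * e = e * poly (formal_deriv h) y * poly k2 y - e * poly k y * poly (formal_deriv h2) y"
          by (simp add: z_def algebra_simps)
        ultimately have "z * e = 0" by simp
        then show False using w by auto
      qed
      then obtain e1 f g where m: "minimal_relation y e1 f g" "e1 * e = e1"
        using minimal_relation_exists[OF w(1) h(1), of y] h(2) by auto
      have rel: "relation_on y e1 f g" using m by (simp add: minimal_relation_def)
      have e1: "e1 * e1 = e1" "e1 \<noteq> 0" using rel by (auto simp: relation_on_def)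
      define c where "c = lead_coeff f"
      obtain n s where s: "e1 * c ^ n * poly (formal_deriv h) y = e1 * poly (formal_deriv f) y * s"
        "e1 * c ^ n * poly k y = e1 * poly g y * s"
        using minimal_relation_derivative[OF m(1) h(1)] h(2) c_def by auto
      obtain n2 s2 where s2: "e1 * c ^ n2 * poly (formal_deriv h2) y = e1 * poly (formal_deriv f) y * s2"
        "e1 * c ^ n2 * poly k2 y = e1 * poly g y * s2"
        using minimal_relation_derivative[OF m(1) h2(1)] h2(2) c_def by auto
      have "e1 * e1 * c ^ (n + n2) * z =
          (e1 * c ^ n * poly (formal_deriv h) y) * (e1 * c ^ n2 * poly k2 y)
          - (e1 * c ^ n2 * poly (formal_deriv h2) y) * (e1 * c ^ n * poly k y)"
        unfolding z_def by (simp add: power_add algebra_simps)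
      also have "\<dots> = 0" unfolding s s2 by (simp add: algebra_simps)
      finally have "e1 * lead_coeff f ^ (n + n2) * z = 0" using e1 by (simp add: c_def)
      then have "e1 * z = 0" by (rule lead_coeff_cancel[OF rel])
      then have "e1 * e = 0" using w(3) by (metis mult.assoc mult_zero_left)
      then show False using m(2) e1 by simp
    qed
    then show "a * d = c * b" by (simp add: h h2 z_def)
  qed
  then obtain u where u: "\<forall>(a, b)\<in>T. a * u = b" by blast
  show ?thesis
  proof (intro exI allI impI)
    fix f g assume "(f, g) \<in> graph_polys G" "poly f y = 0"
    then have "(poly (formal_deriv f) y, - poly g y) \<in> T" by (auto simp: T_def)
    with u show "poly g y + poly (formal_deriv f) y * u = 0" by fastforce
  qed
qed

lemma one_step_extension: "\<exists>G' u. derivation_graph G' \<and> G \<subseteq> G' \<and> (y, u) \<in> G'"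
  using extension_value_exists[of y] adjoin_graph[of y] by blast

end

theorem derivation_extension:
  fixes G :: "('r::complete_regular_ring \<times> 'r) set"
  assumes G: "derivation_graph G"
  obtains D where "\<And>a b. D (a + b) = D a + D b" "\<And>a b. D (a * b) = a * D b + D a * b"
    "\<And>a b. (a, b) \<in> G \<Longrightarrow> D a = b"
proof -
  define X where "X = {H. derivation_graph H \<and> G \<subseteq> H}"
  have "\<exists>M\<in>X. \<forall>H\<in>X. M \<subseteq> H \<longrightarrow> H = M"
  proof (rule subset_Zorn_nonempty)
    show "X \<noteq> {}" using G by (auto simp: X_def)
    fix C assume C: "C \<noteq> {}" "subset.chain X C"
    have two: "\<exists>H\<in>C. p \<in> H \<and> q \<in> H" if pq: "p \<in> \<Union>C" "q \<in> \<Union>C" for p q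
    proof -
      obtain H K where *: "H \<in> C" "p \<in> H" "K \<in> C" "q \<in> K" using pq by blast
      then have "H \<subseteq> K \<or> K \<subseteq> H" using C(2) by (auto simp: subset_chain_def)
      then show ?thesis using * by blast
    qed
    have sub: "derivation_graph H" "G \<subseteq> H" if "H \<in> C" for H
      using that C(2) by (auto simp: subset_chain_def X_def)
    have "derivation_graph (\<Union>C)"
      unfolding derivation_graph_def
    proof (intro conjI allI impI)
      fix e :: 'r assume "e * e = e"
      then show "(e, 0) \<in> \<Union>C" using C(1) sub graph_idem by blast
    next
      fix a b c d assume "(a, b) \<in> \<Union>C" "(c, d) \<in> \<Union>C"
      then obtain H where "H \<in> C" "(a, b) \<in> H" "(c, d) \<in> H" using two by blast
      then show "(a + c, b + d) \<in> \<Union>C" "(a * c, a * d + b * c) \<in> \<Union>C"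
        using graph_add graph_mult sub(1) by blast+
    next
      fix a b assume "(a, b) \<in> \<Union>C"
      then show "(- a, - b) \<in> \<Union>C" using graph_uminus sub(1) by blast
    next
      fix b assume "(0, b) \<in> \<Union>C"
      then show "b = 0" using sub(1) by (auto simp: derivation_graph_def)
    qed
    then show "\<Union>C \<in> X" using C(1) sub by (auto simp: X_def)
  qed
  then obtain M where M: "derivation_graph M" "G \<subseteq> M"
    and max: "\<And>H. derivation_graph H \<Longrightarrow> M \<subseteq> H \<Longrightarrow> H = M"
    by (auto simp: X_def)
  have "\<exists>u. (y, u) \<in> M" for y
    using one_step_extension[OF M(1), of y] max by metis
  then obtain D where D: "\<And>y. (y, D y) \<in> M" by metis
  have eq: "D a = b" if "(a, b) \<in> M" for a b using graph_unique[OF M(1) D that] .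
  show ?thesis
  proof
    show "D (a + b) = D a + D b" for a b by (rule eq[OF graph_add[OF M(1) D D]])
    show "D (a * b) = a * D b + D a * b" for a b by (rule eq[OF graph_mult[OF M(1) D D]])
    show "(a, b) \<in> G \<Longrightarrow> D a = b" for a b using M(2) eq by blast
  qed
qed

section \<open>Commutative C*-algebras\<close>

lemma scaleC_zero_left [simp]: "0 *\<^sub>C (x :: 'a::complex_banach) = 0"
  using scaleC_of_real[of 0 x] by simp

lemma scaleC_zero_right [simp]: "c *\<^sub>C (0 :: 'a::complex_banach) = 0"
  using scaleC_add_right[of c 0 "0::'a"] by simp

lemma scaleC_one [simp]: "1 *\<^sub>C (x :: 'a::complex_banach) = x"
  using scaleC_of_real[of 1 x] by simp

lemma scaleC_minus_right: "c *\<^sub>C (- x :: 'a::complex_banach) = - (c *\<^sub>C x)"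
  using scaleC_add_right[of c x "- x"] by (simp add: eq_neg_iff_add_eq_0 add.commute)

lemma scaleC_minus_left: "(- c) *\<^sub>C (x :: 'a::complex_banach) = - (c *\<^sub>C x)"
  using scaleC_add_left[of c "- c" x] by (simp add: eq_neg_iff_add_eq_0 add.commute)

lemma scaleC_diff_right: "c *\<^sub>C (x - y :: 'a::complex_banach) = c *\<^sub>C x - c *\<^sub>C y"
  using scaleC_add_right[of c x "- y"] by (simp add: scaleC_minus_right)

lemma scaleC_diff_left: "(c - d) *\<^sub>C (x :: 'a::complex_banach) = c *\<^sub>C x - d *\<^sub>C x"
  using scaleC_add_left[of c "- d" x] by (simp add: scaleC_minus_left)

lemma scaleC_mult_right: "x * (c *\<^sub>C y) = c *\<^sub>C (x * y :: 'a::comm_cstar_algebra)"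
  using scaleC_mult_left[of c y x] by (simp add: mult.commute)

lemma star_one [simp]: "star (1 :: 'a::comm_cstar_algebra) = 1"
proof -
  have "star (star 1 * 1) = star 1 * star (star (1 :: 'a))" by (rule star_mult)
  then show ?thesis by (simp add: star_star)
qed

lemma star_zero [simp]: "star (0 :: 'a::comm_cstar_algebra) = 0"
  using star_add[of "0::'a" 0] by simp

lemma star_minus: "star (- x :: 'a::comm_cstar_algebra) = - star x"
  using star_add[of x "- x"] by (simp add: eq_neg_iff_add_eq_0 add.commute)

lemma star_diff: "star (x - y :: 'a::comm_cstar_algebra) = star x - star y"
  using star_add[of x "- y"] by (simp add: star_minus)

lemma star_times: "star (x * y :: 'a::comm_cstar_algebra) = star x * star y"
  by (simp add: star_mult mult.commute)

lemma star_scaleR: "star (r *\<^sub>R x :: 'a::comm_cstar_algebra) = r *\<^sub>R star x"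
  using star_scaleC[of "complex_of_real r" x] by (simp add: scaleC_of_real)

lemma norm_star: "norm (star x :: 'a::comm_cstar_algebra) = norm x"
proof -
  have *: "norm y \<le> norm (star y)" for y :: 'a
  proof (cases "y = 0")
    case False
    have "(norm y)\<^sup>2 \<le> norm (star y) * norm y"
      using norm_mult_ineq[of "star y" y] by (simp add: cstar_identity)
    then show ?thesis using False by (simp add: power2_eq_square)
  qed simp
  show ?thesis using *[of x] *[of "star x"] by (simp add: star_star)
qed

lemma norm_self_adjoint_square:
  "star a = a \<Longrightarrow> norm (a * a :: 'a::comm_cstar_algebra) = (norm a)\<^sup>2"
  using cstar_identity[of a] by simp

text \<open>The iteration \<open>b \<mapsto> (t + b\<^sup>2) / 2\<close> converges to \<open>1 - \<surd>(1 - t)\<close>. It is dominated, step by step, by the same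
  iteration on real numbers for \<open>t = 1\<close>, which also covers \<open>\<parallel>t\<parallel> = 1\<close>.\<close>

lemma sqrt_exists:
  fixes t :: "'a::comm_cstar_algebra"
  assumes t: "star t = t" "norm t \<le> 1"
  obtains d where "star d = d" "d * d = 1 - t" "norm (1 - d) \<le> 1"
proof -
  define b where "b = (\<lambda>n. ((\<lambda>b. (1/2) *\<^sub>R (t + b * b)) ^^ n) 0)"
  define s :: "nat \<Rightarrow> real" where "s = (\<lambda>n. ((\<lambda>s. (1 + s * s) / 2) ^^ n) 0)"
  have b0: "b 0 = 0" and bS: "b (Suc n) = (1/2) *\<^sub>R (t + b n * b n)" for n by (simp_all add: b_def)
  have s0: "s 0 = 0" and sS: "s (Suc n) = (1 + s n * s n) / 2" for n by (simp_all add: s_def)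
  have s01: "0 \<le> s n \<and> s n \<le> 1" for n
    by (induction n) (auto simp: s0 sS mult_le_one intro: add_nonneg_nonneg)
  have bs: "norm (b n) \<le> s n" for n
  proof (induction n)
    case (Suc n)
    have "norm (b n * b n) \<le> norm (b n) * norm (b n)" by (rule norm_mult_ineq)
    also have "\<dots> \<le> s n * s n" by (intro mult_mono Suc) (use s01 in auto)
    finally have "norm (t + b n * b n) \<le> 1 + s n * s n" using norm_triangle_ineq[of t "b n * b n"] t by linarith
    then show ?case by (simp add: bS sS)
  qed (simp add: b0 s0)
  have step: "norm (b (Suc n) - b n) \<le> s (Suc n) - s n" for n
  proof (induction n)
    case 0 show ?case using t by (simp add: b0 bS s0 sS)
  next
    case (Suc n)
    have "b (Suc (Suc n)) - b (Suc n) = (1/2) *\<^sub>R ((b (Suc n) - b n) * (b (Suc n) + b n))"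
      by (simp only: bS[of "Suc n"] bS[of n] scaleR_diff_right[symmetric]) (simp add: algebra_simps bS)
    then have "norm (b (Suc (Suc n)) - b (Suc n)) = (1/2) * norm ((b (Suc n) - b n) * (b (Suc n) + b n))"
      by simp
    also have "norm ((b (Suc n) - b n) * (b (Suc n) + b n)) \<le> norm (b (Suc n) - b n) * norm (b (Suc n) + b n)"
      by (rule norm_mult_ineq)
    also have "\<dots> \<le> (s (Suc n) - s n) * (s (Suc n) + s n)"
    proof (rule mult_mono[OF Suc])
      show "norm (b (Suc n) + b n) \<le> s (Suc n) + s n"
        using norm_triangle_ineq[of "b (Suc n)" "b n"] bs[of n] bs[of "Suc n"] by linarith
      show "0 \<le> s (Suc n) - s n" using Suc norm_ge_zero order_trans by blast
    qed simp
    also have "(1/2) * \<dots> = s (Suc (Suc n)) - s (Suc n)"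
      by (simp only: sS[of "Suc n"] sS[of n]) (simp add: algebra_simps sS power2_eq_square add_divide_distrib diff_divide_distrib)
    finally show ?case by simp
  qed
  have diff: "norm (b (n + k) - b n) \<le> s (n + k) - s n" for n k
  proof (induction k)
    case (Suc k)
    have "norm (b (n + Suc k) - b n) \<le> norm (b (Suc (n + k)) - b (n + k)) + norm (b (n + k) - b n)"
      using norm_triangle_ineq[of "b (Suc (n + k)) - b (n + k)" "b (n + k) - b n"] by simp
    then show ?case using Suc step[of "n + k"] by simp
  qed simp
  have "s n \<le> s (Suc n)" for n using step[of n] norm_ge_zero[of "b (Suc n) - b n"] by linarith
  then have inc: "incseq s" by (rule incseq_SucI)
  then obtain L where "s \<longlonglongrightarrow> L" using incseq_convergent[of s 1] s01 by blast
  then have cs: "Cauchy s" by (rule LIMSEQ_imp_Cauchy)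
  have "Cauchy b"
  proof (rule metric_CauchyI)
    fix e :: real assume "e > 0"
    then obtain M where M: "\<And>m n. m \<ge> M \<Longrightarrow> n \<ge> M \<Longrightarrow> dist (s m) (s n) < e"
      using cs by (meson metric_CauchyD)
    have key: "dist (b m) (b n) < e" if "m \<ge> n" "n \<ge> M" for m n
    proof -
      obtain k where k: "m = n + k" using \<open>m \<ge> n\<close> le_Suc_ex by blast
      have "dist (b m) (b n) \<le> s m - s n" using diff[of n k] by (simp add: dist_norm k)
      also have "\<dots> \<le> dist (s m) (s n)" by (simp add: dist_real_def)
      also have "\<dots> < e" using M that by auto
      finally show ?thesis .
    qed
    show "\<exists>M. \<forall>m\<ge>M. \<forall>n\<ge>M. dist (b m) (b n) < e"
      using key by (metis dist_commute nat_le_linear)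
  qed
  then obtain B where B: "b \<longlonglongrightarrow> B" by (metis Cauchy_convergent convergentD)
  have "(\<lambda>n. b (Suc n)) \<longlonglongrightarrow> (1/2) *\<^sub>R (t + B * B)" unfolding bS by (intro tendsto_intros B)
  then have BB: "B = (1/2) *\<^sub>R (t + B * B)" using LIMSEQ_Suc[OF B] LIMSEQ_unique by blast
  have sb: "star (b n) = b n" for n
    by (induction n) (simp_all add: b0 bS star_scaleR star_add star_times t)
  have "(\<lambda>n. star (b n) - star B) \<longlonglongrightarrow> 0"
  proof (rule Lim_null_comparison)
    show "\<forall>\<^sub>F n in sequentially. norm (star (b n) - star B) \<le> norm (b n - B)"
      by (simp add: norm_star star_diff[symmetric])
    show "(\<lambda>n. norm (b n - B)) \<longlonglongrightarrow> 0" using B by (simp add: LIM_zero tendsto_norm_zero)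
  qed
  then have "b \<longlonglongrightarrow> star B" using sb LIM_zero_iff by auto
  then have sB: "star B = B" using B LIMSEQ_unique by blast
  show ?thesis
  proof
    show "star (1 - B) = 1 - B" by (simp add: star_diff sB)
    have "2 *\<^sub>R B = t + B * B" by (subst BB) simp
    then have "B + B = t + B * B" by (simp add: scaleR_2)
    then show "(1 - B) * (1 - B) = 1 - t" by (simp add: algebra_simps)
    have "norm (b n) \<le> 1" for n using bs[of n] s01[of n] by linarith
    then show "norm (1 - (1 - B)) \<le> 1"
      using LIMSEQ_le_const2[OF tendsto_norm[OF B]] by auto
  qed
qed

text \<open>The double angle formula: \<open>u = d + \<i> \<surd>(1 - d\<^sup>2)\<close> is unitary and \<open>2 d\<^sup>2 - 1\<close> is the real part of \<open>u\<^sup>2\<close>.\<close>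

lemma norm_double_square_minus_one:
  fixes d :: "'a::comm_cstar_algebra"
  assumes d: "star d = d" "norm d \<le> 1"
  shows "norm (2 *\<^sub>R (d * d) - 1) \<le> 1"
proof -
  have "norm (d * d) \<le> 1" using d by (simp add: norm_self_adjoint_square power_le_one)
  then obtain c where c: "star c = c" "c * c = 1 - d * d"
    using sqrt_exists[of "d * d"] d by (auto simp: star_times)
  define u where "u = d + \<i> *\<^sub>C c"
  have su: "star u = d - \<i> *\<^sub>C c" by (simp add: u_def star_add star_scaleC d c scaleC_minus_left)
  have ii: "(\<i> *\<^sub>C c) * (\<i> *\<^sub>C c) = - (c * c)"
    by (simp add: scaleC_mult_left scaleC_mult_right scaleC_scaleC scaleC_minus_left)
  have "star u * u = d * d - (\<i> *\<^sub>C c) * (\<i> *\<^sub>C c)" unfolding su by (simp add: u_def algebra_simps)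
  then have "star u * u = 1" using ii c by simp
  then have "(norm u)\<^sup>2 = 1" using cstar_identity[of u] by simp
  then have nu: "norm u = 1" by (simp add: power2_eq_1_iff) (use norm_ge_zero[of u] in linarith)
  have "u * u + star u * star u = 2 *\<^sub>R (d * d + (\<i> *\<^sub>C c) * (\<i> *\<^sub>C c))"
    unfolding su by (simp add: u_def algebra_simps scaleR_2)
  also have "\<dots> = 2 *\<^sub>R (2 *\<^sub>R (d * d) - 1)" using ii c by (simp add: scaleR_2)
  finally have "2 * norm (2 *\<^sub>R (d * d) - 1) = norm (u * u + star u * star u)" by simp
  also have "\<dots> \<le> norm u * norm u + norm (star u) * norm (star u)"
    by (meson add_mono norm_mult_ineq norm_triangle_le)
  finally show ?thesis using nu by (simp add: norm_star)
qed

lemma norm_projection_le: "projection p \<Longrightarrow> norm (p :: 'a::comm_cstar_algebra) \<le> 1"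
proof -
  assume "projection p"
  then have "norm p = norm p * norm p"
    using norm_self_adjoint_square[of p] by (simp add: projection_def power2_eq_square)
  then show ?thesis by (metis mult_cancel_right1 norm_ge_zero order_refl zero_le_one)
qed

lemma norm_projection: "projection p \<Longrightarrow> p \<noteq> 0 \<Longrightarrow> norm (p :: 'a::comm_cstar_algebra) = 1"
  using norm_self_adjoint_square[of p] by (simp add: projection_def power2_eq_square)

lemma norm_projection_mult_le:
  "projection p \<Longrightarrow> norm (p * x :: 'a::comm_cstar_algebra) \<le> norm x"
  using norm_mult_ineq[of p x] norm_projection_le[of p]
  by (meson mult_left_le_one_le norm_ge_zero order_trans)

lemma projection_idem: "projection p \<Longrightarrow> p * p = p" by (simp add: projection_def)

lemma projection_star: "projection p \<Longrightarrow> star p = p" by (simp add: projection_def)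

lemma projection_zero [simp]: "projection (0 :: 'a::comm_cstar_algebra)" by (simp add: projection_def)

lemma projection_one [simp]: "projection (1 :: 'a::comm_cstar_algebra)" by (simp add: projection_def)

lemma projection_compl: "projection p \<Longrightarrow> projection (1 - p :: 'a::comm_cstar_algebra)"
  by (simp add: projection_def star_diff algebra_simps)

lemma projection_mult: "projection p \<Longrightarrow> projection q \<Longrightarrow> projection (p * q :: 'a::comm_cstar_algebra)"
  by (simp add: projection_def star_times mult_ac) (metis mult.assoc)

lemma projection_absorb [simp]: "projection p \<Longrightarrow> p * (p * x) = p * x"
  by (metis mult.assoc projection_idem)

lemma projection_diff:
  assumes "projection p" "projection q" "p * q = p"
  shows "projection (q - p :: 'a::comm_cstar_algebra)"
proof -
  have "q - p = q * (1 - p)" using assms(3) by (simp add: algebra_simps)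
  then show ?thesis using assms projection_mult projection_compl by metis
qed

lemma projection_join:
  assumes "projection p" "projection q"
  shows "projection (p + q - p * q :: 'a::comm_cstar_algebra)"
proof -
  have "p + q - p * q = 1 - (1 - p) * (1 - q)" by (simp add: algebra_simps)
  then show ?thesis using assms by (metis projection_compl projection_mult)
qed

lemma le_of_power_le:
  fixes a d :: real
  assumes "0 \<le> a" "0 \<le> d" and le: "\<And>n. a ^ (2 ^ n) \<le> 2 * d ^ (2 ^ n)"
  shows "a \<le> d"
proof (rule ccontr)
  assume "\<not> a \<le> d"
  then have ad: "d < a" by simp
  have d: "d > 0" using le[of 0] ad assms(2) by (cases "d = 0") auto
  have "1 < a / d" using ad d by simp
  then obtain k where k: "2 < (a / d) ^ k" using real_arch_pow by blast
  have "(a / d) ^ k \<le> (a / d) ^ (2 ^ k)"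
    using \<open>1 < a / d\<close> by (intro power_increasing) (auto intro: less_imp_le)
  also have "\<dots> \<le> 2" using le[of k] d by (simp add: power_divide divide_simps)
  finally show False using k by simp
qed

text \<open>In a C*-algebra orthogonal summands give the maximum norm. For \<open>y = x\<^sup>* x\<close> the triangle inequality
  gives \<open>\<parallel>y\<parallel>\<^sup>k \<le> 2 r\<^sup>2\<^sup>k\<close> whenever \<open>k\<close> is a power of two, and the factor disappears in the limit.\<close>

lemma norm_le_of_split:
  fixes x :: "'a::comm_cstar_algebra"
  assumes e: "projection e" and le: "norm (e * x) \<le> r" "norm ((1 - e) * x) \<le> r"
  shows "norm x \<le> r"
proof -
  have r0: "0 \<le> r" using le(1) norm_ge_zero order_trans by blast
  define y where "y = star x * x"
  have sy: "star y = y" by (simp add: y_def star_times star_star mult.commute)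
  have ny: "norm (f * y) \<le> r\<^sup>2" if f: "projection f" "norm (f * x) \<le> r" for f
  proof -
    have "star (f * x) * (f * x) = f * (f * y)"
      using f by (simp add: y_def star_times projection_star mult_ac)
    then have "f * y = star (f * x) * (f * x)" using f by simp
    then have "norm (f * y) = (norm (f * x))\<^sup>2" by (simp add: cstar_identity)
    then show ?thesis using f by (simp add: power_mono)
  qed
  have pw: "norm (y ^ (2 ^ n)) = norm y ^ (2 ^ n)" for n
  proof (induction n)
    case (Suc n)
    have st: "star (y ^ k) = y ^ k" for k by (induction k) (simp_all add: star_times sy)
    have "norm (y ^ (2 ^ Suc n)) = norm (y ^ (2 ^ n) * y ^ (2 ^ n))" by (simp add: power_add[symmetric] mult_2)
    also have "\<dots> = (norm (y ^ (2 ^ n)))\<^sup>2" by (rule norm_self_adjoint_square[OF st])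
    finally show ?case using Suc by (simp add: power_mult[symmetric] mult.commute)
  qed simp
  have spl: "y ^ Suc k = (e * y) ^ Suc k + ((1 - e) * y) ^ Suc k" for k
  proof -
    have idp: "f ^ Suc k = f" if "projection f" for f :: 'a
      by (induction k) (simp_all add: projection_idem that)
    show ?thesis using idp[OF e] idp[OF projection_compl[OF e]]
      by (simp only: power_mult_distrib) (simp add: algebra_simps)
  qed
  have "norm y \<le> r\<^sup>2"
  proof (rule le_of_power_le)
    fix n :: nat
    obtain k where k: "(2::nat) ^ n = Suc k" by (metis not0_implies_Suc power_not_zero zero_neq_numeral)
    have "norm y ^ (2 ^ n) = norm ((e * y) ^ (2 ^ n) + ((1 - e) * y) ^ (2 ^ n))"
      using pw[of n] spl[of k] k by simp
    also have "\<dots> \<le> norm (e * y) ^ (2 ^ n) + norm ((1 - e) * y) ^ (2 ^ n)"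
      by (meson add_mono norm_power_ineq norm_triangle_le)
    also have "\<dots> \<le> (r\<^sup>2) ^ (2 ^ n) + (r\<^sup>2) ^ (2 ^ n)"
      by (intro add_mono power_mono ny e projection_compl le norm_ge_zero)
    finally show "norm y ^ (2 ^ n) \<le> 2 * (r\<^sup>2) ^ (2 ^ n)" by simp
  qed auto
  then have "(norm x)\<^sup>2 \<le> r\<^sup>2" by (simp add: y_def cstar_identity)
  then show ?thesis using r0 by (simp add: power2_le_iff_abs_le)
qed

section \<open>Projections in a commutative AW*-algebra\<close>

text \<open>The supremum, characterised by annihilators; this form applies to products with arbitrary elements
  and is what the Baer property provides.\<close>

definition psup :: "'a::comm_awstar_algebra set \<Rightarrow> 'a"
  where "psup E = (SOME r. projection r \<and> (\<forall>x. r * x = 0 \<longleftrightarrow> (\<forall>e\<in>E. e * x = 0)))"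

lemma psup: "projection (psup E)" "psup E * x = 0 \<longleftrightarrow> (\<forall>e\<in>E. e * x = 0)"
proof -
  obtain p :: 'a where p: "star p = p" "p * p = p" "{x. \<forall>s\<in>E. s * x = 0} = {p * a | a. True}"
    using baer by blast
  have "(1 - p) * x = 0 \<longleftrightarrow> (\<forall>e\<in>E. e * x = 0)" for x
  proof -
    have "(\<forall>e\<in>E. e * x = 0) \<longleftrightarrow> x \<in> {p * a | a. True}" using p(3) by blast
    also have "\<dots> \<longleftrightarrow> p * x = x" using p(2) by (auto simp: mult.assoc[symmetric]) metis
    also have "\<dots> \<longleftrightarrow> (1 - p) * x = 0" by (auto simp: algebra_simps)
    finally show ?thesis by simp
  qed
  moreover have "projection (1 - p)" using p projection_compl by (auto simp: projection_def)
  ultimately have "\<exists>r. projection r \<and> (\<forall>x. r * x = 0 \<longleftrightarrow> (\<forall>e\<in>E. e * x = 0))" by blast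
  from someI_ex[OF this]
  show "projection (psup E)" "psup E * x = 0 \<longleftrightarrow> (\<forall>e\<in>E. e * x = 0)"
    by (auto simp: psup_def)
qed

lemma le_iff_compl: "p * (1 - q) = 0 \<longleftrightarrow> p * q = (p :: 'a::comm_cstar_algebra)"
  by (auto simp: algebra_simps)

lemma psup_upper: "e \<in> E \<Longrightarrow> e * psup E = e"
proof -
  assume "e \<in> E"
  moreover have "psup E * (1 - psup E) = 0" using psup(1)[of E] by (simp add: le_iff_compl projection_idem)
  ultimately have "e * (1 - psup E) = 0" by (simp add: psup(2))
  then show ?thesis by (simp add: le_iff_compl)
qed

lemma psup_least: "(\<And>e. e \<in> E \<Longrightarrow> e * q = e) \<Longrightarrow> psup E * q = psup E"
  using psup(2)[of E "1 - q"] by (simp add: le_iff_compl)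

lemma psup_meets:
  assumes "x * psup E \<noteq> 0" obtains e where "e \<in> E" "x * e \<noteq> 0"
  using assms psup(2)[of E x] by (auto simp: mult.commute)

lemma le_antisym: "p * q = p \<Longrightarrow> q * p = q \<Longrightarrow> p = (q :: 'a::comm_cstar_algebra)"
  by (simp add: mult.commute)

lemma le_trans_mult: "p * q = p \<Longrightarrow> q * r = q \<Longrightarrow> p * r = (p :: 'a::comm_cstar_algebra)"
  by (metis mult.assoc)

text \<open>Here \<open>b = |a|\<close> and \<open>(b + a) (b - a) = 0\<close>, so the Baer property separates the two factors: \<open>a = b\<close> on \<open>q\<close> and
  \<open>a = - b\<close> on \<open>1 - q\<close>. As \<open>b\<close> is a square of an element of norm at most one, \<open>2 b - 1\<close> has norm at most one.\<close>

lemma bisection: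
  fixes a :: "'a::comm_awstar_algebra"
  assumes a: "star a = a" "norm a \<le> 1"
  obtains e where "projection e" "norm (e * (2 *\<^sub>R a - 1)) \<le> 1" "norm ((1 - e) * (2 *\<^sub>R a + 1)) \<le> 1"
proof -
  have "norm (2 *\<^sub>R (a * a) - 1) \<le> 1" by (rule norm_double_square_minus_one[OF a])
  then have "norm (1 - (2 *\<^sub>R (a * a) - 1)) \<le> 2"
    using norm_triangle_ineq4[of 1 "2 *\<^sub>R (a * a) - 1"] by simp
  moreover have "1 - (2 *\<^sub>R (a * a) - 1) = 2 *\<^sub>R (1 - a * a)" by (simp add: scaleR_2)
  ultimately have "norm (1 - a * a) \<le> 1" by simp
  then obtain b where b: "star b = b" "b * b = a * a" "norm (1 - b) \<le> 1"
    using sqrt_exists[of "1 - a * a"] a by (auto simp: star_diff star_times)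
  then obtain d where d: "star d = d" "d * d = b"
    using sqrt_exists[of "1 - b"] by (auto simp: star_diff)
  have "(norm b)\<^sup>2 = (norm a)\<^sup>2" using norm_self_adjoint_square[OF b(1)] norm_self_adjoint_square[OF a(1)] b(2) by simp
  then have "norm b \<le> 1" using a(2) by simp
  then have "norm d \<le> 1" using norm_self_adjoint_square[OF d(1)] d(2)
    by (simp add: power2_le_iff_abs_le abs_square_le_1)
  then have nb: "norm (2 *\<^sub>R b - 1) \<le> 1" using norm_double_square_minus_one[of d] d by simp
  define q where "q = psup {b + a}"
  have q: "projection q" unfolding q_def by (rule psup)
  have "(b + a) * (b - a) = 0" using b(2) by (simp add: algebra_simps)
  then have "q * (b - a) = 0" unfolding q_def by (simp add: psup)
  then have qa: "q * a = q * b" by (simp add: algebra_simps)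
  have "(b + a) * (1 - q) = 0" using psup_upper[of "b + a" "{b + a}"] q_def by (simp add: le_iff_compl)
  then have pa: "(1 - q) * a = - ((1 - q) * b)" by (simp add: algebra_simps)
  show ?thesis
  proof
    show "projection q" by (rule q)
    have "q * (2 *\<^sub>R a - 1) = q * (2 *\<^sub>R b - 1)" using qa by (simp add: right_diff_distrib)
    then show "norm (q * (2 *\<^sub>R a - 1)) \<le> 1" using norm_projection_mult_le[OF q] nb by (metis order_trans)
    have "(1 - q) * (2 *\<^sub>R a + 1) = - ((1 - q) * (2 *\<^sub>R b - 1))" using pa
      by (simp add: distrib_left right_diff_distrib del: left_diff_distrib')
    then show "norm ((1 - q) * (2 *\<^sub>R a + 1)) \<le> 1"
      using norm_projection_mult_le[OF projection_compl[OF q], of "2 *\<^sub>R b - 1"] nb by simp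
  qed
qed

section \<open>The Stone space of the projections\<close>

definition clop :: "'a::comm_awstar_algebra \<Rightarrow> 'a set set"
  where "clop p = {U. ultrafilter U \<and> p \<in> U}"

lemma ultrafilter_proj: "ultrafilter U \<Longrightarrow> p \<in> U \<Longrightarrow> projection p"
  by (auto simp: ultrafilter_def)

lemma ultrafilter_one: "ultrafilter U \<Longrightarrow> 1 \<in> U"
  by (auto simp: ultrafilter_def)

lemma ultrafilter_zero: "ultrafilter U \<Longrightarrow> 0 \<notin> U"
  by (auto simp: ultrafilter_def)

lemma ultrafilter_mult: "ultrafilter U \<Longrightarrow> p \<in> U \<Longrightarrow> q \<in> U \<Longrightarrow> p * q \<in> U"
  by (auto simp: ultrafilter_def)

lemma ultrafilter_up: "ultrafilter U \<Longrightarrow> p \<in> U \<Longrightarrow> projection q \<Longrightarrow> p * q = p \<Longrightarrow> q \<in> U"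
  by (auto simp: ultrafilter_def)

lemma ultrafilter_compl: assumes "ultrafilter U" "projection p" shows "1 - p \<in> U \<longleftrightarrow> p \<notin> U"
proof -
  have "\<not> (1 - p \<in> U \<and> p \<in> U)"
  proof
    assume "1 - p \<in> U \<and> p \<in> U"
    then have "(1 - p) * p \<in> U" using assms(1) by (auto intro: ultrafilter_mult)
    then show False using assms by (simp add: left_diff_distrib projection_idem ultrafilter_zero)
  qed
  then show ?thesis using assms by (auto simp: ultrafilter_def)
qed

lemma ultrafilter_mult_iff:
  assumes "ultrafilter U" "projection p" "projection q"
  shows "p * q \<in> U \<longleftrightarrow> p \<in> U \<and> q \<in> U"
proof
  assume "p * q \<in> U"
  moreover have "p * q * p = p * q" "p * q * q = p * q"
    using assms by (simp_all add: mult_ac projection_idem)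
  ultimately show "p \<in> U \<and> q \<in> U" using assms ultrafilter_up by blast
qed (use assms ultrafilter_mult in blast)

text \<open>A maximal multiplicative set of projections without \<open>0\<close> is an ultrafilter.\<close>

lemma ultrafilter_extends:
  fixes F :: "'a::comm_awstar_algebra set"
  assumes F: "F \<subseteq> {p. projection p}" "1 \<in> F" "0 \<notin> F" "\<And>p q. p \<in> F \<Longrightarrow> q \<in> F \<Longrightarrow> p * q \<in> F"
  obtains U where "ultrafilter U" "F \<subseteq> U"
proof -
  define X where "X = {H. H \<subseteq> {p. projection p} \<and> F \<subseteq> H \<and> 0 \<notin> H \<and> (\<forall>p\<in>H. \<forall>q\<in>H. p * q \<in> H)}"
  have "\<exists>M\<in>X. \<forall>H\<in>X. M \<subseteq> H \<longrightarrow> H = M"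
  proof (rule subset_Zorn_nonempty)
    show "X \<noteq> {}" using F by (auto simp: X_def)
    fix C assume C: "C \<noteq> {}" "subset.chain X C"
    have sub: "C \<subseteq> X" using C by (auto simp: subset_chain_def)
    have "p * q \<in> \<Union>C" if pq: "p \<in> \<Union>C" "q \<in> \<Union>C" for p q
    proof -
      obtain H K where *: "H \<in> C" "p \<in> H" "K \<in> C" "q \<in> K" using pq by blast
      then have "H \<subseteq> K \<or> K \<subseteq> H" using C(2) by (auto simp: subset_chain_def)
      then obtain L where "L \<in> C" "p \<in> L" "q \<in> L" using * by blast
      then show ?thesis using sub by (auto simp: X_def)
    qed
    moreover have "F \<subseteq> \<Union>C"
    proof -
      obtain H where "H \<in> C" using C(1) by blast
      then have "F \<subseteq> H" using sub by (auto simp: X_def)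
      then show ?thesis using \<open>H \<in> C\<close> by blast
    qed
    ultimately show "\<Union>C \<in> X" using sub by (auto simp: X_def)
  qed
  then obtain M where M: "M \<in> X" and max: "\<And>H. H \<in> X \<Longrightarrow> M \<subseteq> H \<Longrightarrow> H = M" by blast
  have Mp: "\<And>p. p \<in> M \<Longrightarrow> projection p" "F \<subseteq> M" "0 \<notin> M" "\<And>p q. p \<in> M \<Longrightarrow> q \<in> M \<Longrightarrow> p * q \<in> M"
    using M by (auto simp: X_def)
  have M1: "1 \<in> M" using Mp F by blast
  have adj: "q \<in> M" if q: "projection q" and nz: "\<And>g. g \<in> M \<Longrightarrow> g * q \<noteq> 0" for q
  proof -
    define H where "H = M \<union> (\<lambda>g. g * q) ` M"
    have "H \<in> X"
      unfolding X_def
    proof (intro CollectI conjI ballI)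
      show "H \<subseteq> {p. projection p}" using Mp q by (auto simp: H_def intro: projection_mult)
      show "F \<subseteq> H" using Mp by (auto simp: H_def)
      show "0 \<notin> H" using Mp nz by (force simp: H_def)
      fix a b assume "a \<in> H" "b \<in> H"
      then consider "a \<in> M" "b \<in> M" | g where "g \<in> M" "a = g * q" "b \<in> M"
        | g where "g \<in> M" "b = g * q" "a \<in> M"
        | g h where "g \<in> M" "h \<in> M" "a = g * q" "b = h * q" by (auto simp: H_def)
      then show "a * b \<in> H"
      proof cases
        case 1 then show ?thesis using Mp by (auto simp: H_def)
      next
        case 2
        then have "a * b = (g * b) * q" by (simp add: mult_ac)
        then have "a * b \<in> (\<lambda>g. g * q) ` M" using Mp(4)[OF 2(1,3)] by (rule image_eqI)
        then show ?thesis by (simp add: H_def)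
      next
        case 3
        then have "a * b = (a * g) * q" by (simp add: mult_ac)
        then have "a * b \<in> (\<lambda>g. g * q) ` M" using Mp(4)[OF 3(3,1)] by (rule image_eqI)
        then show ?thesis by (simp add: H_def)
      next
        case 4
        then have "a * b = (g * h) * q" using q by (simp add: mult_ac projection_idem)
        then have "a * b \<in> (\<lambda>g. g * q) ` M" using Mp(4)[OF 4(1,2)] by (rule image_eqI)
        then show ?thesis by (simp add: H_def)
      qed
    qed
    then have "H = M" using max by (auto simp: H_def)
    moreover have "1 * q \<in> H" using M1 unfolding H_def by blast
    ultimately show ?thesis by simp
  qed
  have "ultrafilter M"
    unfolding ultrafilter_def
  proof (intro conjI ballI allI impI)
    show "M \<subseteq> {p. projection p}" using Mp by auto
    show "1 \<in> M" "0 \<notin> M" using M1 Mp by auto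
    show "p * q \<in> M" if "p \<in> M" "q \<in> M" for p q using Mp that by auto
  next
    fix p q assume p: "p \<in> M" and q: "projection q \<and> p * q = p"
    show "q \<in> M"
    proof (rule adj)
      fix g assume "g \<in> M"
      then have "g * p \<noteq> 0" using p Mp by metis
      moreover have "g * p = g * q * p" using q by (metis mult.assoc mult.commute)
      ultimately show "g * q \<noteq> 0" by auto
    qed (use q in auto)
  next
    fix p :: 'a assume p: "projection p"
    show "p \<in> M \<or> 1 - p \<in> M"
    proof (rule ccontr)
      assume n: "\<not> (p \<in> M \<or> 1 - p \<in> M)"
      then obtain g where g: "g \<in> M" "g * p = 0" using adj[OF p] by blast
      from n obtain h where h: "h \<in> M" "h * (1 - p) = 0" using adj[OF projection_compl[OF p]] by blast
      have "g * h = h * (g * p) + g * (h * (1 - p))" by (simp add: algebra_simps)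
      then have "g * h = 0" using g h by simp
      then show False using g h Mp by metis
    qed
  qed
  then show ?thesis using that Mp by blast
qed

lemma clop_nonempty: assumes "projection p" "p \<noteq> 0" obtains U where "U \<in> clop p"
proof -
  obtain U where "ultrafilter U" "{1, p} \<subseteq> U"
    by (rule ultrafilter_extends[of "{1, p}"]) (use assms in \<open>auto simp: projection_idem\<close>)
  then show ?thesis using that by (auto simp: clop_def)
qed

lemma clop_mult: "projection p \<Longrightarrow> projection q \<Longrightarrow> clop (p * q) = clop p \<inter> clop q"
  by (auto simp: clop_def ultrafilter_mult_iff)

lemma clop_compl: "projection p \<Longrightarrow> clop (1 - p) = {U. ultrafilter U} - clop p"
  by (auto simp: clop_def ultrafilter_compl)

lemma clop_empty_iff: "projection p \<Longrightarrow> clop p = {} \<longleftrightarrow> p = 0"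
  by (auto simp: clop_def ultrafilter_zero elim: clop_nonempty) (metis clop_def clop_nonempty empty_Collect_eq mem_Collect_eq)

lemma clop_subset_iff:
  assumes "projection p" "projection q" shows "clop p \<subseteq> clop q \<longleftrightarrow> p * q = p"
proof -
  have "clop (p * (1 - q)) = clop p \<inter> ({U. ultrafilter U} - clop q)"
    using assms by (simp add: clop_mult clop_compl projection_compl)
  moreover have "clop p \<subseteq> {U. ultrafilter U}" by (auto simp: clop_def)
  ultimately have "clop p \<subseteq> clop q \<longleftrightarrow> clop (p * (1 - q)) = {}" by blast
  then show ?thesis using assms by (simp add: clop_empty_iff projection_mult projection_compl le_iff_compl)
qed

text \<open>Compactness of the Stone space in the form in which it is used: the covering property and
  closure under finite joins give the whole space.\<close>

lemma compact_ideal: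
  fixes J :: "'a::comm_awstar_algebra set"
  assumes J: "\<And>p. p \<in> J \<Longrightarrow> projection p" "0 \<in> J" "\<And>p q. p \<in> J \<Longrightarrow> q \<in> J \<Longrightarrow> p + q - p * q \<in> J"
    and cover: "\<And>U. ultrafilter U \<Longrightarrow> \<exists>p\<in>J. p \<in> U"
  shows "1 \<in> J"
proof (rule ccontr)
  assume n: "1 \<notin> J"
  obtain U where U: "ultrafilter U" "(\<lambda>p. 1 - p) ` J \<subseteq> U"
  proof (rule ultrafilter_extends[of "(\<lambda>p. 1 - p) ` J"])
    show "(\<lambda>p. 1 - p) ` J \<subseteq> {p. projection p}" using J projection_compl by auto
    show "1 \<in> (\<lambda>p. 1 - p) ` J" using J(2) by (auto intro!: image_eqI[of _ _ 0])
    show "0 \<notin> (\<lambda>p. 1 - p) ` J" using n by auto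
    show "a * b \<in> (\<lambda>p. 1 - p) ` J" if "a \<in> (\<lambda>p. 1 - p) ` J" "b \<in> (\<lambda>p. 1 - p) ` J" for a b
    proof -
      obtain p q where pq: "p \<in> J" "q \<in> J" "a = 1 - p" "b = 1 - q"
        using \<open>a \<in> _\<close> \<open>b \<in> _\<close> by auto
      have "a * b = 1 - (p + q - p * q)" unfolding pq(3,4) by (simp add: algebra_simps)
      then show ?thesis using J(3)[OF pq(1,2)] by blast
    qed
  qed
  then obtain p where "p \<in> J" "p \<in> U" "1 - p \<in> U" using cover by blast
  then show False using U J(1) ultrafilter_compl by blast
qed

lemma topspace_stone [simp]: "topspace stone_space = {U. ultrafilter U}"
proof -
  have "{U :: 'a set. ultrafilter U} = {U. ultrafilter U \<and> 1 \<in> U}" using ultrafilter_one by blast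
  then have "{U. ultrafilter U} \<in> {{U. ultrafilter U \<and> p \<in> U} | p :: 'a. projection p}"
    using projection_one by blast
  then show ?thesis unfolding stone_space_def topology_generated_by_topspace by blast
qed

lemma openin_clop: "projection p \<Longrightarrow> openin stone_space (clop p)"
  unfolding stone_space_def clop_def by (rule topology_generated_by_Basis) blast

lemma openin_stone_iff:
  fixes W :: "'a::comm_awstar_algebra set set"
  shows "openin stone_space W \<longleftrightarrow> W \<subseteq> {U. ultrafilter U} \<and> (\<forall>U\<in>W. \<exists>p\<in>U. clop p \<subseteq> W)"
proof
  assume W: "openin stone_space W"
  then have "generate_topology_on {{U. ultrafilter U \<and> p \<in> U} | p. projection p} W"
    by (simp add: stone_space_def openin_topology_generated_by_iff)
  then have "\<forall>U\<in>W. \<exists>p\<in>U. clop p \<subseteq> W"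
  proof induction
    case (Int a b)
    show ?case
    proof
      fix U assume U: "U \<in> a \<inter> b"
      then obtain p q where pq: "p \<in> U" "clop p \<subseteq> a" "q \<in> U" "clop q \<subseteq> b" using Int by blast
      show "\<exists>p\<in>U. clop p \<subseteq> a \<inter> b"
      proof (cases "ultrafilter U")
        case True
        then show ?thesis using pq
          by (intro bexI[of _ "p * q"]) (auto simp: clop_mult ultrafilter_proj ultrafilter_mult)
      next
        case False
        have "generate_topology_on {{U. ultrafilter U \<and> p \<in> U} | p. projection p} a \<Longrightarrow> a \<subseteq> {U. ultrafilter U}"
          using openin_subset[of "stone_space" a] by (simp add: stone_space_def[symmetric] openin_topology_generated_by_iff[symmetric])
        then show ?thesis using Int U False by blast
      qed
    qed
  next
    case (UN K) then show ?case by (meson Union_iff Union_upper order_trans)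
  next
    case (Basis s) then show ?case by (auto simp: clop_def)
  qed simp
  then show "W \<subseteq> {U. ultrafilter U} \<and> (\<forall>U\<in>W. \<exists>p\<in>U. clop p \<subseteq> W)" using openin_subset[OF W] by simp
next
  assume W: "W \<subseteq> {U. ultrafilter U} \<and> (\<forall>U\<in>W. \<exists>p\<in>U. clop p \<subseteq> W)"
  show "openin stone_space W"
  proof (subst openin_subopen, intro ballI)
    fix U assume U: "U \<in> W"
    then obtain p where "p \<in> U" "clop p \<subseteq> W" using W by blast
    moreover have "ultrafilter U" using U W by blast
    moreover have "U \<in> clop p" using calculation by (auto simp: clop_def)
    ultimately show "\<exists>T. openin stone_space T \<and> U \<in> T \<and> T \<subseteq> W"
      using openin_clop ultrafilter_proj by blast
  qed
qed

text \<open>Extremal disconnectedness, which is completeness of \<open>P(A)\<close>.\<close>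

lemma closure_of_open_is_clop:
  fixes W :: "'a::comm_awstar_algebra set set"
  assumes W: "openin stone_space W"
  shows "stone_space closure_of W = clop (psup {p. projection p \<and> clop p \<subseteq> W})"
proof -
  define E where "E = {p. projection p \<and> clop p \<subseteq> W}"
  have P: "projection (psup E)" by (rule psup)
  have sub: "W \<subseteq> clop (psup E)"
  proof
    fix U assume U: "U \<in> W"
    obtain p where p: "p \<in> U" "clop p \<subseteq> W" "ultrafilter U" using W U unfolding openin_stone_iff by blast
    then have "p \<in> E" by (auto simp: E_def ultrafilter_proj)
    then have "p * psup E = p" by (rule psup_upper)
    then show "U \<in> clop (psup E)" using p P by (auto simp: clop_def intro: ultrafilter_up)
  qed
  have "closedin stone_space (clop (psup E))"
    using openin_clop[OF projection_compl[OF P]] clop_compl[OF P]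
    by (auto simp: closedin_def clop_def)
  then have "stone_space closure_of W \<subseteq> clop (psup E)" using sub by (rule closure_of_minimal[rotated])
  moreover have "clop (psup E) \<subseteq> stone_space closure_of W"
  proof
    fix U assume U: "U \<in> clop (psup E)"
    show "U \<in> stone_space closure_of W"
      unfolding in_closure_of
    proof (intro conjI allI impI)
      show "U \<in> topspace stone_space" using U by (simp add: clop_def)
      fix T assume T: "U \<in> T \<and> openin stone_space T"
      then obtain q where q: "q \<in> U" "clop q \<subseteq> T" by (auto simp: openin_stone_iff)
      have uU: "ultrafilter U" "psup E \<in> U" using U by (auto simp: clop_def)
      then have "q * psup E \<in> U" using q ultrafilter_mult by blast
      then have "q * psup E \<noteq> 0" using uU ultrafilter_zero by metis
      then obtain p where p: "p \<in> E" "q * p \<noteq> 0" by (rule psup_meets)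
      have pr: "projection q" "projection p" using q uU p by (auto simp: E_def ultrafilter_proj)
      then obtain V where "V \<in> clop (q * p)" using p clop_nonempty projection_mult by metis
      then have "V \<in> clop q" "V \<in> clop p" using clop_mult pr by auto
      then show "\<exists>y. y \<in> W \<and> y \<in> T" using p q by (auto simp: E_def)
    qed
  qed
  ultimately show ?thesis by (auto simp: E_def)
qed

lemma eventually_nhdsin_stone:
  "ultrafilter q \<Longrightarrow> eventually P (nhdsin stone_space q) \<longleftrightarrow> (\<exists>p\<in>q. \<forall>q'\<in>clop p. P q')"
proof -
  assume q: "ultrafilter q"
  have "(\<exists>S. openin stone_space S \<and> q \<in> S \<and> (\<forall>x\<in>S. P x)) \<longleftrightarrow> (\<exists>p\<in>q. \<forall>q'\<in>clop p. P q')"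
  proof
    assume "\<exists>S. openin stone_space S \<and> q \<in> S \<and> (\<forall>x\<in>S. P x)"
    then show "\<exists>p\<in>q. \<forall>q'\<in>clop p. P q'" by (auto simp: openin_stone_iff) (meson subsetD)
  next
    assume "\<exists>p\<in>q. \<forall>q'\<in>clop p. P q'"
    then obtain p where "p \<in> q" "\<forall>q'\<in>clop p. P q'" by blast
    then show "\<exists>S. openin stone_space S \<and> q \<in> S \<and> (\<forall>x\<in>S. P x)"
      using q openin_clop[of p] by (intro exI[of _ "clop p"]) (auto simp: clop_def ultrafilter_proj)
  qed
  then show ?thesis using q by (simp add: eventually_nhdsin)
qed

lemma continuous_map_stone_iff:
  fixes f :: "'a::comm_awstar_algebra set \<Rightarrow> 'b::topological_space"
  shows "continuous_map stone_space euclidean f \<longleftrightarrow> (\<forall>q. ultrafilter q \<longrightarrow> (f \<longlongrightarrow> f q) (nhdsin stone_space q))"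
proof
  assume c: "continuous_map stone_space euclidean f"
  show "\<forall>q. ultrafilter q \<longrightarrow> (f \<longlongrightarrow> f q) (nhdsin stone_space q)"
  proof (intro allI impI topological_tendstoI)
    fix q S assume q: "ultrafilter q" and S: "open S" "f q \<in> S"
    have "openin stone_space {x \<in> topspace stone_space. f x \<in> S}"
      using c S by (auto simp: continuous_map_def)
    then show "\<forall>\<^sub>F x in nhdsin stone_space q. f x \<in> S"
      using q S by (auto simp: eventually_nhdsin intro!: exI[of _ "{x \<in> topspace stone_space. f x \<in> S}"])
  qed
next
  assume c: "\<forall>q. ultrafilter q \<longrightarrow> (f \<longlongrightarrow> f q) (nhdsin stone_space q)"
  show "continuous_map stone_space euclidean f"
    unfolding continuous_map_def
  proof (intro conjI allI impI)
    fix S :: "'b set" assume "openin euclidean S"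
    then have S: "open S" by simp
    show "openin stone_space {x \<in> topspace stone_space. f x \<in> S}"
      unfolding openin_stone_iff
    proof (intro conjI ballI)
      fix q assume "q \<in> {x \<in> topspace stone_space. f x \<in> S}"
      then have q: "ultrafilter q" "f q \<in> S" by auto
      then have "\<forall>\<^sub>F x in nhdsin stone_space q. f x \<in> S" using c S topological_tendstoD by blast
      then obtain p where "p \<in> q" "\<forall>q'\<in>clop p. f q' \<in> S" using eventually_nhdsin_stone[OF q(1)] by blast
      then show "\<exists>p\<in>q. clop p \<subseteq> {x \<in> topspace stone_space. f x \<in> S}" by (auto simp: clop_def)
    qed auto
  qed auto
qed

section \<open>Generic points\<close>

text \<open>The filter generated by the dense open sets; see \<open>eventually_generic_dense\<close>. In terms of
  projections: below each non-zero one there is another on whose clopen set the property holds.\<close>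

definition generic :: "'a::comm_awstar_algebra set filter"
  where "generic = Abs_filter (\<lambda>P. \<forall>p. projection p \<longrightarrow> p \<noteq> 0 \<longrightarrow>
    (\<exists>r. projection r \<and> r \<noteq> 0 \<and> r * p = r \<and> (\<forall>q\<in>clop r. P q)))"

lemma eventually_generic:
  "eventually P (generic :: 'a::comm_awstar_algebra set filter) \<longleftrightarrow>
    (\<forall>p. projection p \<longrightarrow> p \<noteq> 0 \<longrightarrow> (\<exists>r. projection r \<and> r \<noteq> 0 \<and> r * p = r \<and> (\<forall>q\<in>clop r. P q)))"
  unfolding generic_def
proof (rule eventually_Abs_filter, unfold is_filter_def, intro conjI allI impI)
  fix p :: 'a assume "projection p" "p \<noteq> 0"
  then show "\<exists>r. projection r \<and> r \<noteq> 0 \<and> r * p = r \<and> (\<forall>q\<in>clop r. True)"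
    by (intro exI[of _ p]) (simp add: projection_idem)
next
  fix P Q :: "'a set \<Rightarrow> bool" and p :: 'a
  assume P: "\<forall>p. projection p \<longrightarrow> p \<noteq> 0 \<longrightarrow> (\<exists>r. projection r \<and> r \<noteq> 0 \<and> r * p = r \<and> (\<forall>q\<in>clop r. P q))"
    and Q: "\<forall>p. projection p \<longrightarrow> p \<noteq> 0 \<longrightarrow> (\<exists>r. projection r \<and> r \<noteq> 0 \<and> r * p = r \<and> (\<forall>q\<in>clop r. Q q))"
    and p: "projection p" "p \<noteq> 0"
  obtain r where r: "projection r" "r \<noteq> 0" "r * p = r" "\<forall>q\<in>clop r. P q" using P p by blast
  obtain s where s: "projection s" "s \<noteq> 0" "s * r = s" "\<forall>q\<in>clop s. Q q" using Q r by blast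
  have "clop s \<subseteq> clop r" using r s clop_subset_iff by blast
  then show "\<exists>r. projection r \<and> r \<noteq> 0 \<and> r * p = r \<and> (\<forall>q\<in>clop r. P q \<and> Q q)"
    using r s le_trans_mult[OF s(3) r(3)] by (intro exI[of _ s]) auto
next
  fix P Q :: "'a set \<Rightarrow> bool" and p :: 'a
  assume "\<forall>q. P q \<longrightarrow> Q q"
    "\<forall>p. projection p \<longrightarrow> p \<noteq> 0 \<longrightarrow> (\<exists>r. projection r \<and> r \<noteq> 0 \<and> r * p = r \<and> (\<forall>q\<in>clop r. P q))"
    "projection p" "p \<noteq> 0"
  then show "\<exists>r. projection r \<and> r \<noteq> 0 \<and> r * p = r \<and> (\<forall>q\<in>clop r. Q q)" by blast
qed

lemma generic_point:
  assumes "eventually P generic" "projection p" "p \<noteq> 0" obtains q where "q \<in> clop p" "P q"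
proof -
  obtain r where r: "projection r" "r \<noteq> 0" "r * p = r" "\<forall>q\<in>clop r. P q"
    using assms eventually_generic by blast
  obtain q where "q \<in> clop r" using r clop_nonempty by blast
  moreover have "clop r \<subseteq> clop p" using r assms clop_subset_iff by blast
  ultimately show ?thesis using that r by blast
qed

lemma eventually_generic_ultrafilter: "\<forall>\<^sub>F q in generic. ultrafilter q"
  unfolding eventually_generic by (auto simp: clop_def intro: projection_idem)

lemma dense_iff:
  assumes D: "openin stone_space D"
  shows "stone_space closure_of D = topspace stone_space \<longleftrightarrow> (\<forall>p. projection p \<longrightarrow> p \<noteq> 0 \<longrightarrow> clop p \<inter> D \<noteq> {})"
proof
  assume c: "stone_space closure_of D = topspace stone_space"
  show "\<forall>p. projection p \<longrightarrow> p \<noteq> 0 \<longrightarrow> clop p \<inter> D \<noteq> {}"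
  proof (intro allI impI)
    fix p :: 'a assume p: "projection p" "p \<noteq> 0"
    then obtain U where U: "U \<in> clop p" using clop_nonempty by blast
    then have "U \<in> stone_space closure_of D" using c by (auto simp: clop_def)
    then show "clop p \<inter> D \<noteq> {}" using U openin_clop[OF p(1)] by (auto simp: in_closure_of)
  qed
next
  assume c: "\<forall>p. projection p \<longrightarrow> p \<noteq> 0 \<longrightarrow> clop p \<inter> D \<noteq> {}"
  have "U \<in> stone_space closure_of D" if U: "ultrafilter U" for U
    unfolding in_closure_of
  proof (intro conjI allI impI)
    fix T assume "U \<in> T \<and> openin stone_space T"
    then obtain p where "p \<in> U" "clop p \<subseteq> T" by (auto simp: openin_stone_iff)
    moreover from this have "projection p" "p \<noteq> 0" using U by (auto simp: ultrafilter_proj ultrafilter_zero)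
    ultimately show "\<exists>y. y \<in> D \<and> y \<in> T" using c by blast
  qed (use U in simp)
  then show "stone_space closure_of D = topspace stone_space"
    using closure_of_subset_topspace[of "stone_space" D] by auto
qed

lemma eventually_generic_dense:
  "eventually P generic \<longleftrightarrow>
    (\<exists>D. openin stone_space D \<and> stone_space closure_of D = topspace stone_space \<and> (\<forall>q\<in>D. P q))"
proof
  assume P: "eventually P generic"
  define D where "D = \<Union>{clop r | r. projection r \<and> (\<forall>q\<in>clop r. P q)}"
  have D: "openin stone_space D" unfolding D_def by (auto intro: openin_clop)
  have "clop p \<inter> D \<noteq> {}" if p: "projection p" "p \<noteq> 0" for p
  proof -
    obtain r where r: "projection r" "r \<noteq> 0" "r * p = r" "\<forall>q\<in>clop r. P q"
      using P p eventually_generic by blast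
    obtain q where "q \<in> clop r" using r clop_nonempty by blast
    moreover have "clop r \<subseteq> clop p" using r p clop_subset_iff by blast
    moreover have "clop r \<subseteq> D" using r by (auto simp: D_def)
    ultimately show ?thesis by blast
  qed
  then have "stone_space closure_of D = topspace stone_space" by (simp only: dense_iff[OF D]) blast
  then show "\<exists>D. openin stone_space D \<and> stone_space closure_of D = topspace stone_space \<and> (\<forall>q\<in>D. P q)"
    using D by (auto simp: D_def)
next
  assume "\<exists>D. openin stone_space D \<and> stone_space closure_of D = topspace stone_space \<and> (\<forall>q\<in>D. P q)"
  then obtain D where D: "openin stone_space D" "stone_space closure_of D = topspace stone_space" "\<And>q. q \<in> D \<Longrightarrow> P q"
    by blast
  show "eventually P generic"
    unfolding eventually_generic
  proof (intro allI impI)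
    fix p :: 'a assume p: "projection p" "p \<noteq> 0"
    then obtain U where U: "U \<in> clop p" "U \<in> D" using D dense_iff[OF D(1)] by blast
    then obtain s where s: "s \<in> U" "clop s \<subseteq> D" using D(1) by (auto simp: openin_stone_iff)
    have u: "ultrafilter U" "p \<in> U" using U by (auto simp: clop_def)
    have ps: "projection s" using s u ultrafilter_proj by blast
    have "p * s \<in> U" using u s ultrafilter_mult by blast
    then have "p * s \<noteq> 0" using u ultrafilter_zero by metis
    moreover have "clop (p * s) \<subseteq> D" using s clop_mult[OF p(1) ps] by blast
    moreover have "p * s * p = p * s" using p by (simp add: mult_ac)
    ultimately show "\<exists>r. projection r \<and> r \<noteq> 0 \<and> r * p = r \<and> (\<forall>q\<in>clop r. P q)"
      using p ps projection_mult D(3) by (intro exI[of _ "p * s"]) auto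
  qed
qed

lemma generic_denseE:
  assumes "eventually P generic"
  obtains D where "openin stone_space D" "stone_space closure_of D = topspace stone_space" "\<forall>q\<in>D. P q"
  using assms unfolding eventually_generic_dense by blast

text \<open>If the values at \<open>q\<close> differed, continuity would keep them apart on a clopen set, which contains generic
  points.\<close>

lemma generic_eq_imp_eq:
  fixes f g :: "'a::comm_awstar_algebra set \<Rightarrow> 'b::t2_space"
  assumes "(f \<longlongrightarrow> f q) (nhdsin stone_space q)" "(g \<longlongrightarrow> g q) (nhdsin stone_space q)" "ultrafilter q"
    and gen: "\<forall>\<^sub>F q in generic. f q = g q"
  shows "f q = g q"
proof (rule ccontr)
  assume "f q \<noteq> g q"
  then obtain S T where ST: "open S" "open T" "f q \<in> S" "g q \<in> T" "S \<inter> T = {}" by (metis hausdorff)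
  have "\<forall>\<^sub>F x in nhdsin stone_space q. f x \<in> S \<and> g x \<in> T"
    using assms(1,2) ST topological_tendstoD by (intro eventually_conj) blast+
  then obtain p where p: "p \<in> q" "\<forall>x\<in>clop p. f x \<in> S \<and> g x \<in> T"
    using eventually_nhdsin_stone[OF assms(3)] by blast
  have "projection p" "p \<noteq> 0" using p assms(3) by (auto simp: ultrafilter_proj ultrafilter_zero)
  then obtain x where "x \<in> clop p" "f x = g x" using generic_point[OF gen] by blast
  then show False using p ST by auto
qed

lemma generic_le_imp_le:
  fixes f g :: "'a::comm_awstar_algebra set \<Rightarrow> 'b::linorder_topology"
  assumes "(f \<longlongrightarrow> f q) (nhdsin stone_space q)" "(g \<longlongrightarrow> g q) (nhdsin stone_space q)" "ultrafilter q"
    and gen: "\<forall>\<^sub>F q in generic. f q \<le> g q"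
  shows "f q \<le> g q"
proof (rule ccontr)
  assume "\<not> f q \<le> g q"
  then have "g q < f q" by simp
  then obtain a b where ab: "g q \<in> {..<a}" "f q \<in> {b<..}" "{..<a} \<inter> {b<..} = {}"
    using less_separate by blast
  define S T where "S = {b<..}" and "T = {..<a}"
  have ST: "open S" "open T" "f q \<in> S" "g q \<in> T" using ab by (auto simp: S_def T_def)
  have "\<forall>\<^sub>F x in nhdsin stone_space q. f x \<in> S \<and> g x \<in> T"
    using assms(1,2) ST topological_tendstoD by (intro eventually_conj) blast+
  then obtain p where p: "p \<in> q" "\<forall>x\<in>clop p. f x \<in> S \<and> g x \<in> T"
    using eventually_nhdsin_stone[OF assms(3)] by blast
  have "projection p" "p \<noteq> 0" using p assms(3) by (auto simp: ultrafilter_proj ultrafilter_zero)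
  then obtain x where x: "x \<in> clop p" "f x \<le> g x" using generic_point[OF gen] by blast
  then have "f x \<in> {..<a} \<inter> {b<..}" using p by (auto simp: S_def T_def)
  then show False using ab by simp
qed

definition generically_continuous :: "('a::comm_awstar_algebra set \<Rightarrow> 'b::topological_space) \<Rightarrow> bool"
  where "generically_continuous f \<longleftrightarrow> (\<forall>\<^sub>F q in generic. (f \<longlongrightarrow> f q) (nhdsin stone_space q))"

lemma C_infty_iff:
  "x \<in> C_infty \<longleftrightarrow> x \<in> extensional {U. ultrafilter U} \<and>
    (\<forall>q. ultrafilter q \<longrightarrow> (x \<longlongrightarrow> x q) (nhdsin stone_space q)) \<and> (\<forall>\<^sub>F q in generic. \<bar>x q\<bar> \<noteq> \<infinity>)"
proof -
  define N where "N = {q \<in> topspace stone_space. \<bar>x q\<bar> = \<infinity>}"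
  have "stone_space interior_of (stone_space closure_of N) = {} \<longleftrightarrow> (\<forall>\<^sub>F q in generic. \<bar>x q\<bar> \<noteq> \<infinity>)"
  proof
    assume i: "stone_space interior_of (stone_space closure_of N) = {}"
    define D where "D = topspace stone_space - stone_space closure_of N"
    have "openin stone_space D" unfolding D_def by (rule openin_diff[OF openin_topspace closedin_closure_of])
    moreover have "stone_space closure_of D = topspace stone_space"
      unfolding D_def by (metis closure_of_complement i Diff_empty)
    moreover have "\<bar>x q\<bar> \<noteq> \<infinity>" if q: "q \<in> D" for q
    proof -
      have "N \<subseteq> stone_space closure_of N" by (rule closure_of_subset) (auto simp: N_def)
      then have 1: "q \<notin> N" and 2: "q \<in> topspace stone_space" using q unfolding D_def by blast+
      have "\<bar>x q\<bar> = \<infinity> \<Longrightarrow> q \<in> N" unfolding N_def by (intro CollectI conjI 2)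
      with 1 show ?thesis by (rule contrapos_nn)
    qed
    ultimately show "\<forall>\<^sub>F q in generic. \<bar>x q\<bar> \<noteq> \<infinity>"
      unfolding eventually_generic_dense by (intro exI[of _ D] conjI ballI) auto
  next
    assume "\<forall>\<^sub>F q in generic. \<bar>x q\<bar> \<noteq> \<infinity>"
    then obtain D where D: "openin stone_space D" "stone_space closure_of D = topspace stone_space"
      "\<forall>q\<in>D. \<bar>x q\<bar> \<noteq> \<infinity>" by (rule generic_denseE)
    have "N \<subseteq> topspace stone_space - D" using D by (auto simp: N_def)
    moreover have "closedin stone_space (topspace stone_space - D)"
      by (rule closedin_diff[OF closedin_topspace D(1)])
    ultimately have "stone_space closure_of N \<subseteq> topspace stone_space - D" by (rule closure_of_minimal)
    then have "stone_space interior_of (stone_space closure_of N) \<subseteq> stone_space interior_of (topspace stone_space - D)"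
      by (rule interior_of_mono)
    also have "\<dots> = {}" unfolding interior_of_complement D(2) by (rule Diff_cancel)
    finally show "stone_space interior_of (stone_space closure_of N) = {}" by blast
  qed
  then show ?thesis unfolding N_def C_infty_def stone_continuous_def continuous_map_stone_iff by auto
qed

text \<open>For real \<open>r\<close> the closure of the open set where \<open>g < r\<close> is clopen, say the set of \<open>e r\<close>. The extension is
  the function with these level sets, \<open>x q = inf {r. e r \<in> q}\<close>.\<close>

lemma real_extension:
  fixes g :: "'a::comm_awstar_algebra set \<Rightarrow> real"
  assumes g: "generically_continuous g"
  obtains x where "x \<in> C_infty" "\<forall>\<^sub>F q in generic. x q = ereal (g q)"
proof -
  obtain D where D: "openin stone_space D" "stone_space closure_of D = topspace stone_space"
    and c: "\<And>q. q \<in> D \<Longrightarrow> (g \<longlongrightarrow> g q) (nhdsin stone_space q)"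
    using g unfolding generically_continuous_def eventually_generic_dense by blast
  have Du: "ultrafilter q" if "q \<in> D" for q using that D(1) by (auto simp: openin_stone_iff)
  define W where "W = (\<lambda>r. {q \<in> D. g q < r})"
  have W: "openin stone_space (W r)" for r
    unfolding openin_stone_iff
  proof (intro conjI ballI)
    show "W r \<subseteq> {U. ultrafilter U}" using Du by (auto simp: W_def)
    fix q assume "q \<in> W r"
    then have q: "q \<in> D" "g q < r" by (auto simp: W_def)
    have "\<forall>\<^sub>F y in nhdsin stone_space q. g y < r" using c[OF q(1)] q(2) by (rule order_tendstoD)
    moreover have "\<forall>\<^sub>F y in nhdsin stone_space q. y \<in> D"
      using D(1) q(1) by (auto simp: eventually_nhdsin)
    ultimately have "\<forall>\<^sub>F y in nhdsin stone_space q. y \<in> W r"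
      by eventually_elim (simp add: W_def)
    then obtain p where "p \<in> q" "\<forall>q'\<in>clop p. q' \<in> W r"
      unfolding eventually_nhdsin_stone[OF Du[OF q(1)]] by blast
    then show "\<exists>p\<in>q. clop p \<subseteq> W r" by blast
  qed
  define e where "e = (\<lambda>r. psup {p. projection p \<and> clop p \<subseteq> W r})"
  have e: "projection (e r)" "stone_space closure_of (W r) = clop (e r)" for r
    using closure_of_open_is_clop[OF W] psup by (auto simp: e_def)
  have mono: "e r \<in> q \<Longrightarrow> e s \<in> q" if "r \<le> s" "ultrafilter q" for r s q
  proof -
    have "W r \<subseteq> W s" using that by (auto simp: W_def)
    then have "clop (e r) \<subseteq> clop (e s)" using closure_of_mono e by metis
    then show "e r \<in> q \<Longrightarrow> e s \<in> q" using that by (auto simp: clop_def)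
  qed
  define x where "x = (\<lambda>q\<in>{U. ultrafilter U}. INF r\<in>{r. e r \<in> q}. ereal r)"
  have low: "ereal r \<le> x q" if "ultrafilter q" "e r \<notin> q" for r q
  proof -
    have "x q = (INF r\<in>{r. e r \<in> q}. ereal r)" using that by (simp add: x_def)
    also have "\<dots> \<ge> ereal r"
    proof (rule INF_greatest)
      fix s assume "s \<in> {s. e s \<in> q}"
      then have "r \<le> s" using mono[of s r q] that by (metis linear mem_Collect_eq)
      then show "ereal r \<le> ereal s" by simp
    qed
    finally show ?thesis .
  qed
  have up: "x q \<le> ereal r" if "ultrafilter q" "e r \<in> q" for r q
    using that by (auto simp: x_def intro: INF_lower)
  have lim: "(x \<longlongrightarrow> x q) (nhdsin stone_space q)" if q: "ultrafilter q" for q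
  proof (rule order_tendstoI)
    fix l assume "l < x q"
    then obtain r where r: "l < ereal r" "ereal r < x q" using ereal_dense2 by blast
    then have "e r \<notin> q" using up[OF q, of r] by auto
    then have "1 - e r \<in> q" using ultrafilter_compl[OF q e(1)] by blast
    moreover have "l < x q'" if "q' \<in> clop (1 - e r)" for q'
    proof -
      have "ultrafilter q'" "e r \<notin> q'" using that clop_compl[OF e(1)] by (auto simp: clop_def)
      then show ?thesis using low r(1) less_le_trans by blast
    qed
    ultimately show "\<forall>\<^sub>F q in nhdsin stone_space q. l < x q" using eventually_nhdsin_stone[OF q] by blast
  next
    fix u assume "x q < u"
    then obtain r where r: "e r \<in> q" "ereal r < u" using q by (auto simp: x_def INF_less_iff)
    then have "\<forall>q'\<in>clop (e r). x q' < u" using up by (auto simp: clop_def intro: le_less_trans)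
    then show "\<forall>\<^sub>F q in nhdsin stone_space q. x q < u" using eventually_nhdsin_stone[OF q] r by blast
  qed
  have eq: "x q = ereal (g q)" if q: "q \<in> D" for q
  proof (rule antisym)
    show "x q \<le> ereal (g q)"
    proof (rule ereal_le_epsilon2)
      fix t :: real assume "0 < t"
      then have "q \<in> W (g q + t)" using q by (simp add: W_def)
      then have "q \<in> clop (e (g q + t))"
        using closure_of_subset[of "W (g q + t)" stone_space] openin_subset[OF W] e by blast
      then show "x q \<le> ereal (g q) + ereal t" using up Du[OF q] by (auto simp: clop_def)
    qed
    show "ereal (g q) \<le> x q"
    proof (rule ereal_le_epsilon2)
      fix t :: real assume t: "0 < t"
      have "e (g q - t) \<notin> q"
      proof
        assume "e (g q - t) \<in> q"
        then have "q \<in> stone_space closure_of (W (g q - t))" using e Du[OF q] by (auto simp: clop_def)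
        moreover have "\<forall>\<^sub>F y in nhdsin stone_space q. g q - t < g y"
          using c[OF q] t by (intro order_tendstoD(1)) auto
        then obtain S where "openin stone_space S" "q \<in> S" "\<forall>y\<in>S. g q - t < g y"
          using Du[OF q] by (auto simp: eventually_nhdsin)
        ultimately obtain y where "y \<in> W (g q - t)" "y \<in> S" by (auto simp: in_closure_of)
        then show False using \<open>\<forall>y\<in>S. g q - t < g y\<close> by (auto simp: W_def)
      qed
      then have "ereal (g q - t) \<le> x q" using low Du[OF q] by blast
      then show "ereal (g q) \<le> x q + ereal t" by (cases "x q") auto
    qed
  qed
  have gen: "\<forall>\<^sub>F q in generic. x q = ereal (g q)"
    unfolding eventually_generic_dense using D eq by blast
  then have "\<forall>\<^sub>F q in generic. \<bar>x q\<bar> \<noteq> \<infinity>" by eventually_elim simp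
  moreover have "x \<in> extensional {U. ultrafilter U}" by (simp add: x_def)
  ultimately have "x \<in> C_infty" using lim by (simp add: C_infty_iff)
  then show ?thesis using that gen by blast
qed

lemma C_infty_eqI:
  assumes "x \<in> C_infty" "y \<in> C_infty" "\<forall>\<^sub>F q in generic. x q = y q" shows "x = y"
proof (rule extensionalityI)
  show "x \<in> extensional {U. ultrafilter U}" "y \<in> extensional {U. ultrafilter U}"
    using assms by (auto simp: C_infty_iff)
  show "x q = y q" if "q \<in> {U. ultrafilter U}" for q
    using assms that by (intro generic_eq_imp_eq) (auto simp: C_infty_iff)
qed

lemma S_alg_finite: "z \<in> S_alg \<Longrightarrow> \<forall>\<^sub>F q in generic. finite_at z q"
  by (auto simp: S_alg_def C_infty_iff finite_at_def intro: eventually_conj)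

lemma S_alg_eqI:
  assumes "z \<in> S_alg" "w \<in> S_alg" "\<forall>\<^sub>F q in generic. val z q = val w q" shows "z = w"
proof -
  have "\<forall>\<^sub>F q in generic. fst z q = fst w q \<and> snd z q = snd w q"
    using S_alg_finite[OF assms(1)] S_alg_finite[OF assms(2)] assms(3)
    by eventually_elim (auto simp: finite_at_def val_def ereal_real' dest: arg_cong[of _ _ ereal])
  then have "\<forall>\<^sub>F q in generic. fst z q = fst w q" "\<forall>\<^sub>F q in generic. snd z q = snd w q"
    by (auto elim: eventually_mono)
  then show ?thesis using assms by (intro prod_eqI C_infty_eqI) (auto simp: S_alg_def)
qed

lemma val_generically_continuous: "z \<in> S_alg \<Longrightarrow> generically_continuous (val z)"
  unfolding generically_continuous_def
proof -
  assume z: "z \<in> S_alg"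
  show "\<forall>\<^sub>F q in generic. (val z \<longlongrightarrow> val z q) (nhdsin stone_space q)"
    using S_alg_finite[OF z] eventually_generic_ultrafilter
  proof eventually_elim
    case (elim q)
    have l: "((\<lambda>y. real_of_ereal (x y)) \<longlongrightarrow> real_of_ereal (x q)) (nhdsin stone_space q)"
      if x: "x \<in> C_infty" "\<bar>x q\<bar> \<noteq> \<infinity>" for x
      using x elim by (intro lim_real_of_ereal) (auto simp: C_infty_iff ereal_real')
    show ?case unfolding val_def complex_eq_iff[symmetric]
      using elim z by (intro tendsto_Complex l) (auto simp: finite_at_def S_alg_def)
  qed
qed

lemma S_ext:
  assumes f: "generically_continuous f"
  shows "S_ext f \<in> S_alg" "\<forall>\<^sub>F q in generic. finite_at (S_ext f) q \<and> val (S_ext f) q = f q"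
proof -
  have "generically_continuous (\<lambda>q. Re (f q))" "generically_continuous (\<lambda>q. Im (f q))"
    using f unfolding generically_continuous_def by (auto elim!: eventually_mono intro: tendsto_intros)
  then obtain x y where x: "x \<in> C_infty" "\<forall>\<^sub>F q in generic. x q = ereal (Re (f q))"
    and y: "y \<in> C_infty" "\<forall>\<^sub>F q in generic. y q = ereal (Im (f q))" by (metis real_extension)
  have "\<exists>z. z \<in> S_alg \<and> (\<forall>\<^sub>F q in generic. finite_at z q \<and> val z q = f q)"
  proof (intro exI conjI)
    show "(x, y) \<in> S_alg" using x y by (simp add: S_alg_def)
    show "\<forall>\<^sub>F q in generic. finite_at (x, y) q \<and> val (x, y) q = f q"
      using x(2) y(2) by eventually_elim (auto simp: finite_at_def val_def)
  qed
  then have "\<exists>!z. z \<in> S_alg \<and> (\<forall>\<^sub>F q in generic. finite_at z q \<and> val z q = f q)"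
  proof (rule ex_ex1I)
    fix z w assume a: "z \<in> S_alg \<and> (\<forall>\<^sub>F q in generic. finite_at z q \<and> val z q = f q)"
      "w \<in> S_alg \<and> (\<forall>\<^sub>F q in generic. finite_at w q \<and> val w q = f q)"
    have "\<forall>\<^sub>F q in generic. val z q = val w q"
      using a(1)[THEN conjunct2] a(2)[THEN conjunct2] by eventually_elim simp
    then show "z = w" using a S_alg_eqI by blast
  qed
  from theI'[OF this]
  show "S_ext f \<in> S_alg" "\<forall>\<^sub>F q in generic. finite_at (S_ext f) q \<and> val (S_ext f) q = f q"
    unfolding S_ext_def eventually_generic_dense by auto
qed

section \<open>The representation of the algebra on its Stone space\<close>

text \<open>The number \<open>l\<close> is within \<open>r\<close> of the value of \<open>a\<close> at \<open>q\<close>. Phrased with a projection in \<open>q\<close>, this extends to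
  a neighbourhood of \<open>q\<close>.\<close>

definition near :: "'a::comm_awstar_algebra \<Rightarrow> 'a set \<Rightarrow> complex \<Rightarrow> real \<Rightarrow> bool"
  where "near a q l r \<longleftrightarrow> (\<exists>e\<in>q. norm (e * (a - l *\<^sub>C 1)) \<le> r)"

lemma norm_mult_projection_mono:
  assumes "projection e" "projection f" "norm (e * x) \<le> r"
  shows "norm (e * f * x :: 'a::comm_cstar_algebra) \<le> r"
  using norm_projection_mult_le[OF assms(2), of "e * x"] assms(3) by (simp add: mult_ac)

text \<open>Halving the interval that contains the value, by means of \<open>bisection\<close>.\<close>

lemma near_self_adjoint:
  fixes a :: "'a::comm_awstar_algebra"
  assumes a: "star a = a" and q: "ultrafilter q"
  shows "\<exists>e\<in>q. \<exists>l. norm (e * (a - l *\<^sub>R 1)) \<le> norm a / 2 ^ n"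
proof (induction n)
  case 0
  show ?case using ultrafilter_one[OF q] by (intro bexI[of _ 1] exI[of _ 0]) simp_all
next
  case (Suc n)
  then obtain e l where e: "e \<in> q" "norm (e * (a - l *\<^sub>R 1)) \<le> norm a / 2 ^ n" by blast
  define r where "r = norm a / 2 ^ n"
  define b where "b = e * (a - l *\<^sub>R 1)"
  have pe: "projection e" using e q ultrafilter_proj by blast
  have nb: "norm b \<le> r" using e by (simp add: b_def r_def)
  have sb: "star b = b" using pe a by (simp add: b_def star_times projection_star star_diff star_scaleR)
  have eb: "e * b = b" using pe by (simp add: b_def)
  show ?case
  proof (cases "r = 0")
    case True
    then have "norm a = 0" by (simp add: r_def)
    then show ?thesis using e by auto
  next
    case False
    then have r: "r > 0" by (simp add: r_def)
    obtain f where f: "projection f" "norm (f * (2 *\<^sub>R ((1 / r) *\<^sub>R b) - 1)) \<le> 1"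
      "norm ((1 - f) * (2 *\<^sub>R ((1 / r) *\<^sub>R b) + 1)) \<le> 1"
      using bisection[of "(1 / r) *\<^sub>R b"] sb nb r by (auto simp: star_scaleR)
    have step: "\<exists>e\<in>q. \<exists>l. norm (e * (a - l *\<^sub>R 1)) \<le> norm a / 2 ^ Suc n"
      if g: "projection g" "g \<in> q" "norm (g * (2 *\<^sub>R ((1 / r) *\<^sub>R b) - s *\<^sub>R 1)) \<le> 1" for g s
    proof (intro bexI exI)
      show "e * g \<in> q" using e g q ultrafilter_mult by blast
      have "e * g * (a - (l + r * s / 2) *\<^sub>R 1) = g * b - (r * s / 2) *\<^sub>R (e * g)"
        unfolding b_def by (simp add: algebra_simps)
      also have "\<dots> = e * (g * (b - (r * s / 2) *\<^sub>R 1))"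
        using eb by (simp add: right_diff_distrib mult.left_commute[of e g])
      also have "b - (r * s / 2) *\<^sub>R 1 = (r / 2) *\<^sub>R (2 *\<^sub>R ((1 / r) *\<^sub>R b) - s *\<^sub>R 1)"
        using r by (simp add: scaleR_diff_right)
      also have "e * (g * \<dots>) = (r / 2) *\<^sub>R (e * (g * (2 *\<^sub>R ((1 / r) *\<^sub>R b) - s *\<^sub>R 1)))"
        by (simp only: mult_scaleR_right)
      finally have "norm (e * g * (a - (l + r * s / 2) *\<^sub>R 1))
          = (r / 2) * norm (e * (g * (2 *\<^sub>R ((1 / r) *\<^sub>R b) - s *\<^sub>R 1)))" using r by simp
      also have "\<dots> \<le> (r / 2) * 1"
        using r norm_projection_mult_le[OF pe, of "g * (2 *\<^sub>R ((1 / r) *\<^sub>R b) - s *\<^sub>R 1)"] g(3)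
        by (intro mult_left_mono) auto
      finally show "norm (e * g * (a - (l + r * s / 2) *\<^sub>R 1)) \<le> norm a / 2 ^ Suc n"
        by (simp add: r_def mult.commute)
    qed
    show ?thesis
    proof (cases "f \<in> q")
      case True
      then show ?thesis using step[of f 1] f by simp
    next
      case False
      then have "1 - f \<in> q" using ultrafilter_compl[OF q f(1)] by blast
      then show ?thesis using step[of "1 - f" "-1"] f projection_compl[OF f(1)] by simp
    qed
  qed
qed

lemma near_exists:
  fixes a :: "'a::comm_awstar_algebra"
  assumes q: "ultrafilter q" and r: "r > 0"
  shows "\<exists>l. near a q l r"
proof -
  have sa: "\<exists>e\<in>q. \<exists>l. norm (e * (b - complex_of_real l *\<^sub>C 1)) \<le> r / 2" if b: "star b = b" for b :: 'a
  proof -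
    \<comment> \<open>the number of halvings that brings the error below \<open>r / 2\<close>\<close>
    obtain n where "norm b / (r / 2) < 2 ^ n" using real_arch_pow[of 2] by auto
    then have "norm b / 2 ^ n \<le> r / 2" using r by (simp add: field_simps)
    moreover obtain e l where "e \<in> q" "norm (e * (b - l *\<^sub>R 1)) \<le> norm b / 2 ^ n"
      using near_self_adjoint[OF b q, of n] by blast
    ultimately show ?thesis unfolding scaleC_of_real by (meson order_trans)
  qed
  define x where "x = (1/2) *\<^sub>C (a + star a)"
  define y where "y = (- \<i> / 2) *\<^sub>C (a - star a)"
  have "star x = x" by (simp add: x_def star_scaleC star_add star_star add.commute)
  then obtain e l where e: "e \<in> q" "norm (e * (x - complex_of_real l *\<^sub>C 1)) \<le> r / 2" using sa by blast
  have "star y = y"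
    by (simp add: y_def star_scaleC star_diff star_star) (metis minus_diff_eq minus_divide_left scaleC_minus_left scaleC_minus_right)
  then obtain f m where f: "f \<in> q" "norm (f * (y - complex_of_real m *\<^sub>C 1)) \<le> r / 2" using sa by blast
  have a: "a = x + \<i> *\<^sub>C y"
  proof -
    have "\<i> *\<^sub>C y = (1/2) *\<^sub>C (a - star a)" by (simp add: y_def scaleC_scaleC)
    then have "x + \<i> *\<^sub>C y = (1/2) *\<^sub>C (a + a)" by (simp add: x_def scaleC_add_right[symmetric])
    also have "\<dots> = (1/2 + 1/2) *\<^sub>C a" by (simp only: scaleC_add_right scaleC_add_left)
    finally show ?thesis by simp
  qed
  define k where "k = complex_of_real l + \<i> * complex_of_real m"
  have pr: "projection e" "projection f" using e f q ultrafilter_proj by auto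
  have "a - k *\<^sub>C 1 = (x - complex_of_real l *\<^sub>C 1) + \<i> *\<^sub>C (y - complex_of_real m *\<^sub>C 1)"
    by (simp add: a k_def scaleC_add_left scaleC_diff_right scaleC_scaleC)
  then have "e * f * (a - k *\<^sub>C 1)
      = e * f * (x - complex_of_real l *\<^sub>C 1) + \<i> *\<^sub>C (f * e * (y - complex_of_real m *\<^sub>C 1))"
    by (simp add: distrib_left scaleC_mult_right mult.commute)
  then have "norm (e * f * (a - k *\<^sub>C 1)) \<le> r / 2 + r / 2"
    using norm_mult_projection_mono[OF pr e(2)] norm_mult_projection_mono[OF pr(2,1) f(2)]
      norm_triangle_ineq[of "e * f * (x - complex_of_real l *\<^sub>C 1)" "\<i> *\<^sub>C (f * e * (y - complex_of_real m *\<^sub>C 1))"]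
    by (simp add: norm_scaleC)
  then show ?thesis using e f q ultrafilter_mult unfolding near_def by (intro exI[of _ k] bexI[of _ "e * f"]) auto
qed

lemma near_dist:
  assumes q: "ultrafilter q" and "near a q l r" "near a q m s" shows "cmod (l - m) \<le> r + s"
proof -
  obtain e f where e: "e \<in> q" "norm (e * (a - l *\<^sub>C 1)) \<le> r" and f: "f \<in> q" "norm (f * (a - m *\<^sub>C 1)) \<le> s"
    using assms by (auto simp: near_def)
  have pr: "projection e" "projection f" using e f q ultrafilter_proj by auto
  have "e * f \<in> q" using e f q ultrafilter_mult by blast
  then have ef: "e * f \<noteq> 0" "projection (e * f)" using q ultrafilter_zero ultrafilter_proj by metis+
  have "(l - m) *\<^sub>C (e * f) = f * e * (a - m *\<^sub>C 1) - e * f * (a - l *\<^sub>C 1)"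
    by (simp add: right_diff_distrib scaleC_mult_right scaleC_mult_left scaleC_diff_left mult.commute)
  then have "norm ((l - m) *\<^sub>C (e * f)) \<le> s + r"
    using norm_mult_projection_mono[OF pr e(2)] norm_mult_projection_mono[OF pr(2,1) f(2)]
      norm_triangle_ineq4[of "f * e * (a - m *\<^sub>C 1)" "e * f * (a - l *\<^sub>C 1)"] by simp
  then show ?thesis using norm_projection[OF ef(2,1)] by (simp add: norm_scaleC)
qed

text \<open>The Gelfand transform; \<open>near_hat\<close> and \<open>hat_eqI\<close> show that the number described exists and is unique.\<close>

definition hat :: "'a::comm_awstar_algebra \<Rightarrow> 'a set \<Rightarrow> complex"
  where "hat a q = (THE l. \<forall>r>0. near a q l r)"

lemma hat_eqI:
  assumes q: "ultrafilter q" and l: "\<And>r. r > 0 \<Longrightarrow> near a q l r" shows "hat a q = l"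
  unfolding hat_def
proof (rule the_equality)
  fix m assume m: "\<forall>r>0. near a q m r"
  have "cmod (m - l) \<le> e" if "e > 0" for e
    using near_dist[OF q, of a m "e/2" l "e/2"] m l[of "e/2"] that by auto
  then have "cmod (m - l) \<le> 0" by (rule field_le_epsilon[of _ 0, simplified])
  then show "m = l" by simp
qed (use l in auto)

lemma near_hat:
  assumes q: "ultrafilter q" and r: "r > 0" shows "near a q (hat a q) r"
proof -
  define h where "h = (\<lambda>n. SOME l. near a q l (inverse (real (Suc n))))"
  have h: "near a q (h n) (inverse (real (Suc n)))" for n
    unfolding h_def by (rule someI_ex) (rule near_exists[OF q], simp)
  have "Cauchy h"
  proof (rule metric_CauchyI)
    fix e :: real assume "e > 0"
    then obtain N where N: "inverse (real (Suc N)) < e / 2" using reals_Archimedean[of "e/2"] half_gt_zero[of e] \<open>e > 0\<close> by blast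
    have "dist (h m) (h n) < e" if "m \<ge> N" "n \<ge> N" for m n
    proof -
      have "dist (h m) (h n) \<le> inverse (real (Suc m)) + inverse (real (Suc n))"
        using near_dist[OF q h h] by (simp add: dist_norm)
      also have "\<dots> \<le> inverse (real (Suc N)) + inverse (real (Suc N))"
        using that by (intro add_mono le_imp_inverse_le) auto
      finally show ?thesis using N by simp
    qed
    then show "\<exists>M. \<forall>m\<ge>M. \<forall>n\<ge>M. dist (h m) (h n) < e" by blast
  qed
  then obtain l where l: "h \<longlonglongrightarrow> l" by (metis Cauchy_convergent convergentD)
  have nl: "near a q l e" if "e > 0" for e
  proof -
    have e2: "e / 2 > 0" using that by simp
    obtain N where N: "inverse (real (Suc N)) < e / 2" using reals_Archimedean[OF e2] by blast
    obtain M where M: "\<forall>n\<ge>M. dist (h n) l < e / 2" using l e2 by (meson half_gt_zero metric_LIMSEQ_D)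
    define n where "n = max N M"
    obtain f where f: "f \<in> q" "norm (f * (a - h n *\<^sub>C 1)) \<le> inverse (real (Suc n))"
      using h[of n] by (auto simp: near_def)
    have "inverse (real (Suc n)) \<le> inverse (real (Suc N))" by (intro le_imp_inverse_le) (auto simp: n_def)
    moreover have "norm ((h n - l) *\<^sub>C f) \<le> e / 2"
    proof -
      have "norm f \<le> 1" using norm_projection_le ultrafilter_proj[OF q] f by blast
      moreover have "dist (h n) l < e / 2" using M by (simp add: n_def)
      ultimately show ?thesis unfolding norm_scaleC dist_norm using that
        by (meson less_imp_le mult_right_le_one_le norm_ge_zero order_trans)
    qed
    moreover have eq: "f * (a - l *\<^sub>C 1) = f * (a - h n *\<^sub>C 1) + (h n - l) *\<^sub>C f"
      by (simp add: right_diff_distrib scaleC_mult_right scaleC_diff_left)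
    ultimately have "norm (f * (a - l *\<^sub>C 1)) \<le> e"
      unfolding eq using norm_triangle_ineq[of "f * (a - h n *\<^sub>C 1)" "(h n - l) *\<^sub>C f"] f(2) N by linarith
    then show ?thesis using f by (auto simp: near_def)
  qed
  have "hat a q = l" by (rule hat_eqI[OF q nl])
  then show ?thesis using nl r by simp
qed

context
  fixes q :: "'a::comm_awstar_algebra set"
  assumes q: "ultrafilter q"
begin

lemma hat_add: "hat (a + b) q = hat a q + hat b q"
proof (rule hat_eqI[OF q])
  fix r :: real assume "r > 0"
  then obtain e f where e: "e \<in> q" "norm (e * (a - hat a q *\<^sub>C 1)) \<le> r / 2"
    and f: "f \<in> q" "norm (f * (b - hat b q *\<^sub>C 1)) \<le> r / 2"
    using near_hat[OF q, of "r/2"] by (auto simp: near_def) blast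
  have pr: "projection e" "projection f" using e f q ultrafilter_proj by auto
  have "e * f * (a + b - (hat a q + hat b q) *\<^sub>C 1) =
      e * f * (a - hat a q *\<^sub>C 1) + f * e * (b - hat b q *\<^sub>C 1)"
    by (simp add: algebra_simps scaleC_add_left)
  then have "norm (e * f * (a + b - (hat a q + hat b q) *\<^sub>C 1)) \<le> r / 2 + r / 2"
    using norm_mult_projection_mono[OF pr e(2)] norm_mult_projection_mono[OF pr(2,1) f(2)]
      norm_triangle_ineq[of "e * f * (a - hat a q *\<^sub>C 1)" "f * e * (b - hat b q *\<^sub>C 1)"] by simp
  then show "near (a + b) q (hat a q + hat b q) r"
    using e f q ultrafilter_mult unfolding near_def by (intro bexI[of _ "e * f"]) auto
qed

lemma hat_scaleC: "hat (c *\<^sub>C a) q = c * hat a q"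
proof (rule hat_eqI[OF q])
  fix r :: real assume r: "r > 0"
  define s where "s = r / (cmod c + 1)"
  have s: "s > 0" "cmod c * s \<le> r" using r
    by (auto simp: s_def field_simps add_pos_nonneg add_nonneg_pos)
  obtain e where e: "e \<in> q" "norm (e * (a - hat a q *\<^sub>C 1)) \<le> s"
    using near_hat[OF q s(1)] by (auto simp: near_def)
  have "e * (c *\<^sub>C a - (c * hat a q) *\<^sub>C 1) = c *\<^sub>C (e * (a - hat a q *\<^sub>C 1))"
    by (simp add: scaleC_diff_right scaleC_mult_right[symmetric] scaleC_scaleC)
  then have "norm (e * (c *\<^sub>C a - (c * hat a q) *\<^sub>C 1)) \<le> cmod c * s"
    using e by (simp add: norm_scaleC mult_left_mono)
  then show "near (c *\<^sub>C a) q (c * hat a q) r"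
    unfolding near_def using e s by (intro bexI[of _ e]) auto
qed

lemma hat_mult: "hat (a * b) q = hat a q * hat b q"
proof (rule hat_eqI[OF q])
  fix r :: real assume r: "r > 0"
  define s where "s = r / (norm b + cmod (hat a q) + 1)"
  have pos: "norm b + cmod (hat a q) + 1 > 0" by (smt (verit) norm_ge_zero)
  then have s: "s > 0" using r by (simp add: s_def)
  have s2: "s * norm b + cmod (hat a q) * s \<le> r"
  proof -
    have "s * norm b + cmod (hat a q) * s \<le> s * (norm b + cmod (hat a q) + 1)"
      using s by (simp add: algebra_simps)
    also have "\<dots> = r" using pos by (simp add: s_def)
    finally show ?thesis .
  qed
  obtain e where e: "e \<in> q" "norm (e * (a - hat a q *\<^sub>C 1)) \<le> s"
    using near_hat[OF q s(1)] by (auto simp: near_def)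
  obtain f where f: "f \<in> q" "norm (f * (b - hat b q *\<^sub>C 1)) \<le> s"
    using near_hat[OF q s(1)] by (auto simp: near_def)
  have pr: "projection e" "projection f" using e f q ultrafilter_proj by auto
  have "e * f * (a * b - (hat a q * hat b q) *\<^sub>C 1) =
      (e * f * (a - hat a q *\<^sub>C 1)) * b + hat a q *\<^sub>C (f * e * (b - hat b q *\<^sub>C 1))"
    by (simp add: algebra_simps scaleC_mult_right scaleC_mult_left scaleC_diff_right scaleC_scaleC)
  then have "norm (e * f * (a * b - (hat a q * hat b q) *\<^sub>C 1)) \<le>
      norm ((e * f * (a - hat a q *\<^sub>C 1)) * b) + norm (hat a q *\<^sub>C (f * e * (b - hat b q *\<^sub>C 1)))"
    by (simp only: norm_triangle_ineq)
  also have "\<dots> \<le> norm (e * f * (a - hat a q *\<^sub>C 1)) * norm b + cmod (hat a q) * norm (f * e * (b - hat b q *\<^sub>C 1))"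
    unfolding norm_scaleC by (intro add_right_mono norm_mult_ineq)
  also have "\<dots> \<le> s * norm b + cmod (hat a q) * s"
    using norm_mult_projection_mono[OF pr e(2)] norm_mult_projection_mono[OF pr(2,1) f(2)]
    by (intro add_mono mult_right_mono mult_left_mono) auto
  also note s2
  finally have "norm (e * f * (a * b - (hat a q * hat b q) *\<^sub>C 1)) \<le> r" .
  then show "near (a * b) q (hat a q * hat b q) r"
    using e f q ultrafilter_mult unfolding near_def by (intro bexI[of _ "e * f"]) auto
qed

lemma hat_star: "hat (star a) q = cnj (hat a q)"
proof (rule hat_eqI[OF q])
  fix r :: real assume r: "r > 0"
  then obtain e where e: "e \<in> q" "norm (e * (a - hat a q *\<^sub>C 1)) \<le> r"
    using near_hat[OF q] by (auto simp: near_def)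
  have "star (e * (a - hat a q *\<^sub>C 1)) = e * (star a - cnj (hat a q) *\<^sub>C 1)"
    using ultrafilter_proj[OF q e(1)] by (simp add: star_times projection_star star_diff star_scaleC)
  then have "norm (e * (star a - cnj (hat a q) *\<^sub>C 1)) \<le> r" using e norm_star by metis
  then show "near (star a) q (cnj (hat a q)) r" using e by (auto simp: near_def)
qed

lemma hat_one: "hat 1 q = 1"
  by (rule hat_eqI[OF q]) (auto simp: near_def intro!: bexI[of _ 1] ultrafilter_one q)

lemma hat_projection: assumes p: "projection p" shows "hat p q = (if p \<in> q then 1 else 0)"
proof (cases "p \<in> q")
  case True
  then show ?thesis
    by (auto intro!: hat_eqI[OF q] simp: near_def right_diff_distrib projection_idem[OF p] intro!: bexI[of _ p])
next
  case False
  then have "1 - p \<in> q" using ultrafilter_compl[OF q p] by blast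
  moreover have "(1 - p) * p = 0" by (simp add: algebra_simps projection_idem[OF p])
  ultimately have "hat p q = 0" by (auto intro!: hat_eqI[OF q] simp: near_def intro!: bexI[of _ "1 - p"])
  then show ?thesis using False by simp
qed

lemma cmod_hat_le: "cmod (hat a q) \<le> norm a"
proof (rule field_le_epsilon)
  fix r :: real assume r: "r > 0"
  have "near a q 0 (norm a)" unfolding near_def using ultrafilter_one[OF q] by (intro bexI[of _ 1]) auto
  from near_dist[OF q near_hat[OF q r] this] show "cmod (hat a q) \<le> norm a + r" by (simp add: add.commute)
qed

lemma hat_diff: "hat (a - b) q = hat a q - hat b q"
  using hat_add[of "a - b" b] by simp

lemma hat_continuous_at: "(hat a \<longlongrightarrow> hat a q) (nhdsin stone_space q)"
proof (rule tendstoI)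
  fix r :: real assume r: "r > 0"
  then obtain e where e: "e \<in> q" "norm (e * (a - hat a q *\<^sub>C 1)) \<le> r / 3"
    using near_hat[OF q, of "r/3"] by (auto simp: near_def)
  have "dist (hat a q') (hat a q) < r" if "q' \<in> clop e" for q'
  proof -
    have q': "ultrafilter q'" "e \<in> q'" using that by (auto simp: clop_def)
    then have "near a q' (hat a q) (r/3)" using e by (auto simp: near_def)
    from near_dist[OF q'(1) near_hat[OF q'(1), of "r/3"] this] show ?thesis using r by (simp add: dist_norm)
  qed
  then show "\<forall>\<^sub>F x in nhdsin stone_space q. dist (hat a x) (hat a q) < r"
    unfolding eventually_nhdsin_stone[OF q] using e by blast
qed

end

text \<open>Near each point \<open>a\<close> is cut down to norm \<open>r + d\<close> by some projection, and by \<open>norm_le_of_split\<close> such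
  projections form an ideal, so compactness applies.\<close>

lemma norm_le_of_hat:
  fixes a :: "'a::comm_awstar_algebra"
  assumes h: "\<And>q. ultrafilter q \<Longrightarrow> cmod (hat a q) \<le> r"
  shows "norm a \<le> r"
proof (rule field_le_epsilon)
  fix d :: real assume d: "d > 0"
  define J where "J = {e. projection e \<and> norm (e * a) \<le> r + d}"
  obtain U :: "'a set" where "U \<in> clop 1" using clop_nonempty[of "1::'a"] by auto
  then have r0: "0 \<le> r" using h[of U] by (metis clop_def mem_Collect_eq norm_ge_zero order_trans)
  have "1 \<in> J"
  proof (rule compact_ideal)
    show "0 \<in> J" using d r0 by (simp add: J_def)
  next
    fix p q assume pq: "p \<in> J" "q \<in> J"
    then have P: "projection p" "projection q" by (auto simp: J_def)
    have "norm ((p + q - p * q) * a) \<le> r + d"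
    proof (rule norm_le_of_split[OF P(1)])
      have "p * ((p + q - p * q) * a) = p * a" using P by (simp add: algebra_simps projection_idem)
      then show "norm (p * ((p + q - p * q) * a)) \<le> r + d" using pq by (simp add: J_def)
      have "(1 - p) * ((p + q - p * q) * a) = (1 - p) * (q * a)" using P by (simp add: algebra_simps projection_idem)
      then show "norm ((1 - p) * ((p + q - p * q) * a)) \<le> r + d"
        using pq norm_projection_mult_le[OF projection_compl[OF P(1)], of "q * a"] by (simp add: J_def)
    qed
    then show "p + q - p * q \<in> J" using projection_join[OF P] by (simp add: J_def)
  next
    fix U :: "'a set" assume U: "ultrafilter U"
    then obtain e where e: "e \<in> U" "norm (e * (a - hat a U *\<^sub>C 1)) \<le> d"
      using near_hat[OF U d] by (auto simp: near_def)
    have pe: "projection e" using U e ultrafilter_proj by blast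
    have "e * a = e * (a - hat a U *\<^sub>C 1) + hat a U *\<^sub>C e" by (simp add: right_diff_distrib scaleC_mult_right)
    then have "norm (e * a) \<le> d + cmod (hat a U) * norm e"
      using e(2) norm_triangle_ineq[of "e * (a - hat a U *\<^sub>C 1)" "hat a U *\<^sub>C e"] by (simp add: norm_scaleC)
    also have "\<dots> \<le> d + r * 1" using h[OF U] norm_projection_le[OF pe] r0
      by (intro add_left_mono mult_mono) auto
    finally show "\<exists>p\<in>J. p \<in> U" using e pe by (auto simp: J_def add.commute)
  qed (auto simp: J_def)
  then show "norm a \<le> r + d" by (simp add: J_def)
qed

text \<open>Near each point the constant \<open>f U\<close> is an approximation. Approximations on \<open>p\<close> and on \<open>q\<close> paste to one on their join,
  so compactness applies.\<close>

lemma continuous_uniformly_approximable: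
  fixes f :: "'a::comm_awstar_algebra set \<Rightarrow> complex"
  assumes f: "\<And>q. ultrafilter q \<Longrightarrow> (f \<longlongrightarrow> f q) (nhdsin stone_space q)" and r: "r > 0"
  shows "\<exists>a. \<forall>q. ultrafilter q \<longrightarrow> cmod (hat a q - f q) \<le> r"
proof -
  define J where "J = {e. projection e \<and> (\<exists>a. \<forall>q\<in>clop e. cmod (hat a q - f q) \<le> r)}"
  have "1 \<in> J"
  proof (rule compact_ideal)
    show "0 \<in> J" using ultrafilter_zero by (auto simp: J_def clop_def)
  next
    fix p q assume pq: "p \<in> J" "q \<in> J"
    then have P: "projection p" "projection q" by (auto simp: J_def)
    obtain a b where ab: "\<forall>U\<in>clop p. cmod (hat a U - f U) \<le> r" "\<forall>U\<in>clop q. cmod (hat b U - f U) \<le> r"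
      using pq by (auto simp: J_def)
    have "cmod (hat (p * a + (1 - p) * b) U - f U) \<le> r" if U: "U \<in> clop (p + q - p * q)" for U
    proof -
      have u: "ultrafilter U" "p + q - p * q \<in> U" using U by (auto simp: clop_def)
      have hU: "hat (p * a + (1 - p) * b) U = (if p \<in> U then hat a U else hat b U)"
        using u P by (simp add: hat_add hat_mult hat_projection projection_compl ultrafilter_compl)
      show ?thesis
      proof (cases "p \<in> U")
        case True then show ?thesis using hU ab u by (simp add: clop_def)
      next
        case False
        then have "1 - p \<in> U" using ultrafilter_compl[OF u(1) P(1)] by blast
        then have "(1 - p) * (p + q - p * q) \<in> U" using u ultrafilter_mult by blast
        moreover have "(1 - p) * (p + q - p * q) = (1 - p) * q" using P by (simp add: algebra_simps projection_idem)
        ultimately have "q \<in> U" using ultrafilter_mult_iff[OF u(1) projection_compl[OF P(1)] P(2)] by simp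
        then show ?thesis using False hU ab u by (simp add: clop_def)
      qed
    qed
    then show "p + q - p * q \<in> J" using projection_join[OF P] by (auto simp: J_def)
  next
    fix U :: "'a set" assume U: "ultrafilter U"
    have "\<forall>\<^sub>F x in nhdsin stone_space U. dist (f x) (f U) < r" using f[OF U] r by (rule tendstoD)
    then obtain e where e: "e \<in> U" "\<forall>x\<in>clop e. dist (f x) (f U) < r" unfolding eventually_nhdsin_stone[OF U] by blast
    have "cmod (hat (f U *\<^sub>C 1) x - f x) \<le> r" if "x \<in> clop e" for x
    proof -
      have "ultrafilter x" using that by (simp add: clop_def)
      then have "hat (f U *\<^sub>C 1) x = f U" by (simp add: hat_scaleC hat_one)
      moreover have "dist (f x) (f U) < r" using e(2) that by blast
      ultimately show ?thesis by (simp add: dist_norm norm_minus_commute[of "f U" "f x"])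
    qed
    then show "\<exists>p\<in>J. p \<in> U" using e ultrafilter_proj[OF U] by (auto simp: J_def)
  qed (auto simp: J_def)
  then obtain a where a: "\<forall>q\<in>clop 1. cmod (hat a q - f q) \<le> r" by (auto simp: J_def)
  have "q \<in> clop 1" if "ultrafilter q" for q :: "'a set" using that by (simp add: clop_def ultrafilter_one)
  then show ?thesis using a by blast
qed

lemma hat_surjective:
  fixes f :: "'a::comm_awstar_algebra set \<Rightarrow> complex"
  assumes f: "\<And>q. ultrafilter q \<Longrightarrow> (f \<longlongrightarrow> f q) (nhdsin stone_space q)"
  shows "\<exists>a. \<forall>q. ultrafilter q \<longrightarrow> hat a q = f q"
proof -
  have "\<forall>n. \<exists>a. \<forall>q. ultrafilter q \<longrightarrow> cmod (hat a q - f q) \<le> inverse (real (Suc n))"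
    by (intro allI continuous_uniformly_approximable f) auto
  then obtain a where a: "\<And>n q. ultrafilter q \<Longrightarrow> cmod (hat (a n) q - f q) \<le> inverse (real (Suc n))" by metis
  have "Cauchy a"
  proof (rule metric_CauchyI)
    fix e :: real assume "e > 0"
    then obtain N where N: "inverse (real (Suc N)) < e / 2" using reals_Archimedean[of "e/2"] half_gt_zero[of e] \<open>e > 0\<close> by blast
    have "dist (a m) (a n) < e" if mn: "m \<ge> N" "n \<ge> N" for m n
    proof -
      have "norm (a m - a n) \<le> inverse (real (Suc N)) + inverse (real (Suc N))"
      proof (rule norm_le_of_hat)
        fix q :: "'a set" assume q: "ultrafilter q"
        have "inverse (real (Suc m)) \<le> inverse (real (Suc N))" "inverse (real (Suc n)) \<le> inverse (real (Suc N))"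
          using mn by (auto intro: le_imp_inverse_le)
        moreover have eq: "hat (a m - a n) q = (hat (a m) q - f q) - (hat (a n) q - f q)" by (simp add: hat_diff[OF q])
        ultimately show "cmod (hat (a m - a n) q) \<le> inverse (real (Suc N)) + inverse (real (Suc N))"
          unfolding eq using a[OF q, of m] a[OF q, of n] norm_triangle_ineq4[of "hat (a m) q - f q" "hat (a n) q - f q"] by linarith
      qed
      then show ?thesis using N by (simp add: dist_norm)
    qed
    then show "\<exists>M. \<forall>m\<ge>M. \<forall>n\<ge>M. dist (a m) (a n) < e" by blast
  qed
  then obtain b where b: "a \<longlonglongrightarrow> b" by (metis Cauchy_convergent convergentD)
  have "hat b q = f q" if q: "ultrafilter q" for q
  proof -
    have "(\<lambda>n. hat (a n) q) \<longlonglongrightarrow> hat b q"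
    proof (rule LIM_zero_cancel, rule Lim_null_comparison)
      show "\<forall>\<^sub>F n in sequentially. norm (hat (a n) q - hat b q) \<le> norm (a n - b)"
        using cmod_hat_le[OF q] by (simp add: hat_diff[OF q, symmetric])
      show "(\<lambda>n. norm (a n - b)) \<longlonglongrightarrow> 0" using b by (simp add: LIM_zero tendsto_norm_zero)
    qed
    moreover have "(\<lambda>n. hat (a n) q) \<longlonglongrightarrow> f q"
    proof (rule LIM_zero_cancel, rule Lim_null_comparison)
      show "\<forall>\<^sub>F n in sequentially. norm (hat (a n) q - f q) \<le> inverse (real (Suc n))" using a[OF q] by simp
      show "(\<lambda>n. inverse (real (Suc n))) \<longlonglongrightarrow> 0" by (rule LIMSEQ_inverse_real_of_nat)
    qed
    ultimately show ?thesis by (rule LIMSEQ_unique)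
  qed
  then show ?thesis by blast
qed

lemma stone_continuous_iff:
  "f \<in> stone_continuous \<longleftrightarrow> f \<in> extensional {U. ultrafilter U} \<and>
    (\<forall>q. ultrafilter q \<longrightarrow> (f \<longlongrightarrow> f q) (nhdsin stone_space q))"
  by (simp add: stone_continuous_def continuous_map_stone_iff)

lemma tendsto_nhdsin_cong:
  assumes q: "ultrafilter q" and fg: "\<And>x. ultrafilter x \<Longrightarrow> f x = g x"
  shows "(f \<longlongrightarrow> l) (nhdsin stone_space q) \<longleftrightarrow> (g \<longlongrightarrow> l) (nhdsin stone_space q)"
proof (rule tendsto_cong)
  show "\<forall>\<^sub>F x in nhdsin stone_space q. f x = g x"
    unfolding eventually_nhdsin_stone[OF q] using ultrafilter_one[OF q] fg by (intro bexI[of _ 1]) (auto simp: clop_def)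
qed

lemma stone_iso_properties:
  "bij_betw (stone_iso :: 'a::comm_awstar_algebra \<Rightarrow> _) UNIV stone_continuous"
  "\<forall>q\<in>topspace stone_space.
      (\<forall>x y. stone_iso (x + y) q = stone_iso x q + stone_iso y q) \<and>
      (\<forall>c x. stone_iso (c *\<^sub>C x) q = c * stone_iso x q) \<and>
      (\<forall>x y. stone_iso (x * y) q = stone_iso x q * stone_iso y q) \<and>
      (\<forall>x. stone_iso (star x) q = cnj (stone_iso (x::'a) q)) \<and>
      (\<forall>p::'a. projection p \<longrightarrow> stone_iso p q = (if p \<in> q then 1 else 0))"
proof -
  define F where "F = (\<lambda>a::'a. \<lambda>q\<in>{U. ultrafilter U}. hat a q)"
  have "bij_betw F UNIV stone_continuous"
    unfolding bij_betw_def
  proof (intro conjI subset_antisym subsetI)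
    show "inj F"
    proof (rule injI)
      fix a b assume "F a = F b"
      then have "hat a q = hat b q" if "ultrafilter q" for q using that unfolding F_def
        by (metis mem_Collect_eq restrict_apply')
      then have "norm (a - b) \<le> 0" by (intro norm_le_of_hat) (simp add: hat_diff)
      then show "a = b" by simp
    qed
    fix f assume "f \<in> range F"
    then obtain a where f: "f = F a" by blast
    show "f \<in> stone_continuous"
      unfolding stone_continuous_iff
    proof (intro conjI allI impI)
      show "f \<in> extensional {U. ultrafilter U}" by (simp add: f F_def)
      fix q :: "'a set" assume q: "ultrafilter q"
      show "(f \<longlongrightarrow> f q) (nhdsin stone_space q)"
        using hat_continuous_at[OF q, of a] q by (subst tendsto_nhdsin_cong[OF q, of _ "hat a"]) (simp_all add: f F_def)
    qed
  next
    fix f :: "'a set \<Rightarrow> complex" assume f: "f \<in> stone_continuous"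
    then obtain a where a: "\<forall>q. ultrafilter q \<longrightarrow> hat a q = f q"
      using hat_surjective[of f] by (auto simp: stone_continuous_iff)
    have "f = F a" using f a
      by (intro extensionalityI[of f "{U. ultrafilter U}"]) (auto simp: stone_continuous_iff F_def)
    then show "f \<in> range F" by blast
  qed
  moreover have "\<forall>q\<in>topspace stone_space.
      (\<forall>x y. F (x + y) q = F x q + F y q) \<and>
      (\<forall>c x. F (c *\<^sub>C x) q = c * F x q) \<and>
      (\<forall>x y. F (x * y) q = F x q * F y q) \<and>
      (\<forall>x. F (star x) q = cnj (F x q)) \<and>
      (\<forall>p. projection p \<longrightarrow> F p q = (if p \<in> q then 1 else 0))"
    by (auto simp: F_def hat_add hat_scaleC hat_mult hat_star hat_projection)
  ultimately have "bij_betw F UNIV stone_continuous \<and> (\<forall>q\<in>topspace stone_space.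
      (\<forall>x y. F (x + y) q = F x q + F y q) \<and>
      (\<forall>c x. F (c *\<^sub>C x) q = c * F x q) \<and>
      (\<forall>x y. F (x * y) q = F x q * F y q) \<and>
      (\<forall>x. F (star x) q = cnj (F x q)) \<and>
      (\<forall>p. projection p \<longrightarrow> F p q = (if p \<in> q then 1 else 0)))" by blast
  from someI[of "\<lambda>\<Phi>. bij_betw \<Phi> UNIV stone_continuous \<and> (\<forall>q\<in>topspace stone_space.
      (\<forall>x y. \<Phi> (x + y) q = \<Phi> x q + \<Phi> y q) \<and>
      (\<forall>c x. \<Phi> (c *\<^sub>C x) q = c * \<Phi> x q) \<and>
      (\<forall>x y. \<Phi> (x * y) q = \<Phi> x q * \<Phi> y q) \<and>
      (\<forall>x. \<Phi> (star x) q = cnj (\<Phi> x q)) \<and>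
      (\<forall>p. projection p \<longrightarrow> \<Phi> p q = (if p \<in> q then 1 else 0)))", OF this]
  show "bij_betw (stone_iso :: 'a \<Rightarrow> _) UNIV stone_continuous"
    "\<forall>q\<in>topspace stone_space.
      (\<forall>x y. stone_iso (x + y) q = stone_iso x q + stone_iso y q) \<and>
      (\<forall>c x. stone_iso (c *\<^sub>C x) q = c * stone_iso x q) \<and>
      (\<forall>x y. stone_iso (x * y) q = stone_iso x q * stone_iso y q) \<and>
      (\<forall>x. stone_iso (star x) q = cnj (stone_iso (x::'a) q)) \<and>
      (\<forall>p::'a. projection p \<longrightarrow> stone_iso p q = (if p \<in> q then 1 else 0))"
    unfolding stone_iso_def by blast+
qed

context
  fixes q :: "'a::comm_awstar_algebra set"
  assumes q: "ultrafilter q"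
begin

lemma stone_iso_add: "stone_iso (x + y) q = stone_iso x q + stone_iso y q"
  and stone_iso_scaleC: "stone_iso (c *\<^sub>C x) q = c * stone_iso x q"
  and stone_iso_mult: "stone_iso (x * y) q = stone_iso x q * stone_iso y q"
  and stone_iso_projection: "projection p \<Longrightarrow> stone_iso p q = (if p \<in> q then 1 else 0)"
  using stone_iso_properties(2) q by auto

lemma stone_iso_continuous_at: "(stone_iso a \<longlongrightarrow> stone_iso a q) (nhdsin stone_space q)"
  using bij_betwE[OF stone_iso_properties(1)] q by (auto simp: stone_continuous_iff)

end

lemma stone_iso_eqI:
  assumes "\<And>q. ultrafilter q \<Longrightarrow> stone_iso a q = stone_iso b q" shows "a = b"
proof -
  have "stone_iso a = stone_iso b"
    using assms bij_betwE[OF stone_iso_properties(1)]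
    by (intro extensionalityI[of _ "{U. ultrafilter U}"]) (auto simp: stone_continuous_iff)
  then show ?thesis using stone_iso_properties(1) by (auto simp: bij_betw_def dest: injD)
qed

lemma stone_iso_surjective:
  fixes f :: "'a::comm_awstar_algebra set \<Rightarrow> complex"
  assumes f: "\<And>q. ultrafilter q \<Longrightarrow> (f \<longlongrightarrow> f q) (nhdsin stone_space q)"
  obtains a where "\<And>q. ultrafilter q \<Longrightarrow> stone_iso a q = f q"
proof -
  define g where "g = (\<lambda>q\<in>{U. ultrafilter U}. f q)"
  have "g \<in> stone_continuous"
    unfolding stone_continuous_iff
  proof (intro conjI allI impI)
    show "g \<in> extensional {U. ultrafilter U}" by (simp add: g_def)
    fix q :: "'a set" assume q: "ultrafilter q"
    show "(g \<longlongrightarrow> g q) (nhdsin stone_space q)"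
      using f[OF q] q by (subst tendsto_nhdsin_cong[OF q, of _ f]) (simp_all add: g_def)
  qed
  then obtain a where "stone_iso a = g" using stone_iso_properties(1) unfolding bij_betw_def by (metis imageE)
  then have "stone_iso a q = f q" if "ultrafilter q" for q using that by (simp add: g_def)
  then show ?thesis by (rule that)
qed

text \<open>Here \<open>stone_iso\<close> is known by its algebraic properties alone, so the bound comes from compactness of
  the Stone space.\<close>

lemma stone_iso_bounded:
  fixes a :: "'a::comm_awstar_algebra"
  obtains B where "B > 0" "\<And>q. ultrafilter q \<Longrightarrow> cmod (stone_iso a q) \<le> B"
proof -
  define J where "J = {e :: 'a. projection e \<and> (\<exists>B. \<forall>q\<in>clop e. cmod (stone_iso a q) \<le> B)}"
  have "1 \<in> J"
  proof (rule compact_ideal)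
    show "0 \<in> J" using ultrafilter_zero by (auto simp: J_def clop_def)
  next
    fix p q assume pq: "p \<in> J" "q \<in> J"
    then have P: "projection p" "projection q" by (auto simp: J_def)
    obtain B C where BC: "\<forall>U\<in>clop p. cmod (stone_iso a U) \<le> B" "\<forall>U\<in>clop q. cmod (stone_iso a U) \<le> C"
      using pq by (auto simp: J_def)
    have "cmod (stone_iso a U) \<le> max B C" if U: "U \<in> clop (p + q - p * q)" for U
    proof -
      have u: "ultrafilter U" "p + q - p * q \<in> U" using U by (auto simp: clop_def)
      have "p \<in> U \<or> q \<in> U"
      proof (rule ccontr)
        assume "\<not> (p \<in> U \<or> q \<in> U)"
        then have "(1 - p) * (1 - q) \<in> U" using u P ultrafilter_compl ultrafilter_mult by blast
        moreover have "(1 - p) * (1 - q) = 1 - (p + q - p * q)" by (simp add: algebra_simps)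
        ultimately show False using u ultrafilter_compl[OF u(1) projection_join[OF P]] by simp
      qed
      then show ?thesis using BC u by (auto simp: clop_def intro: max.coboundedI1 max.coboundedI2)
    qed
    then show "p + q - p * q \<in> J" using projection_join[OF P] unfolding J_def by blast
  next
    fix U :: "'a set" assume U: "ultrafilter U"
    have "\<forall>\<^sub>F x in nhdsin stone_space U. dist (stone_iso a x) (stone_iso a U) < 1"
      using stone_iso_continuous_at[OF U] by (rule tendstoD) simp
    then obtain e where e: "e \<in> U" "\<forall>x\<in>clop e. dist (stone_iso a x) (stone_iso a U) < 1"
      unfolding eventually_nhdsin_stone[OF U] by blast
    have "cmod (stone_iso a x) \<le> cmod (stone_iso a U) + 1" if "x \<in> clop e" for x
      using e(2) that norm_triangle_ineq2[of "stone_iso a x" "stone_iso a U"] by (fastforce simp: dist_norm)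
    then show "\<exists>p\<in>J. p \<in> U" using e ultrafilter_proj[OF U] unfolding J_def by blast
  qed (auto simp: J_def)
  then obtain B where B: "\<forall>q\<in>clop 1. cmod (stone_iso a q) \<le> B" by (auto simp: J_def)
  have "q \<in> clop 1" if "ultrafilter q" for q :: "'a set" using that by (simp add: clop_def ultrafilter_one)
  then have "cmod (stone_iso a q) \<le> max B 1" if "ultrafilter q" for q
    using B that by (meson max.coboundedI1)
  then show ?thesis using that[of "max B 1"] by simp
qed

section \<open>The algebra of measurable operators as a ring type\<close>

lemma zero_in_C_infty: "(\<lambda>q\<in>topspace stone_space. 0) \<in> (C_infty :: ('a::comm_awstar_algebra set \<Rightarrow> ereal) set)"
  unfolding C_infty_iff
proof (intro conjI allI impI)
  show "((\<lambda>q\<in>topspace stone_space. 0) \<longlongrightarrow> (\<lambda>q\<in>topspace stone_space. 0 :: ereal) q) (nhdsin stone_space q)"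
    if q: "ultrafilter q" for q :: "'a set"
    by (subst tendsto_nhdsin_cong[OF q, of _ "\<lambda>_. 0"]) (use q in auto)
  show "\<forall>\<^sub>F q in generic. \<bar>(\<lambda>q\<in>topspace stone_space. 0 :: ereal) q\<bar> \<noteq> \<infinity>"
    using eventually_generic_ultrafilter by eventually_elim simp
qed simp

lemma S_zero_in_S_alg: "S_zero \<in> S_alg"
  unfolding S_zero_def S_alg_def using zero_in_C_infty by simp

text \<open>The elements of \<open>S(A)\<close>, the operators affiliated with \<open>A\<close>, as a type, so that the ring operations become
  class operations.\<close>

typedef (overloaded) 'a aff = "S_alg :: 'a::comm_awstar_algebra meas set"
  morphisms rep_aff Abs_aff
  using S_zero_in_S_alg by blast

text \<open>The value at a point. It is meaningful only where \<open>z\<close> is finite, which is a generic set.\<close>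

definition ev :: "'a::comm_awstar_algebra aff \<Rightarrow> 'a set \<Rightarrow> complex"
  where "ev z = val (rep_aff z)"

lemma rep_aff_in [simp]: "rep_aff z \<in> S_alg" by (rule rep_aff)

lemma aff_eqI: "\<forall>\<^sub>F q in generic. ev z q = ev w q \<Longrightarrow> z = w"
  unfolding ev_def using S_alg_eqI[OF rep_aff rep_aff] by (simp add: rep_aff_inject)

lemma ev_generically_continuous: "generically_continuous (ev z)"
  unfolding ev_def by (rule val_generically_continuous) simp

lemma ev_continuous_at: "\<forall>\<^sub>F q in generic. (ev z \<longlongrightarrow> ev z q) (nhdsin stone_space q)"
  using ev_generically_continuous unfolding generically_continuous_def .

definition aff_of :: "('a::comm_awstar_algebra set \<Rightarrow> complex) \<Rightarrow> 'a aff"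
  where "aff_of f = Abs_aff (S_ext f)"

lemma rep_aff_of: "generically_continuous f \<Longrightarrow> rep_aff (aff_of f) = S_ext f"
  unfolding aff_of_def by (rule Abs_aff_inverse) (rule S_ext)

lemma ev_aff_of: "generically_continuous f \<Longrightarrow> \<forall>\<^sub>F q in generic. ev (aff_of f) q = f q"
  unfolding ev_def using S_ext(2)[of f] by (simp add: rep_aff_of) (auto elim: eventually_mono)

lemma generically_continuous_const: "generically_continuous (\<lambda>_. c)"
  by (simp add: generically_continuous_def)

lemma generically_continuous_add: "generically_continuous f \<Longrightarrow> generically_continuous g \<Longrightarrow>
    generically_continuous (\<lambda>q. f q + g q :: complex)"
  unfolding generically_continuous_def by (erule (1) eventually_elim2) (rule tendsto_add)

lemma generically_continuous_mult: "generically_continuous f \<Longrightarrow> generically_continuous g \<Longrightarrow>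
    generically_continuous (\<lambda>q. f q * g q :: complex)"
  unfolding generically_continuous_def by (erule (1) eventually_elim2) (rule tendsto_mult)

lemma generically_continuous_uminus: "generically_continuous f \<Longrightarrow> generically_continuous (\<lambda>q. - f q :: complex)"
  unfolding generically_continuous_def by (auto elim!: eventually_mono intro: tendsto_intros)

instantiation aff :: (comm_awstar_algebra) comm_ring_1
begin

definition "0 = Abs_aff S_zero"
definition "1 = (aff_of (\<lambda>_. 1) :: 'a aff)"
definition "z + w = Abs_aff (S_add (rep_aff z) (rep_aff w))" for z w :: "'a aff"
definition "z * w = Abs_aff (S_mult (rep_aff z) (rep_aff w))" for z w :: "'a aff"
definition "- z = aff_of (\<lambda>q. - ev z q)" for z :: "'a aff"
definition "z - w = z + (- w)" for z w :: "'a aff"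

lemma ev_zero: "\<forall>\<^sub>F q in generic. ev (0 :: 'a aff) q = 0"
  using eventually_generic_ultrafilter
  unfolding zero_aff_def ev_def Abs_aff_inverse[OF S_zero_in_S_alg]
  by eventually_elim (simp add: val_def S_zero_def complex_eq_iff)

lemma ev_one: "\<forall>\<^sub>F q in generic. ev (1 :: 'a aff) q = 1"
  unfolding one_aff_def by (rule ev_aff_of) (rule generically_continuous_const)

lemma ev_add: "\<forall>\<^sub>F q in generic. ev (z + w) q = ev z q + ev w q" for z w :: "'a aff"
  using ev_aff_of[OF generically_continuous_add[OF ev_generically_continuous[of z] ev_generically_continuous[of w]]]
  by (simp add: plus_aff_def S_add_def aff_of_def ev_def)

lemma ev_mult: "\<forall>\<^sub>F q in generic. ev (z * w) q = ev z q * ev w q" for z w :: "'a aff"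
  using ev_aff_of[OF generically_continuous_mult[OF ev_generically_continuous[of z] ev_generically_continuous[of w]]]
  by (simp add: times_aff_def S_mult_def aff_of_def ev_def)

lemma ev_uminus: "\<forall>\<^sub>F q in generic. ev (- z) q = - ev z q" for z :: "'a aff"
  unfolding uminus_aff_def by (rule ev_aff_of[OF generically_continuous_uminus[OF ev_generically_continuous]])

instance
proof
  fix a b c :: "'a aff"
  show "a * b * c = a * (b * c)"
    by (rule aff_eqI)
      (use ev_mult[of a b] ev_mult[of "a * b" c] ev_mult[of b c] ev_mult[of a "b * c"] in eventually_elim, simp)
  show "a * b = b * a"
    by (rule aff_eqI) (use ev_mult[of a b] ev_mult[of b a] in eventually_elim, simp)
  show "1 * a = a"
    by (rule aff_eqI) (use ev_mult[of 1 a] ev_one in eventually_elim, simp)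
  show "a + b + c = a + (b + c)"
    by (rule aff_eqI)
      (use ev_add[of a b] ev_add[of "a + b" c] ev_add[of b c] ev_add[of a "b + c"] in eventually_elim, simp)
  show "a + b = b + a"
    by (rule aff_eqI) (use ev_add[of a b] ev_add[of b a] in eventually_elim, simp)
  show "0 + a = a"
    by (rule aff_eqI) (use ev_add[of 0 a] ev_zero in eventually_elim, simp)
  show "- a + a = 0"
    by (rule aff_eqI) (use ev_add[of "- a" a] ev_uminus[of a] ev_zero in eventually_elim, simp)
  show "a - b = a + - b" by (simp add: minus_aff_def)
  show "(a + b) * c = a * c + b * c"
    by (rule aff_eqI)
      (use ev_add[of a b] ev_mult[of "a + b" c] ev_mult[of a c] ev_mult[of b c] ev_add[of "a * c" "b * c"]
        in eventually_elim, simp add: distrib_right)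
  show "(0 :: 'a aff) \<noteq> 1"
  proof
    assume a: "(0 :: 'a aff) = 1"
    have "\<forall>\<^sub>F q in generic :: 'a set filter. (0::complex) = 1"
      using ev_zero ev_one by eventually_elim (metis a)
    then show False by (rule generic_point[of _ 1]) auto
  qed
qed

end

lemma ev_diff: "\<forall>\<^sub>F q in generic. ev (z - w) q = ev z q - ev w q"
  using ev_add[of z "- w"] ev_uminus[of w] by eventually_elim simp

lemma ev_of_nat: "\<forall>\<^sub>F q in generic. ev (of_nat n) q = of_nat n"
proof (induction n)
  case 0 then show ?case using ev_zero by simp
next
  case (Suc n)
  then show ?case using ev_one ev_add[of 1 "of_nat n"] by eventually_elim simp
qed

lemma ev_power: "\<forall>\<^sub>F q in generic. ev (z ^ n) q = ev z q ^ n"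
proof (induction n)
  case 0 then show ?case using ev_one by simp
next
  case (Suc n)
  then show ?case using ev_mult[of z "z ^ n"] by eventually_elim simp
qed

lemma ev_sum:
  assumes "finite A" shows "\<forall>\<^sub>F q in generic. ev (sum f A) q = (\<Sum>i\<in>A. ev (f i) q)"
  using assms
proof (induction A rule: finite_induct)
  case empty then show ?case using ev_zero by simp
next
  case (insert x F)
  show ?case using insert.IH ev_add[of "f x" "sum f F"] by eventually_elim (simp add: insert)
qed

lemma ev_poly: "\<forall>\<^sub>F q in generic. ev (poly f y) q = (\<Sum>i\<le>degree f. ev (coeff f i) q * ev y q ^ i)"
proof -
  have "\<forall>\<^sub>F q in generic. \<forall>i\<in>{..degree f}. ev (coeff f i * y ^ i) q = ev (coeff f i) q * ev y q ^ i"
  proof (rule eventually_ball_finite, simp, intro ballI)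
    fix i
    show "\<forall>\<^sub>F q in generic. ev (coeff f i * y ^ i) q = ev (coeff f i) q * ev y q ^ i"
      using ev_mult[of "coeff f i" "y ^ i"] ev_power[of y i] by eventually_elim simp
  qed
  then show ?thesis unfolding poly_altdef
    using ev_sum[of "{..degree f}" "\<lambda>i. coeff f i * y ^ i"] by (auto elim: eventually_elim2)
qed

text \<open>A dense open set is a neighbourhood of each of its points.\<close>

lemma generic_nhds:
  assumes "eventually P generic" shows "\<forall>\<^sub>F q in generic. \<forall>\<^sub>F y in nhdsin stone_space q. P y"
proof -
  obtain D where D: "openin stone_space D" "stone_space closure_of D = topspace stone_space" "\<forall>q\<in>D. P q"
    using assms by (rule generic_denseE)
  show ?thesis unfolding eventually_generic_dense
  proof (intro exI conjI ballI)
    fix q assume "q \<in> D"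
    then show "\<forall>\<^sub>F y in nhdsin stone_space q. P y" using D by (auto simp: eventually_nhdsin)
  qed (use D in auto)
qed

text \<open>The boundary of an open set is nowhere dense.\<close>

lemma generic_dichotomy:
  assumes "\<forall>\<^sub>F q in generic. P q \<longrightarrow> (\<forall>\<^sub>F y in nhdsin stone_space q. P y)"
  shows "\<forall>\<^sub>F q in generic. (\<forall>\<^sub>F y in nhdsin stone_space q. P y) \<or> (\<forall>\<^sub>F y in nhdsin stone_space q. \<not> P y)"
  unfolding eventually_generic
proof (intro allI impI)
  fix p :: 'a assume "projection p" "p \<noteq> 0"
  then obtain r where r: "projection r" "r \<noteq> 0" "r * p = r"
    "\<forall>q\<in>clop r. P q \<longrightarrow> (\<forall>\<^sub>F y in nhdsin stone_space q. P y)"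
    using assms unfolding eventually_generic by blast
  show "\<exists>r. projection r \<and> r \<noteq> 0 \<and> r * p = r \<and> (\<forall>q\<in>clop r. (\<forall>\<^sub>F y in nhdsin stone_space q. P y) \<or>
      (\<forall>\<^sub>F y in nhdsin stone_space q. \<not> P y))"
  proof (cases "\<exists>q\<in>clop r. P q")
    case True
    then obtain q where q: "q \<in> clop r" "P q" by blast
    then have u: "ultrafilter q" "r \<in> q" by (auto simp: clop_def)
    obtain s where s: "s \<in> q" "\<forall>y\<in>clop s. P y" using r q eventually_nhdsin_stone[OF u(1)] by blast
    have ps: "projection s" using s u ultrafilter_proj by blast
    have "s * r \<in> q" using s u ultrafilter_mult by blast
    then have "s * r \<noteq> 0" using u ultrafilter_zero by metis
    moreover have "\<forall>\<^sub>F y in nhdsin stone_space x. P y" if "x \<in> clop (s * r)" for x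
    proof -
      have "x \<in> clop s" using that clop_mult[OF ps r(1)] by blast
      then show ?thesis using s by (subst eventually_nhdsin_stone) (auto simp: clop_def)
    qed
    moreover have "s * r * p = s * r" using r(3) by (simp add: mult.assoc)
    ultimately show ?thesis using projection_mult[OF ps r(1)] by blast
  next
    case False
    have "\<forall>\<^sub>F y in nhdsin stone_space x. \<not> P y" if "x \<in> clop r" for x
      using that False by (subst eventually_nhdsin_stone) (auto simp: clop_def)
    then show ?thesis using r by blast
  qed
qed

section \<open>The embedding of the algebra\<close>

text \<open>The inclusion of \<open>A\<close> in \<open>S(A)\<close>.\<close>

definition E :: "'a::comm_awstar_algebra \<Rightarrow> 'a aff"
  where "E a = Abs_aff (emb a)"

lemma emb_in_S_alg: "emb (a :: 'a::comm_awstar_algebra) \<in> S_alg"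
proof -
  have "(\<lambda>q\<in>topspace stone_space. ereal (g (stone_iso a q))) \<in> C_infty"
    if g: "\<And>q. ultrafilter q \<Longrightarrow> ((\<lambda>x. g (stone_iso a x)) \<longlongrightarrow> g (stone_iso a q)) (nhdsin stone_space q)"
    for g
    unfolding C_infty_iff
  proof (intro conjI allI impI)
    show "((\<lambda>q\<in>topspace stone_space. ereal (g (stone_iso a q))) \<longlongrightarrow>
        (\<lambda>q\<in>topspace stone_space. ereal (g (stone_iso a q))) q) (nhdsin stone_space q)"
      if q: "ultrafilter q" for q :: "'a set"
      by (subst tendsto_nhdsin_cong[OF q, of _ "\<lambda>q. ereal (g (stone_iso a q))"]) (use q g[OF q] in auto)
    show "\<forall>\<^sub>F q in generic. \<bar>(\<lambda>q\<in>topspace stone_space. ereal (g (stone_iso a q))) q\<bar> \<noteq> \<infinity>"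
      using eventually_generic_ultrafilter by eventually_elim simp
  qed simp
  from this[of Re] this[of Im] show ?thesis
    by (simp add: emb_def S_alg_def stone_iso_continuous_at tendsto_Re tendsto_Im)
qed

lemma rep_E: "rep_aff (E a) = emb a"
  by (simp add: E_def Abs_aff_inverse emb_in_S_alg)

lemma ev_E: "ultrafilter q \<Longrightarrow> ev (E a) q = stone_iso a q"
  by (simp add: ev_def rep_E val_def emb_def)

lemma eventually_ev_E: "\<forall>\<^sub>F q in generic. ev (E a) q = stone_iso a q"
  using eventually_generic_ultrafilter by eventually_elim (rule ev_E)

lemma eventually_ev_E_projection:
  "projection p \<Longrightarrow> \<forall>\<^sub>F q in generic. ev (E p) q = (if p \<in> q then 1 else 0)"
  using eventually_generic_ultrafilter by eventually_elim (simp add: ev_E stone_iso_projection)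

lemma E_add: "E (a + b) = E a + E b"
  by (rule aff_eqI, use eventually_generic_ultrafilter ev_add[of "E a" "E b"] in eventually_elim)
    (simp add: ev_E stone_iso_add)

lemma E_mult: "E (a * b) = E a * E b"
  by (rule aff_eqI, use eventually_generic_ultrafilter ev_mult[of "E a" "E b"] in eventually_elim)
    (simp add: ev_E stone_iso_mult)

lemma E_one: "E 1 = 1"
  by (rule aff_eqI, use eventually_generic_ultrafilter ev_one in eventually_elim)
    (simp add: ev_E stone_iso_projection ultrafilter_one)

lemma E_zero: "E 0 = 0"
  using E_add[of 0 0] by simp

lemma E_diff: "E (a - b) = E a - E b"
  using E_add[of "a - b" b] by simp

lemma E_eq_iff: "E a = E b \<longleftrightarrow> a = b"
proof
  assume "E a = E b"
  then have "stone_iso a q = stone_iso b q" if "ultrafilter q" for q using ev_E[OF that] by metis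
  then show "a = b" by (rule stone_iso_eqI)
qed simp

lemma E_idem: "projection p \<Longrightarrow> E p * E p = E p"
  by (simp add: E_mult[symmetric] projection_idem)

lemma E_proj_mult: "projection p \<Longrightarrow> E p * (E p * z) = E p * z"
  by (simp add: mult.assoc[symmetric] E_idem)

definition cst :: "complex \<Rightarrow> 'a::comm_awstar_algebra aff"
  where "cst c = E (c *\<^sub>C 1)"

lemma ev_cst: "\<forall>\<^sub>F q in generic. ev (cst c) q = c"
  unfolding cst_def using eventually_generic_ultrafilter
  by eventually_elim (simp add: ev_E stone_iso_scaleC stone_iso_projection ultrafilter_one)

lemma cst_add: "cst (c + d) = cst c + cst d" by (simp add: cst_def scaleC_add_left E_add)
lemma cst_mult: "cst (c * d) = cst c * cst d"
  by (simp add: cst_def E_mult[symmetric] scaleC_mult_left scaleC_mult_right scaleC_scaleC mult.commute)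
lemma cst_one [simp]: "cst 1 = 1" by (simp add: cst_def E_one)
lemma cst_zero [simp]: "cst 0 = 0" by (simp add: cst_def E_zero)
lemma cst_uminus: "cst (- c) = - cst c"
  using cst_add[of "- c" c] by (simp add: eq_neg_iff_add_eq_0)
lemma E_scaleC: "E (c *\<^sub>C a) = cst c * E a"
  by (simp add: cst_def E_mult[symmetric] scaleC_mult_left)

section \<open>Local behaviour of measurable operators\<close>

lemma E_mult_eq_0_iff:
  assumes p: "projection p"
  shows "E p * z = 0 \<longleftrightarrow> (\<forall>\<^sub>F q in generic. p \<in> q \<longrightarrow> ev z q = 0)"
proof
  assume "E p * z = 0"
  then have "\<forall>\<^sub>F q in generic. ev (E p * z) q = 0" using ev_zero by simp
  then show "\<forall>\<^sub>F q in generic. p \<in> q \<longrightarrow> ev z q = 0"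
    using ev_mult[of "E p" z] eventually_ev_E_projection[OF p] by eventually_elim auto
next
  assume z: "\<forall>\<^sub>F q in generic. p \<in> q \<longrightarrow> ev z q = 0"
  show "E p * z = 0"
    by (intro aff_eqI, use z ev_mult[of "E p" z] eventually_ev_E_projection[OF p] ev_zero in eventually_elim) auto
qed

lemma E_mult_eq_iff:
  assumes p: "projection p"
  shows "E p * z = E p * w \<longleftrightarrow> (\<forall>\<^sub>F q in generic. p \<in> q \<longrightarrow> ev z q = ev w q)"
proof -
  have "E p * z = E p * w \<longleftrightarrow> E p * (z - w) = 0" by (simp add: right_diff_distrib)
  also have "\<dots> \<longleftrightarrow> (\<forall>\<^sub>F q in generic. p \<in> q \<longrightarrow> ev (z - w) q = 0)" by (rule E_mult_eq_0_iff[OF p])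
  also have "\<dots> \<longleftrightarrow> (\<forall>\<^sub>F q in generic. p \<in> q \<longrightarrow> ev z q = ev w q)"
    by (intro eventually_subst) (use ev_diff[of z w] in eventually_elim, simp)
  finally show ?thesis .
qed

text \<open>The union of the clopen sets of the members of \<open>S\<close> is dense in the clopen set of their supremum.\<close>

lemma E_psup_mult_eq_0:
  assumes S: "\<And>e. e \<in> S \<Longrightarrow> projection e" and z: "\<And>e. e \<in> S \<Longrightarrow> E e * z = 0"
  shows "E (psup S) * z = 0"
  unfolding E_mult_eq_0_iff[OF psup(1)] eventually_generic
proof (intro allI impI)
  fix p :: 'a assume p: "projection p" "p \<noteq> 0"
  show "\<exists>r. projection r \<and> r \<noteq> 0 \<and> r * p = r \<and> (\<forall>q\<in>clop r. psup S \<in> q \<longrightarrow> ev z q = 0)"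
  proof (cases "p * psup S = 0")
    case True
    have "psup S \<notin> q" if q: "q \<in> clop p" for q
    proof
      assume "psup S \<in> q"
      then have "p * psup S \<in> q" using q by (auto simp: clop_def intro: ultrafilter_mult)
      then show False using True q by (auto simp: clop_def ultrafilter_zero)
    qed
    then show ?thesis using p by (intro exI[of _ p]) (auto simp: projection_idem)
  next
    case False
    then obtain e where e: "e \<in> S" "p * e \<noteq> 0" by (rule psup_meets)
    have pe: "projection (p * e)" "projection e" using p S e projection_mult by auto
    have "\<forall>\<^sub>F q in generic. e \<in> q \<longrightarrow> ev z q = 0" using z[OF e(1)] E_mult_eq_0_iff[OF pe(2)] by simp
    then obtain r where r: "projection r" "r \<noteq> 0" "r * (p * e) = r" "\<forall>q\<in>clop r. e \<in> q \<longrightarrow> ev z q = 0"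
      unfolding eventually_generic using pe(1) e(2) by blast
    have re: "r * e = r" "r * p = r" using r(3) p pe
      by (metis mult.assoc mult.commute projection_idem)+
    have "ev z q = 0" if q: "q \<in> clop r" for q
    proof -
      have "e \<in> q" using q re pe by (auto simp: clop_def intro: ultrafilter_up)
      then show ?thesis using r q by blast
    qed
    then show ?thesis using r re by blast
  qed
qed

lemma nonzero_locally_bounded_below:
  assumes "z \<noteq> 0"
  obtains e c where "projection e" "e \<noteq> 0" "c > 0" "\<And>q. q \<in> clop e \<Longrightarrow> c \<le> cmod (ev z q)"
    "\<And>q. q \<in> clop e \<Longrightarrow> cmod (ev z q) \<le> 1 / c"
proof -
  have "\<not> (\<forall>\<^sub>F q in generic. ev z q = 0)"
  proof
    assume z: "\<forall>\<^sub>F q in generic. ev z q = 0"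
    have "z = 0" by (intro aff_eqI, use z ev_zero in eventually_elim) simp
    then show False using assms by simp
  qed
  then obtain p where p: "projection p" "p \<noteq> 0"
    "\<And>r. projection r \<Longrightarrow> r \<noteq> 0 \<Longrightarrow> r * p = r \<Longrightarrow> \<exists>q\<in>clop r. ev z q \<noteq> 0"
    unfolding eventually_generic by blast
  obtain r where r: "projection r" "r \<noteq> 0" "r * p = r"
    "\<forall>q\<in>clop r. (ev z \<longlongrightarrow> ev z q) (nhdsin stone_space q)"
    using ev_continuous_at[of z] p unfolding eventually_generic by blast
  obtain q where q: "q \<in> clop r" "ev z q \<noteq> 0" using p(3)[OF r(1-3)] by blast
  define m where "m = cmod (ev z q)"
  have m: "m > 0" using q by (simp add: m_def)
  have u: "ultrafilter q" using q by (simp add: clop_def)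
  have "((\<lambda>y. cmod (ev z y)) \<longlongrightarrow> m) (nhdsin stone_space q)" unfolding m_def using r q by (intro tendsto_norm) auto
  then have "\<forall>\<^sub>F y in nhdsin stone_space q. m / 2 < cmod (ev z y) \<and> cmod (ev z y) < m + 1"
    using m by (intro eventually_conj order_tendstoD) auto
  then obtain e where e: "e \<in> q" "\<forall>y\<in>clop e. m / 2 < cmod (ev z y) \<and> cmod (ev z y) < m + 1"
    unfolding eventually_nhdsin_stone[OF u] by blast
  define c where "c = min (m / 2) (1 / (m + 1))"
  show ?thesis
  proof (rule that)
    show "projection e" "e \<noteq> 0" using e u ultrafilter_proj ultrafilter_zero by metis+
    show c0: "c > 0" using m by (simp add: c_def)
    fix y assume "y \<in> clop e"
    then have y: "m / 2 < cmod (ev z y)" "cmod (ev z y) < m + 1" using e by auto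
    show "c \<le> cmod (ev z y)" using y by (auto simp: c_def)
    have "c \<le> 1 / (m + 1)" by (simp add: c_def)
    then have "m + 1 \<le> 1 / c" using m c0 by (simp add: field_simps)
    then show "cmod (ev z y) \<le> 1 / c" using y by linarith
  qed
qed

text \<open>Only the boundary of the zero set is exceptional: in its interior the inverse is \<open>0\<close>.\<close>

lemma generically_continuous_inverse:
  assumes f: "generically_continuous f" shows "generically_continuous (\<lambda>q. inverse (f q :: complex))"
proof -
  have "\<forall>\<^sub>F q in generic. f q \<noteq> 0 \<longrightarrow> (\<forall>\<^sub>F y in nhdsin stone_space q. f y \<noteq> 0)"
    using f unfolding generically_continuous_def by (auto elim!: eventually_mono dest: tendsto_imp_eventually_ne)
  from generic_dichotomy[OF this] show ?thesis
    using f eventually_generic_ultrafilter unfolding generically_continuous_def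
  proof eventually_elim
    case (elim q)
    from elim(1) show ?case
    proof
      assume "\<forall>\<^sub>F y in nhdsin stone_space q. f y \<noteq> 0"
      then have "f q \<noteq> 0" unfolding eventually_nhdsin_stone[OF elim(3)] using elim(3) by (auto simp: clop_def)
      then show ?thesis using elim by (intro tendsto_inverse) auto
    next
      assume ev: "\<forall>\<^sub>F y in nhdsin stone_space q. \<not> f y \<noteq> 0"
      then have "f q = 0" unfolding eventually_nhdsin_stone[OF elim(3)] using elim(3) by (auto simp: clop_def)
      moreover have "\<forall>\<^sub>F y in nhdsin stone_space q. inverse (f y) = 0" using ev by eventually_elim simp
      ultimately show ?thesis by (simp add: tendsto_eventually)
    qed
  qed
qed

lemma aff_regular: "\<exists>w. z * w * z = (z :: 'a::comm_awstar_algebra aff)"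
proof -
  define w where "w = aff_of (\<lambda>q. inverse (ev z q))"
  have w: "\<forall>\<^sub>F q in generic. ev w q = inverse (ev z q)"
    unfolding w_def by (rule ev_aff_of[OF generically_continuous_inverse[OF ev_generically_continuous]])
  have "z * w * z = z"
    by (rule aff_eqI, use w ev_mult[of z w] ev_mult[of "z * w" z] in eventually_elim)
      (metis left_inverse mult.assoc mult.commute mult_1 mult_zero_right)
  then show ?thesis by blast
qed

text \<open>The quotients \<open>b / a\<close> agree where two of them are defined, hence they define one continuous function
  on an open set; it is extended by zero to the complement of its closure.\<close>

lemma aff_solvable_system:
  fixes T :: "('a::comm_awstar_algebra aff \<times> 'a aff) set"
  assumes supp: "\<And>a b c. (a, b) \<in> T \<Longrightarrow> c * a = 0 \<Longrightarrow> c * b = 0"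
    and compat: "\<And>a b c d. (a, b) \<in> T \<Longrightarrow> (c, d) \<in> T \<Longrightarrow> a * d = c * b"
  shows "\<exists>u. \<forall>(a, b)\<in>T. a * u = b"
proof -
  let ?cont = "\<lambda>(z :: 'a aff) q. (ev z \<longlongrightarrow> ev z q) (nhdsin stone_space q)"
  define W where "W = (\<lambda>(a :: 'a aff) b q. \<forall>\<^sub>F y in nhdsin stone_space q. ev a y \<noteq> 0 \<and> ?cont a y \<and> ?cont b y)"
  \<comment> \<open>the open set on which some quotient is defined\<close>
  define P where "P = (\<lambda>q. ultrafilter q \<and> (\<exists>(a, b)\<in>T. W a b q))"
  define u where "u = (\<lambda>q. if P q then (THE l. \<forall>(a, b)\<in>T. W a b q \<longrightarrow> l = ev b q / ev a q) else 0)"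
  have Wq: "ev a q \<noteq> 0" "?cont a q" "?cont b q" if "W a b q" "ultrafilter q" for a b q
    using that(1) unfolding W_def eventually_nhdsin_stone[OF that(2)] using that(2) by (auto simp: clop_def)
  have Wopen: "\<forall>\<^sub>F y in nhdsin stone_space q. ultrafilter y \<and> W a b y" if Wab: "W a b q" and uq: "ultrafilter q" for a b q
  proof -
    obtain e where e: "e \<in> q" "\<forall>y\<in>clop e. ev a y \<noteq> 0 \<and> ?cont a y \<and> ?cont b y"
      using Wab unfolding W_def eventually_nhdsin_stone[OF uq] by blast
    have "W a b y" if y: "y \<in> clop e" for y
    proof -
      have "ultrafilter y" "e \<in> y" using y by (auto simp: clop_def)
      then show ?thesis unfolding W_def using e by (subst eventually_nhdsin_stone) auto
    qed
    then show ?thesis unfolding eventually_nhdsin_stone[OF uq] using e by (auto simp: clop_def)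
  qed
  have uq: "u q = ev b q / ev a q" if ab: "(a, b) \<in> T" and w: "W a b q" and q: "ultrafilter q" for a b q
  proof -
    have eq: "ev b q / ev a q = ev d q / ev c q" if cd: "(c, d) \<in> T" "W c d q" for c d
    proof -
      have "ev a q * ev d q = ev c q * ev b q"
      proof (rule generic_eq_imp_eq[OF _ _ q])
        have "\<forall>\<^sub>F q in generic. ev (a * d) q = ev (c * b) q" using compat[OF ab cd(1)] by simp
        then show "\<forall>\<^sub>F q in generic. ev a q * ev d q = ev c q * ev b q"
          using ev_mult[of a d] ev_mult[of c b] by eventually_elim simp
      qed (intro tendsto_mult Wq[OF w q] Wq[OF cd(2) q])+
      then show ?thesis using Wq[OF w q] Wq[OF cd(2) q] by (simp add: field_simps)
    qed
    have "P q" using ab w q by (auto simp: P_def)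
    moreover have "(THE l. \<forall>(a, b)\<in>T. W a b q \<longrightarrow> l = ev b q / ev a q) = ev b q / ev a q"
      by (rule the_equality) (use eq ab w in blast)+
    ultimately show ?thesis by (simp add: u_def)
  qed
  have Popen: "\<forall>\<^sub>F y in nhdsin stone_space q. P y" if Pq: "P q" for q
  proof -
    obtain a b where ab: "(a, b) \<in> T" "W a b q" "ultrafilter q" using Pq by (auto simp: P_def)
    show ?thesis using Wopen[OF ab(2,3)] by eventually_elim (use ab in \<open>auto simp: P_def\<close>)
  qed
  have "\<forall>\<^sub>F q in generic. P q \<longrightarrow> (\<forall>\<^sub>F y in nhdsin stone_space q. P y)"
    using Popen by simp
  from generic_dichotomy[OF this] have gu: "generically_continuous u"
    unfolding generically_continuous_def
    using eventually_generic_ultrafilter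
  proof eventually_elim
    case (elim q)
    have q: "ultrafilter q" using elim by simp
    show ?case
    proof (cases "P q")
      case True
      then obtain a b where ab: "(a, b) \<in> T" "W a b q" by (auto simp: P_def)
      have "\<forall>\<^sub>F y in nhdsin stone_space q. u y = ev b y / ev a y"
        using Wopen[OF ab(2) q] by eventually_elim (use uq[OF ab(1)] in blast)
      moreover have "((\<lambda>y. ev b y / ev a y) \<longlongrightarrow> ev b q / ev a q) (nhdsin stone_space q)"
        by (intro tendsto_divide Wq[OF ab(2) q])
      ultimately show ?thesis using uq[OF ab q] by (simp add: tendsto_cong)
    next
      case False
      then have "\<not> (\<forall>\<^sub>F y in nhdsin stone_space q. P y)"
        unfolding eventually_nhdsin_stone[OF q] using q by (auto simp: clop_def)
      then have "\<forall>\<^sub>F y in nhdsin stone_space q. \<not> P y" using elim(1) by blast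
      then have "\<forall>\<^sub>F y in nhdsin stone_space q. u y = 0" by eventually_elim (simp add: u_def)
      then show ?thesis using False by (simp add: u_def tendsto_eventually)
    qed
  qed
  have "a * aff_of u = b" if ab: "(a, b) \<in> T" for a b
  proof (rule aff_eqI)
    have "\<forall>\<^sub>F q in generic. ev a q \<noteq> 0 \<longrightarrow> (\<forall>\<^sub>F y in nhdsin stone_space q. ev a y \<noteq> 0)"
      using ev_continuous_at[of a] by (auto elim!: eventually_mono dest: tendsto_imp_eventually_ne)
    from generic_dichotomy[OF this] generic_nhds[OF ev_continuous_at[of a]] generic_nhds[OF ev_continuous_at[of b]]
      eventually_generic_ultrafilter
    have "\<forall>\<^sub>F q in generic. ev a q * u q = ev b q"
    proof eventually_elim
      case (elim q)
      have q: "ultrafilter q" using elim by simp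
      from elim(1) show ?case
      proof
        assume "\<forall>\<^sub>F y in nhdsin stone_space q. ev a y \<noteq> 0"
        then have w: "W a b q" unfolding W_def using elim(2,3) by eventually_elim simp
        then show ?thesis using uq[OF ab w q] Wq[OF w q] by simp
      next
        assume "\<forall>\<^sub>F y in nhdsin stone_space q. \<not> ev a y \<noteq> 0"
        then obtain e where e: "e \<in> q" "\<forall>y\<in>clop e. ev a y = 0" unfolding eventually_nhdsin_stone[OF q] by blast
        have pe: "projection e" using e q ultrafilter_proj by blast
        have "E e * a = 0" unfolding E_mult_eq_0_iff[OF pe]
          using eventually_generic_ultrafilter by eventually_elim (use e in \<open>auto simp: clop_def\<close>)
        then have eb: "E e * b = 0" by (rule supp[OF ab])
        have "\<forall>\<^sub>F y in generic. ev (E e) y * ev b y = 0"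
          using ev_mult[of "E e" b] ev_zero by eventually_elim (simp add: eb)
        moreover have "?cont b q" using elim(3) unfolding eventually_nhdsin_stone[OF q] using q by (auto simp: clop_def)
        moreover have "?cont (E e) q"
          using stone_iso_continuous_at[OF q, of e] q
          by (subst tendsto_nhdsin_cong[OF q, of _ "stone_iso e"]) (auto simp: ev_E)
        ultimately have "ev (E e) q * ev b q = 0"
          using q by (intro generic_eq_imp_eq[of "\<lambda>y. ev (E e) y * ev b y" q "\<lambda>_. 0"]) (auto intro: tendsto_mult)
        then have "ev b q = 0" using e q pe by (simp add: ev_E stone_iso_projection)
        moreover have "ev a q = 0" using e q by (auto simp: clop_def)
        ultimately show ?thesis by simp
      qed
    qed
    then show "\<forall>\<^sub>F q in generic. ev (a * aff_of u) q = ev b q"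
      using ev_mult[of a "aff_of u"] ev_aff_of[OF gu] by eventually_elim simp
  qed
  then show ?thesis by blast
qed

instance aff :: (comm_awstar_algebra) complete_regular_ring
proof
  fix z :: "'a aff" and T :: "('a aff \<times> 'a aff) set" and n :: nat
  show "\<exists>w. z * w * z = z" by (rule aff_regular)
  show "\<exists>u. \<forall>(a, b)\<in>T. a * u = b"
    if "\<And>a b c. (a, b) \<in> T \<Longrightarrow> c * a = 0 \<Longrightarrow> c * b = 0"
      "\<And>a b c d. (a, b) \<in> T \<Longrightarrow> (c, d) \<in> T \<Longrightarrow> a * d = c * b"
    using that by (rule aff_solvable_system)
  assume "of_nat (Suc n) * z = 0"
  then have "\<forall>\<^sub>F q in generic. ev (of_nat (Suc n) * z) q = 0" using ev_zero by simp
  then show "z = 0"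
    using ev_mult[of "of_nat (Suc n)" z] ev_of_nat[of "Suc n", where 'a='a] ev_zero
    by (intro aff_eqI, eventually_elim) (auto simp del: of_nat_Suc)
qed

lemma glue_disjoint:
  fixes f :: "'a::comm_awstar_algebra \<Rightarrow> 'a aff"
  assumes S: "\<And>e. e \<in> S \<Longrightarrow> projection e" "\<And>e d. e \<in> S \<Longrightarrow> d \<in> S \<Longrightarrow> e \<noteq> d \<Longrightarrow> e * d = 0"
  obtains z where "\<forall>e\<in>S. E e * z = E e * f e"
proof -
  have "\<exists>u. \<forall>(a, b)\<in>(\<lambda>e. (E e, E e * f e)) ` S. a * u = b"
  proof (rule solvable_system)
    fix a b c assume "(a, b) \<in> (\<lambda>e. (E e, E e * f e)) ` S" "c * a = 0"
    then show "c * b = 0" by (auto simp: mult.assoc[symmetric])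
  next
    fix a b c d
    assume "(a, b) \<in> (\<lambda>e. (E e, E e * f e)) ` S" "(c, d) \<in> (\<lambda>e. (E e, E e * f e)) ` S"
    then obtain e e' where e: "e \<in> S" "a = E e" "b = E e * f e" and e': "e' \<in> S" "c = E e'" "d = E e' * f e'"
      by auto
    show "a * d = c * b"
    proof (cases "e = e'")
      case False
      then have "E e * E e' = 0" using S(2)[OF e(1) e'(1)] by (simp add: E_mult[symmetric] E_zero)
      then show ?thesis unfolding e e' by (metis mult.assoc mult.commute mult_zero_left)
    qed (use e e' in simp)
  qed
  then show ?thesis using that by auto
qed

section \<open>Translation of the operations on \<^const>\<open>S_alg\<close>\<close>

lemma rep_add: "rep_aff (z + w) = S_add (rep_aff z) (rep_aff w)"
  using rep_aff_of[OF generically_continuous_add[OF ev_generically_continuous[of z] ev_generically_continuous[of w]]]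
  by (simp add: plus_aff_def S_add_def aff_of_def ev_def)

lemma rep_mult: "rep_aff (z * w) = S_mult (rep_aff z) (rep_aff w)"
  using rep_aff_of[OF generically_continuous_mult[OF ev_generically_continuous[of z] ev_generically_continuous[of w]]]
  by (simp add: times_aff_def S_mult_def aff_of_def ev_def)

lemma rep_zero: "rep_aff 0 = S_zero"
  by (simp add: zero_aff_def Abs_aff_inverse S_zero_in_S_alg)

lemma rep_scale: "rep_aff (cst c * z) = S_scale c (rep_aff z)"
proof -
  have g: "generically_continuous (\<lambda>q. c * ev z q)" by (rule generically_continuous_mult[OF generically_continuous_const ev_generically_continuous])
  have "aff_of (\<lambda>q. c * ev z q) = cst c * z"
    by (rule aff_eqI, use ev_aff_of[OF g] ev_mult[of "cst c" z] ev_cst[of c] in eventually_elim) simp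
  then show ?thesis using rep_aff_of[OF g] by (simp add: S_scale_def ev_def)
qed

lemma rep_star: "\<forall>\<^sub>F q in generic. val (S_star (rep_aff z)) q = cnj (ev z q)" "S_star (rep_aff z) \<in> S_alg"
proof -
  have g: "generically_continuous (\<lambda>q. cnj (ev z q))"
    using ev_continuous_at[of z] unfolding generically_continuous_def by (auto elim!: eventually_mono intro: tendsto_cnj)
  show "\<forall>\<^sub>F q in generic. val (S_star (rep_aff z)) q = cnj (ev z q)"
    using S_ext(2)[OF g] unfolding S_star_def ev_def by eventually_elim simp
  show "S_star (rep_aff z) \<in> S_alg" using S_ext(1)[OF g] unfolding S_star_def ev_def by simp
qed

lemma S_abs_generic: "S_abs (rep_aff z) \<in> C_infty" "\<forall>\<^sub>F q in generic. S_abs (rep_aff z) q = ereal (cmod (ev z q))"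
proof -
  define s where "s = Abs_aff (S_star (rep_aff z))"
  have rs: "rep_aff s = S_star (rep_aff z)" by (simp add: s_def Abs_aff_inverse rep_star)
  have s: "\<forall>\<^sub>F q in generic. ev s q = cnj (ev z q)" using rep_star(1)[of z] by (simp add: ev_def rs)
  define f where "f = (\<lambda>q. complex_of_real (sqrt (Re (ev (s * z) q))))"
  have g: "generically_continuous f"
    using ev_continuous_at[of "s * z"] unfolding generically_continuous_def f_def
    by (auto elim!: eventually_mono intro!: tendsto_of_real tendsto_real_sqrt tendsto_Re)
  have A: "S_abs (rep_aff z) = fst (S_ext f)"
    unfolding S_abs_def f_def ev_def rep_mult rs ..
  show "S_abs (rep_aff z) \<in> C_infty" using S_ext(1)[OF g] by (simp add: A S_alg_def mem_Times_iff)
  show "\<forall>\<^sub>F q in generic. S_abs (rep_aff z) q = ereal (cmod (ev z q))"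
    using S_ext(2)[OF g] s ev_mult[of s z]
  proof eventually_elim
    case (elim q)
    have "ev (s * z) q = complex_of_real ((cmod (ev z q))\<^sup>2)"
      using elim complex_norm_square[of "ev z q"] by (simp add: mult.commute)
    then have "f q = complex_of_real (cmod (ev z q))" by (simp add: f_def)
    then have "real_of_ereal (fst (S_ext f) q) = cmod (ev z q)"
      using elim(1) by (simp add: val_def complex_eq_iff)
    then show ?case using elim(1) by (auto simp: A finite_at_def ereal_real')
  qed
qed

lemma S_abs_le_iff:
  "S_abs_le (rep_aff y) (rep_aff x) \<longleftrightarrow> (\<forall>\<^sub>F q in generic. cmod (ev y q) \<le> cmod (ev x q))"
proof
  assume "S_abs_le (rep_aff y) (rep_aff x)"
  then have le: "S_abs (rep_aff y) q \<le> S_abs (rep_aff x) q" if "ultrafilter q" for q using that by (simp add: S_abs_le_def)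
  show "\<forall>\<^sub>F q in generic. cmod (ev y q) \<le> cmod (ev x q)"
    using eventually_generic_ultrafilter S_abs_generic(2)[of y] S_abs_generic(2)[of x]
    by eventually_elim (use le in force)
next
  assume "\<forall>\<^sub>F q in generic. cmod (ev y q) \<le> cmod (ev x q)"
  then have gen: "\<forall>\<^sub>F q in generic. S_abs (rep_aff y) q \<le> S_abs (rep_aff x) q"
    using S_abs_generic(2)[of y] S_abs_generic(2)[of x] by eventually_elim simp
  show "S_abs_le (rep_aff y) (rep_aff x)"
    unfolding S_abs_le_def
  proof (intro ballI)
    fix q :: "'a set" assume "q \<in> topspace stone_space"
    then have q: "ultrafilter q" by simp
    show "S_abs (rep_aff y) q \<le> S_abs (rep_aff x) q"
      using S_abs_generic(1)[of y] S_abs_generic(1)[of x] q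
      by (intro generic_le_imp_le[OF _ _ q gen]) (auto simp: C_infty_iff)
  qed
qed

section \<open>Suprema and supports\<close>

lemma carrier_projections:
  assumes p: "projection p"
  shows "carrier (projections {p * a | a. True}) = {e. projection e \<and> e * p = e}"
proof -
  have "e \<in> {p * a | a. True} \<longleftrightarrow> e * p = e" for e
  proof
    assume "e \<in> {p * a | a. True}" then show "e * p = e" using p by (auto simp: mult_ac projection_idem)
  next
    assume "e * p = e" then show "e \<in> {p * a | a. True}" by (metis (mono_tags, lifting) mem_Collect_eq mult.commute)
  qed
  then show ?thesis by (auto simp: projections_def)
qed

lemma le_projections [simp]: "e \<sqsubseteq>\<^bsub>projections B\<^esub> f \<longleftrightarrow> e * f = e"
  by (simp add: projections_def)

lemma sup_projections:
  assumes p: "projection p" and S: "S \<subseteq> carrier (projections {p * a | a. True})"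
  shows "\<Squnion>\<^bsub>projections {p * a | a. True}\<^esub> S = psup S"
proof -
  define L where "L = projections {p * a | a. True}"
  have c: "carrier L = {e. projection e \<and> e * p = e}" unfolding L_def by (rule carrier_projections[OF p])
  have le: "e \<sqsubseteq>\<^bsub>L\<^esub> f \<longleftrightarrow> e * f = e" for e f by (simp add: L_def)
  have S': "projection e" "e * p = e" if "e \<in> S" for e
    using S that carrier_projections[OF p] by blast+
  have "psup S * p = psup S" by (rule psup_least) (rule S')
  then have "psup S \<in> carrier L" using psup(1) by (simp add: c)
  moreover have "psup S * d = psup S" if "\<And>e. e \<in> S \<Longrightarrow> e * d = e" for d
    using that by (rule psup_least)
  ultimately have least: "least L (psup S) (Upper L S)"
    unfolding least_def Upper_def le using S' psup_upper by (auto simp: c)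
  have "x = psup S" if "least L x (Upper L S)" for x
    using least that unfolding least_def le by (metis le_antisym)
  then show ?thesis unfolding Lattice.sup_def L_def[symmetric] using least by (metis someI)
qed

lemma inf_projections:
  assumes p: "projection p" and S: "S \<subseteq> carrier (projections {p * a | a. True})" "S \<noteq> {}"
  shows "\<Sqinter>\<^bsub>projections {p * a | a. True}\<^esub> S = 1 - psup ((\<lambda>e. 1 - e) ` S)"
proof -
  define L where "L = projections {p * a | a. True}"
  define m where "m = 1 - psup ((\<lambda>e. 1 - e) ` S)"
  have c: "carrier L = {e. projection e \<and> e * p = e}" unfolding L_def by (rule carrier_projections[OF p])
  have le: "e \<sqsubseteq>\<^bsub>L\<^esub> f \<longleftrightarrow> e * f = e" for e f by (simp add: L_def)
  have S': "projection e" "e * p = e" if "e \<in> S" for e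
    using S(1) that carrier_projections[OF p] by blast+
  have pm: "projection m" unfolding m_def by (rule projection_compl[OF psup(1)])
  have me: "m * e = m" if e: "e \<in> S" for e
  proof -
    have "(1 - e) * psup ((\<lambda>e. 1 - e) ` S) = 1 - e" by (rule psup_upper) (use e in blast)
    then show ?thesis by (simp add: m_def algebra_simps)
  qed
  obtain e0 where e0: "e0 \<in> S" using S by blast
  have mp: "m * p = m" using le_trans_mult[OF me[OF e0] S'(2)[OF e0]] .
  have gm: "d * m = d" if "\<And>e. e \<in> S \<Longrightarrow> d * e = d" for d
  proof -
    have "psup ((\<lambda>e. 1 - e) ` S) * d = 0" unfolding psup using that by (auto simp: algebra_simps)
    then show ?thesis by (simp add: m_def algebra_simps)
  qed
  have "m \<in> carrier L" using pm mp by (simp add: c)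
  then have great: "greatest L m (Lower L S)"
    unfolding greatest_def Lower_def le using S' me gm by (auto simp: c)
  have "x = m" if "greatest L x (Lower L S)" for x
    using great that unfolding greatest_def le by (metis le_antisym)
  then show ?thesis unfolding Lattice.inf_def m_def[symmetric] L_def[symmetric] using great by (metis someI)
qed

lemma UNIV_eq_one_multiples: "(UNIV :: 'a::comm_awstar_algebra set) = {1 * a | a. True}"
  by auto

lemma sup_projections_UNIV:
  "(\<And>e. e \<in> S \<Longrightarrow> projection e) \<Longrightarrow> \<Squnion>\<^bsub>projections UNIV\<^esub> S = psup S"
  unfolding UNIV_eq_one_multiples by (intro sup_projections) (auto simp: carrier_projections[OF projection_one, simplified])

lemma supp_projection: "projection (supp (rep_aff z))"
  and supp_mult_eq_0_iff: "projection e \<Longrightarrow> e * supp (rep_aff z) = 0 \<longleftrightarrow> E e * z = 0"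
proof -
  define N where "N = {e. projection e \<and> E e * z = 0}"
  have "S_mult (emb e) (rep_aff z) = S_zero \<longleftrightarrow> E e * z = 0" for e
    by (metis rep_E rep_aff_inject rep_mult rep_zero)
  then have "supp (rep_aff z) = 1 - \<Squnion>\<^bsub>projections UNIV\<^esub> N" by (simp add: supp_def N_def)
  then have s: "supp (rep_aff z) = 1 - psup N" by (subst (asm) sup_projections_UNIV) (auto simp: N_def)
  show "projection (supp (rep_aff z))" unfolding s by (rule projection_compl[OF psup(1)])
  have n: "E (psup N) * z = 0" by (rule E_psup_mult_eq_0) (auto simp: N_def)
  assume e: "projection e"
  show "e * supp (rep_aff z) = 0 \<longleftrightarrow> E e * z = 0"
  proof
    assume "e * supp (rep_aff z) = 0"
    then have "e = e * psup N" by (simp add: s algebra_simps)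
    then have "E e = E e * E (psup N)" by (metis E_mult)
    then show "E e * z = 0" using n by (metis mult.assoc mult_zero_right)
  next
    assume "E e * z = 0"
    then have "e * psup N = e" using e by (intro psup_upper) (simp add: N_def)
    then show "e * supp (rep_aff z) = 0" by (simp add: s algebra_simps)
  qed
qed

lemma supp_set_projection: "Z \<subseteq> S_alg \<Longrightarrow> projection (supp_set Z)"
  and supp_set_mult_eq_0_iff:
    "Z \<subseteq> S_alg \<Longrightarrow> projection e \<Longrightarrow> e * supp_set Z = 0 \<longleftrightarrow> (\<forall>z. rep_aff z \<in> Z \<longrightarrow> E e * z = 0)"
proof -
  assume Z: "Z \<subseteq> S_alg"
  then have rep: "\<exists>z. y = rep_aff z" if "y \<in> Z" for y using that by (metis Abs_aff_inverse subsetD)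
  then have "projection s" if "s \<in> supp ` Z" for s using that supp_projection by fastforce
  then have s: "supp_set Z = psup (supp ` Z)" unfolding supp_set_def by (rule sup_projections_UNIV)
  show "projection (supp_set Z)" unfolding s by (rule psup)
  assume e: "projection e"
  have "e * supp_set Z = 0 \<longleftrightarrow> (\<forall>y\<in>Z. e * supp y = 0)"
    unfolding s using psup(2)[of "supp ` Z" e] by (auto simp: mult.commute)
  also have "\<dots> \<longleftrightarrow> (\<forall>z. rep_aff z \<in> Z \<longrightarrow> e * supp (rep_aff z) = 0)" using rep by metis
  finally show "e * supp_set Z = 0 \<longleftrightarrow> (\<forall>z. rep_aff z \<in> Z \<longrightarrow> E e * z = 0)"
    by (simp add: supp_mult_eq_0_iff[OF e])
qed

section \<open>Sigma-distributivity and locally constant elements\<close>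

text \<open>Weak distributivity below \<open>d\<close> itself: given countably many countable covers of \<open>d\<close>, some non-zero
  part of \<open>d\<close> lies below one member of each cover. A family covers \<open>d\<close> if every part of \<open>d\<close>
  meets one of its members.\<close>

definition refinable :: "'a::comm_awstar_algebra \<Rightarrow> bool"
  where "refinable d \<longleftrightarrow> (\<forall>c :: nat \<Rightarrow> nat \<Rightarrow> 'a. (\<forall>n m. projection (c n m)) \<longrightarrow>
    (\<forall>n e. projection e \<longrightarrow> e \<noteq> 0 \<longrightarrow> e * d = e \<longrightarrow> (\<exists>m. e * c n m \<noteq> 0)) \<longrightarrow>
    (\<exists>\<phi> q. projection q \<and> q \<noteq> 0 \<and> q * d = q \<and> (\<forall>n. q * c n (\<phi> n) = q)))"

text \<open>The law is applied to the complements of the covers in \<open>d\<close>. All infima on its left-hand side are \<open>0\<close>,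
  so for some \<open>\<phi>\<close> the supremum on the right is not \<open>d\<close>.\<close>

lemma sigma_distributive_imp_refinable:
  assumes p: "projection p" and sd: "sigma_distributive (projections {p * a | a. True})"
    and d: "projection d" "d \<noteq> 0" "d * p = d"
  shows "refinable d"
  unfolding refinable_def
proof (intro allI impI)
  fix c :: "nat \<Rightarrow> nat \<Rightarrow> 'a"
  assume c: "\<forall>n m. projection (c n m)"
    and cover: "\<forall>n e. projection e \<longrightarrow> e \<noteq> 0 \<longrightarrow> e * d = e \<longrightarrow> (\<exists>m. e * c n m \<noteq> 0)"
  define L where "L = projections {p * a | a. True}"
  have cL: "carrier L = {e. projection e \<and> e * p = e}" unfolding L_def by (rule carrier_projections[OF p])
  define e where "e = (\<lambda>n m. d * (1 - c n m))"
  have ed: "e n m * d = e n m" for n m using d by (simp add: e_def mult_ac projection_idem)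
  have eP: "projection (e n m)" for n m using d c by (simp add: e_def projection_mult projection_compl)
  have eL: "e n m \<in> carrier L" for n m
    using eP[of n m] le_trans_mult[OF ed d(3)] by (simp add: cL)
  have inf0: "\<Sqinter>\<^bsub>L\<^esub> {e n m | m. True} = 0" for n
  proof -
    define i where "i = \<Sqinter>\<^bsub>L\<^esub> {e n m | m. True}"
    have i: "i = 1 - psup ((\<lambda>e. 1 - e) ` {e n m | m. True})"
      unfolding i_def L_def by (rule inf_projections[OF p]) (use eL L_def in auto)
    have iP: "projection i" unfolding i by (rule projection_compl[OF psup(1)])
    have ie: "i * e n m = i" for m
    proof -
      have "(1 - e n m) * psup ((\<lambda>e. 1 - e) ` {e n m | m. True}) = 1 - e n m" by (rule psup_upper) blast
      then show ?thesis by (simp add: i algebra_simps)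
    qed
    have "i * d = i" using le_trans_mult[OF ie ed] .
    moreover have "i * c n m = 0" for m
    proof -
      have "i * c n m = i * e n m * c n m" using ie by simp
      also have "\<dots> = i * d * ((1 - c n m) * c n m)" by (simp add: e_def mult_ac)
      also have "(1 - c n m) * c n m = 0" using c by (simp add: left_diff_distrib projection_idem)
      finally show ?thesis by simp
    qed
    ultimately show ?thesis using cover iP unfolding i_def[symmetric] by blast
  qed
  define s where "s = (\<lambda>\<phi> :: nat \<Rightarrow> nat. psup {e n (\<phi> n) | n. True})"
  have s: "\<Squnion>\<^bsub>L\<^esub> {e n (\<phi> n) | n. True} = s \<phi>" for \<phi>
    unfolding s_def L_def by (rule sup_projections[OF p]) (use eL L_def in auto)
  have sP: "projection (s \<phi>)" for \<phi> unfolding s_def by (rule psup)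
  have sd': "s \<phi> * d = s \<phi>" for \<phi> unfolding s_def by (rule psup_least) (use ed in auto)
  have sL: "s \<phi> \<in> carrier L" for \<phi> using sP le_trans_mult[OF sd' d(3)] by (simp add: cL)
  show "\<exists>\<phi> q. projection q \<and> q \<noteq> 0 \<and> q * d = q \<and> (\<forall>n. q * c n (\<phi> n) = q)"
  proof (rule ccontr)
    assume none: "\<not> ?thesis"
    have ds: "d * s \<phi> = d" for \<phi>
    proof (rule ccontr)
      assume "d * s \<phi> \<noteq> d"
      define q where "q = d * (1 - s \<phi>)"
      have "q \<noteq> 0" using \<open>d * s \<phi> \<noteq> d\<close> by (simp add: q_def le_iff_compl)
      moreover have "projection q" using d sP by (simp add: q_def projection_mult projection_compl)
      moreover have qd: "q * d = q" using d by (simp add: q_def mult_ac projection_idem)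
      moreover have "q * c n (\<phi> n) = q" for n
      proof -
        have "e n (\<phi> n) * s \<phi> = e n (\<phi> n)" unfolding s_def by (rule psup_upper) blast
        then have "q * e n (\<phi> n) = 0" by (simp add: q_def algebra_simps)
        then have "q * d * (1 - c n (\<phi> n)) = 0" by (simp add: e_def mult.assoc)
        then show ?thesis unfolding qd by (simp add: algebra_simps)
      qed
      ultimately show False using none by blast
    qed
    have "{\<Sqinter>\<^bsub>L\<^esub> {e n m | m. True} | n. True} = {0}" unfolding inf0 by simp
    moreover have "{0} \<subseteq> carrier L" by (simp add: cL)
    ultimately have "\<Squnion>\<^bsub>L\<^esub> {\<Sqinter>\<^bsub>L\<^esub> {e n m | m. True} | n. True} = psup {0 :: 'a}"
      unfolding L_def by (simp only: sup_projections[OF p])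
    also have "\<dots> = 0" using psup_least[of "{0::'a}" 0] by simp
    finally have "\<Squnion>\<^bsub>L\<^esub> {\<Sqinter>\<^bsub>L\<^esub> {e n m | m. True} | n. True} = 0" .
    moreover have "\<forall>n m. e n m \<in> carrier L" using eL by blast
    note sd[folded L_def, unfolded sigma_distributive_def, THEN spec[of _ e], THEN mp, OF this]
    ultimately have "\<Sqinter>\<^bsub>L\<^esub> {\<Squnion>\<^bsub>L\<^esub> {e n (\<phi> n) | n. True} | \<phi>. True} = 0"
      by (rule trans[OF sym, rotated])
    then have "\<Sqinter>\<^bsub>L\<^esub> {s \<phi> | \<phi>. True} = 0" unfolding s .
    then have "psup ((\<lambda>e. 1 - e) ` {s \<phi> | \<phi>. True}) = 1"
      unfolding L_def by (subst (asm) inf_projections[OF p]) (use sL L_def in auto)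
    moreover have "psup ((\<lambda>e. 1 - e) ` {s \<phi> | \<phi>. True}) * d = 0"
      unfolding psup using ds by (auto simp: right_diff_distrib mult.commute[of _ d])
    ultimately show False using d by simp
  qed
qed

text \<open>If the law fails for \<open>e\<close>, the complements of the \<open>e n m\<close> cover the difference of the two sides, and a common
  refinement would contradict the definition of the right-hand side.\<close>

lemma refinable_imp_sigma_distributive:
  assumes p: "projection p"
    and ref: "\<And>d. projection d \<Longrightarrow> d \<noteq> 0 \<Longrightarrow> d * p = d \<Longrightarrow> refinable d"
  shows "sigma_distributive (projections {p * a | a. True})"
  unfolding sigma_distributive_def
proof (intro allI impI)
  fix e :: "nat \<Rightarrow> nat \<Rightarrow> 'a"
  define L where "L = projections {p * a | a. True}"
  have cL: "carrier L = {e. projection e \<and> e * p = e}" unfolding L_def by (rule carrier_projections[OF p])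
  assume "\<forall>n m. e n m \<in> carrier (projections {p * a | a. True})"
  then have eL: "e n m \<in> carrier L" for n m by (simp add: L_def)
  then have eP: "projection (e n m)" "e n m * p = e n m" for n m by (auto simp: cL)
  define i where "i = (\<lambda>n. \<Sqinter>\<^bsub>L\<^esub> {e n m | m. True})"
  have i': "\<Sqinter>\<^bsub>L\<^esub> {e n m | m. True} = i n" for n by (simp add: i_def)
  have i: "i n = 1 - psup ((\<lambda>e. 1 - e) ` {e n m | m. True})" for n
    unfolding i_def L_def by (rule inf_projections[OF p]) (use eL L_def in auto)
  have iP: "projection (i n)" for n unfolding i by (rule projection_compl[OF psup(1)])
  have ie: "i n * e n m = i n" for n m
  proof -
    have "(1 - e n m) * psup ((\<lambda>e. 1 - e) ` {e n m | m. True}) = 1 - e n m" by (rule psup_upper) blast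
    then show ?thesis by (simp add: i algebra_simps)
  qed
  have iL: "i n \<in> carrier L" for n using iP le_trans_mult[OF ie eP(2)] by (simp add: cL)
  have i_great: "d * i n = d" if de: "\<And>m. d * e n m = d" for d n
  proof -
    have "psup ((\<lambda>e. 1 - e) ` {e n m | m. True}) * d = 0"
      unfolding psup
    proof
      fix x assume "x \<in> (\<lambda>e. 1 - e) ` {e n m | m. True}"
      then obtain m where x: "x = 1 - e n m" by blast
      show "x * d = 0" using de[of m] by (simp add: x right_diff_distrib mult.commute[of _ d])
    qed
    then show ?thesis by (simp add: i right_diff_distrib mult.commute)
  qed
  define s where "s = (\<lambda>\<phi> :: nat \<Rightarrow> nat. psup {e n (\<phi> n) | n. True})"
  have s: "\<Squnion>\<^bsub>L\<^esub> {e n (\<phi> n) | n. True} = s \<phi>" for \<phi>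
    unfolding s_def L_def by (rule sup_projections[OF p]) (use eL L_def in auto)
  have sP: "projection (s \<phi>)" for \<phi> unfolding s_def by (rule psup)
  have es: "e n (\<phi> n) * s \<phi> = e n (\<phi> n)" for n \<phi> unfolding s_def by (rule psup_upper) blast
  have sp: "s \<phi> * p = s \<phi>" for \<phi> unfolding s_def by (rule psup_least) (use eP in auto)
  have sL: "s \<phi> \<in> carrier L" for \<phi> using sP sp by (simp add: cL)
  define l where "l = psup {i n | n. True}"
  have l: "\<Squnion>\<^bsub>L\<^esub> {i n | n. True} = l"
    unfolding l_def L_def by (rule sup_projections[OF p]) (use iL L_def in auto)
  have lP: "projection l" unfolding l_def by (rule psup)
  have il: "i n * l = i n" for n unfolding l_def by (rule psup_upper) blast
  define r where "r = 1 - psup ((\<lambda>e. 1 - e) ` {s \<phi> | \<phi>. True})"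
  have r: "\<Sqinter>\<^bsub>L\<^esub> {s \<phi> | \<phi>. True} = r"
    unfolding r_def L_def by (rule inf_projections[OF p]) (use sL L_def in auto)
  have rP: "projection r" unfolding r_def by (rule projection_compl[OF psup(1)])
  have rs: "r * s \<phi> = r" for \<phi>
  proof -
    have "(1 - s \<phi>) * psup ((\<lambda>e. 1 - e) ` {s \<phi> | \<phi>. True}) = 1 - s \<phi>" by (rule psup_upper) blast
    then show ?thesis by (simp add: r_def algebra_simps)
  qed
  have lr: "l * r = l"
    unfolding l_def
  proof (rule psup_least)
    fix x assume "x \<in> {i n | n. True}"
    then obtain n where x: "x = i n" by blast
    have "psup ((\<lambda>e. 1 - e) ` {s \<phi> | \<phi>. True}) * x = 0"
      unfolding psup x using le_trans_mult[OF ie es] by (auto simp: right_diff_distrib mult.commute[of _ "i n"])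
    then show "x * r = x" by (simp add: r_def right_diff_distrib mult.commute)
  qed
  have "r * l = r"
  proof (rule ccontr)
    assume "r * l \<noteq> r"
    define d where "d = r * (1 - l)"
    have dP: "projection d" using rP lP by (simp add: d_def projection_mult projection_compl)
    have d0: "d \<noteq> 0" using \<open>r * l \<noteq> r\<close> by (simp add: d_def le_iff_compl)
    have dr: "d * r = d" using rP by (simp add: d_def mult_ac projection_idem)
    have dl: "d * l = 0"
    proof -
      have "d * l = r * (l - l * l)" by (simp add: d_def algebra_simps)
      then show ?thesis using lP by (simp add: projection_idem)
    qed
    have dp: "d * p = d" using le_trans_mult[OF le_trans_mult[OF dr rs] sp] .
    have "\<exists>\<phi> q. projection q \<and> q \<noteq> 0 \<and> q * d = q \<and> (\<forall>n. q * (1 - e n (\<phi> n)) = q)"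
    proof (rule ref[OF dP d0 dp, unfolded refinable_def, rule_format])
      show "projection (1 - e n m)" for n m by (rule projection_compl[OF eP(1)])
      fix n e' assume e': "projection e'" "e' \<noteq> 0" "e' * d = e'"
      show "\<exists>m. e' * (1 - e n m) \<noteq> 0"
      proof (rule ccontr)
        assume "\<not> ?thesis"
        then have "e' * e n m = e'" for m by (simp add: le_iff_compl)
        then have "e' * i n = e'" by (rule i_great)
        then have "e' * l = e'" using il by (rule le_trans_mult)
        moreover have "e' * l = e' * (d * l)" using e'(3) by (metis mult.assoc)
        ultimately show False using dl e'(2) by simp
      qed
    qed
    then obtain \<phi> q where q: "projection q" "q \<noteq> 0" "q * d = q" "\<And>n. q * (1 - e n (\<phi> n)) = q" by blast
    have "s \<phi> * q = 0" unfolding s_def psup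
    proof
      fix x assume "x \<in> {e n (\<phi> n) | n. True}"
      then obtain n where x: "x = e n (\<phi> n)" by blast
      show "x * q = 0" using q(4)[of n] by (simp add: x right_diff_distrib mult.commute)
    qed
    moreover have "q * s \<phi> = q" using le_trans_mult[OF q(3) le_trans_mult[OF dr rs]] .
    ultimately show False using q(2) by (simp add: mult.commute)
  qed
  then have "l = r" using lr le_antisym by blast
  then show "\<Squnion>\<^bsub>projections {p * a |a. True}\<^esub> {\<Sqinter>\<^bsub>projections {p * a |a. True}\<^esub> {e n m |m. True} |n. True} =
      \<Sqinter>\<^bsub>projections {p * a |a. True}\<^esub> {\<Squnion>\<^bsub>projections {p * a |a. True}\<^esub> {e n (\<phi> n) |n. True} |\<phi>. True}"
    unfolding L_def[symmetric] i' s l r .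
qed

lemma sigma_distributive_iff_refinable:
  assumes "projection p"
  shows "sigma_distributive (projections {p * a | a. True}) \<longleftrightarrow>
    (\<forall>d. projection d \<longrightarrow> d \<noteq> 0 \<longrightarrow> d * p = d \<longrightarrow> refinable d)"
  using sigma_distributive_imp_refinable[OF assms] refinable_imp_sigma_distributive[OF assms] by blast

lemma clop_psup_le:
  assumes f: "\<And>U. ultrafilter U \<Longrightarrow> (f \<longlongrightarrow> f U) (nhdsin stone_space U)"
    and S: "\<And>e. e \<in> S \<Longrightarrow> projection e \<and> (\<forall>U\<in>clop e. f U \<le> r)"
    and U: "U \<in> clop (psup S)"
  shows "f U \<le> (r :: real)"
proof (rule ccontr)
  assume "\<not> f U \<le> r"
  have u: "ultrafilter U" "psup S \<in> U" using U by (auto simp: clop_def)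
  have "\<forall>\<^sub>F y in nhdsin stone_space U. r < f y" using f[OF u(1)] \<open>\<not> f U \<le> r\<close> by (intro order_tendstoD) auto
  then obtain s where s: "s \<in> U" "\<forall>y\<in>clop s. r < f y" unfolding eventually_nhdsin_stone[OF u(1)] by blast
  have "s * psup S \<in> U" using s u ultrafilter_mult by blast
  then have "s * psup S \<noteq> 0" using u ultrafilter_zero by metis
  then obtain e where e: "e \<in> S" "s * e \<noteq> 0" by (rule psup_meets)
  have P: "projection s" "projection e" using s u e S ultrafilter_proj by auto
  then obtain V where "V \<in> clop (s * e)" using e clop_nonempty projection_mult by metis
  then have "V \<in> clop s" "V \<in> clop e" using clop_mult[OF P] by auto
  then show False using s S e by fastforce
qed

text \<open>The \<open>n\<close>-th cover consists of the sets on which \<open>a\<close> is within \<open>1 / (n + 1)\<close> of a member of a countable dense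
  set of numbers. A part below one member of each cover leaves no room for variation.\<close>

lemma refinable_imp_locally_constant:
  fixes a :: "'a::comm_awstar_algebra"
  assumes d: "projection d" and ref: "refinable d"
  obtains q l where "projection q" "q \<noteq> 0" "q * d = q" "\<And>U. U \<in> clop q \<Longrightarrow> stone_iso a U = l"
proof -
  have "\<exists>X :: complex set. countable X \<and> (\<forall>S. open S \<longrightarrow> S \<noteq> {} \<longrightarrow> (\<exists>x\<in>X. x \<in> S))"
    by (rule countable_dense_setE) blast
  then obtain X :: "complex set" where X: "countable X" "\<And>S. open S \<Longrightarrow> S \<noteq> {} \<Longrightarrow> \<exists>x\<in>X. x \<in> S"
    by blast
  have X0: "X \<noteq> {}" using X(2)[of UNIV] by auto
  define l where "l = from_nat_into X"
  define S where "S = (\<lambda>n m. {e. projection e \<and> (\<forall>U\<in>clop e. cmod (stone_iso a U - l m) \<le> inverse (real (Suc n)))})"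
  define c where "c = (\<lambda>n m. psup (S n m))"
  have cP: "projection (c n m)" for n m unfolding c_def by (rule psup)
  have near: "cmod (stone_iso a U - l m) \<le> inverse (real (Suc n))" if "U \<in> clop (c n m)" for U n m
    using that unfolding c_def
    by (rule clop_psup_le[rotated 2]) (auto simp: S_def intro!: tendsto_norm tendsto_diff stone_iso_continuous_at)
  have "\<exists>\<phi> q. projection q \<and> q \<noteq> 0 \<and> q * d = q \<and> (\<forall>n. q * c n (\<phi> n) = q)"
  proof (rule ref[unfolded refinable_def, rule_format])
    show "projection (c n m)" for n m by (rule cP)
    fix n e assume e: "projection e" "e \<noteq> 0" "e * d = e"
    obtain U where U: "U \<in> clop e" using e clop_nonempty by blast
    then have u: "ultrafilter U" "e \<in> U" by (auto simp: clop_def)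
    define r where "r = inverse (real (Suc n))"
    obtain x where x: "x \<in> X" "x \<in> ball (stone_iso a U) (r / 2)"
      using X(2)[of "ball (stone_iso a U) (r / 2)"] by (auto simp: r_def)
    obtain m where m: "l m = x" unfolding l_def using X(1) x(1) from_nat_into_surj by metis
    have "\<forall>\<^sub>F y in nhdsin stone_space U. dist (stone_iso a y) (stone_iso a U) < r / 2"
      using stone_iso_continuous_at[OF u(1)] by (rule tendstoD) (simp add: r_def)
    then obtain s where s: "s \<in> U" "\<forall>y\<in>clop s. dist (stone_iso a y) (stone_iso a U) < r / 2"
      unfolding eventually_nhdsin_stone[OF u(1)] by blast
    have "cmod (stone_iso a y - l m) \<le> r" if y: "y \<in> clop s" for y
    proof -
      have "dist (stone_iso a y) x \<le> dist (stone_iso a y) (stone_iso a U) + dist (stone_iso a U) x" by (rule dist_triangle)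
      also have "\<dots> \<le> r / 2 + r / 2" using s(2) y x(2) by (intro add_mono) (auto intro: less_imp_le)
      finally show ?thesis by (simp add: m dist_norm)
    qed
    then have "s \<in> S n m" using s u ultrafilter_proj by (auto simp: S_def r_def)
    then have sc: "s * c n m = s" unfolding c_def by (rule psup_upper)
    have "e * s \<in> U" using s u ultrafilter_mult by blast
    then have "e * s \<noteq> 0" using u ultrafilter_zero by metis
    then have "e * c n m * s \<noteq> 0" using sc by (simp add: mult.assoc mult.commute[of "c n m"])
    then show "\<exists>m. e * c n m \<noteq> 0" by (intro exI[of _ m]) auto
  qed
  then obtain \<phi> q where q: "projection q" "q \<noteq> 0" "q * d = q" "\<And>n. q * c n (\<phi> n) = q" by blast
  obtain V where V: "V \<in> clop q" using q clop_nonempty by blast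
  have "stone_iso a U = stone_iso a V" if U: "U \<in> clop q" for U
  proof -
    have "cmod (stone_iso a U - stone_iso a V) \<le> e" if e: "e > 0" for e
    proof -
      have e2: "e / 2 > 0" using e by simp
      obtain n where n: "inverse (real (Suc n)) < e / 2" using reals_Archimedean[OF e2] by blast
      have "clop q \<subseteq> clop (c n (\<phi> n))" using q cP clop_subset_iff by blast
      then have "cmod (stone_iso a U - l (\<phi> n)) \<le> inverse (real (Suc n))"
        "cmod (stone_iso a V - l (\<phi> n)) \<le> inverse (real (Suc n))" using near U V by blast+
      then show ?thesis
        using n norm_triangle_ineq4[of "stone_iso a U - l (\<phi> n)" "stone_iso a V - l (\<phi> n)"] by simp
    qed
    then have "cmod (stone_iso a U - stone_iso a V) \<le> 0" by (rule field_le_epsilon[of _ 0, simplified])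
    then show ?thesis by simp
  qed
  then show ?thesis using q that by blast
qed

text \<open>Base three rather than two: the digits \<open>0\<close> and \<open>1\<close> are then determined by the sum, because the tail after
  a place contributes at most half of the weight of that place.\<close>

lemma ternary_digits_unique:
  fixes x y :: "nat \<Rightarrow> real"
  assumes x: "(\<lambda>k. (1/3) ^ k * x k) sums s" and y: "(\<lambda>k. (1/3) ^ k * y k) sums s"
    and 01: "\<And>k. x k \<in> {0, 1}" "\<And>k. y k \<in> {0, 1}"
  shows "x k = y k"
proof (induction k rule: less_induct)
  case (less k)
  define d where "d = (\<lambda>j. (1/3) ^ j * (x j - y j))"
  have "d sums 0" using sums_diff[OF x y] by (simp add: d_def right_diff_distrib)
  moreover have "(\<Sum>j<k. d j) = 0" using less by (simp add: d_def)
  ultimately have "(\<lambda>j. d (j + k)) sums 0" using sums_split_initial_segment[of d 0 k] by simp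
  then have "(\<lambda>j. 3 ^ k * d (j + k)) sums 0" using sums_mult[of "\<lambda>j. d (j + k)" 0 "3 ^ k"] by simp
  moreover have "3 ^ k * d (j + k) = (1/3) ^ j * (x (j + k) - y (j + k))" for j
    by (simp add: d_def power_add power_divide)
  ultimately have z: "(\<lambda>j. (1/3) ^ j * (x (j + k) - y (j + k))) sums 0" by simp
  then have t: "(\<lambda>j. (1/3) ^ Suc j * (x (Suc j + k) - y (Suc j + k))) sums (- (x k - y k))"
    using sums_split_initial_segment[OF z, of 1] by simp
  have g: "(\<lambda>j. (1/3 :: real) ^ Suc j) sums (1/2)"
    using sums_mult[OF geometric_sums[of "1/3::real"], of "1/3"] by simp
  have b: "\<bar>x j - y j\<bar> \<le> 1" for j using 01(1)[of j] 01(2)[of j] by auto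
  have "\<bar>- (x k - y k)\<bar> \<le> 1/2"
  proof -
    have "norm (\<Sum>j. (1/3) ^ Suc j * (x (Suc j + k) - y (Suc j + k))) \<le> (\<Sum>j. (1/3 :: real) ^ Suc j)"
    proof (rule norm_suminf_le)
      fix j show "norm ((1/3) ^ Suc j * (x (Suc j + k) - y (Suc j + k))) \<le> (1/3 :: real) ^ Suc j"
        using b[of "Suc j + k"] by (simp only: norm_mult real_norm_def abs_mult) (simp add: mult_left_le)
    qed (use g in \<open>simp add: sums_iff\<close>)
    then show ?thesis using t g by (simp add: sums_iff)
  qed
  then show ?case using 01(1)[of k] 01(2)[of k] by auto
qed

text \<open>All members of all covers are coded as ternary digits of one element. Where that element is constant, every
  digit is constant, so each member contains the part or is disjoint from it.\<close>

lemma locally_constant_imp_refinable: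
  fixes d :: "'a::comm_awstar_algebra"
  assumes d: "projection d"
    and lc: "\<And>a. \<exists>q l. projection q \<and> q \<noteq> 0 \<and> q * d = q \<and> (\<forall>U\<in>clop q. stone_iso a U = l)"
  shows "refinable d"
  unfolding refinable_def
proof (intro allI impI)
  fix c :: "nat \<Rightarrow> nat \<Rightarrow> 'a"
  assume c: "\<forall>n m. projection (c n m)"
    and cover: "\<forall>n e. projection e \<longrightarrow> e \<noteq> 0 \<longrightarrow> e * d = e \<longrightarrow> (\<exists>m. e * c n m \<noteq> 0)"
  define g where "g = (\<lambda>k. case prod_decode k of (n, m) \<Rightarrow> c n m)"
  have gP: "projection (g k)" for k using c by (simp add: g_def split: prod.split)
  have "summable (\<lambda>k. norm ((1/3) ^ k *\<^sub>R g k))"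
  proof (rule summable_comparison_test'[of "\<lambda>k. (1/3 :: real) ^ k" 0])
    show "summable (\<lambda>k. (1/3 :: real) ^ k)" by (rule summable_geometric) simp
    show "norm (norm ((1/3) ^ k *\<^sub>R g k)) \<le> (1/3) ^ k" for k
      using norm_projection_le[OF gP[of k]] by (simp add: mult_left_le)
  qed
  then have "summable (\<lambda>k. (1/3) ^ k *\<^sub>R g k)" by (rule summable_norm_cancel)
  then obtain b where b: "(\<lambda>k. (1/3) ^ k *\<^sub>R g k) sums b" by (rule that[OF summable_sums])
  have hb: "(\<lambda>k. (1/3) ^ k * (if g k \<in> U then 1 else 0 :: complex)) sums hat b U" if U: "ultrafilter U" for U
    unfolding sums_def
  proof (rule LIM_zero_cancel, rule Lim_null_comparison)
    have h: "hat (\<Sum>k<n. (1/3) ^ k *\<^sub>R g k) U = (\<Sum>k<n. (1/3) ^ k * (if g k \<in> U then 1 else 0))" for n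
    proof (induction n)
      case 0 then show ?case using hat_scaleC[OF U, of 0 0] by simp
    next
      case (Suc n)
      have "hat ((1/3) ^ n *\<^sub>R g n) U = complex_of_real ((1/3) ^ n) * hat (g n) U"
        unfolding scaleC_of_real[symmetric] by (rule hat_scaleC[OF U])
      then show ?case using Suc by (simp add: hat_add[OF U] hat_projection[OF U gP])
    qed
    show "\<forall>\<^sub>F n in sequentially. norm ((\<Sum>k<n. (1/3) ^ k * (if g k \<in> U then 1 else 0)) - hat b U)
        \<le> norm ((\<Sum>k<n. (1/3) ^ k *\<^sub>R g k) - b)"
      unfolding h[symmetric] hat_diff[OF U, symmetric] using cmod_hat_le[OF U] by simp
    show "(\<lambda>n. norm ((\<Sum>k<n. (1/3) ^ k *\<^sub>R g k) - b)) \<longlonglongrightarrow> 0"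
      using b by (simp add: sums_def LIM_zero tendsto_norm_zero)
  qed
  obtain a where a: "\<And>U. ultrafilter U \<Longrightarrow> stone_iso a U = hat b U"
    using stone_iso_surjective[of "hat b"] hat_continuous_at by blast
  obtain q l where q: "projection q" "q \<noteq> 0" "q * d = q" "\<forall>U\<in>clop q. stone_iso a U = l" using lc by blast
  have same: "g k \<in> U \<longleftrightarrow> g k \<in> V" if UV: "U \<in> clop q" "V \<in> clop q" for U V k
  proof -
    define x where "x = (\<lambda>W k. if g k \<in> W then 1 else 0 :: real)"
    have "(\<lambda>k. (1/3) ^ k * x W k) sums Re l" if W: "W \<in> clop q" for W
    proof -
      have "(\<lambda>k. Re ((1/3) ^ k * (if g k \<in> W then 1 else 0 :: complex))) sums Re (hat b W)"
        using hb[of W] W by (intro sums_Re) (auto simp: clop_def)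
      moreover have "Re ((1/3) ^ k * (if g k \<in> W then 1 else 0 :: complex)) = (1/3) ^ k * x W k" for k
      proof -
        have "(1/3 :: complex) ^ k = complex_of_real ((1/3) ^ k)" by simp
        then show ?thesis by (simp only: Re_complex_of_real x_def split: if_split) simp
      qed
      ultimately show ?thesis using q(4) a W by (auto simp: clop_def)
    qed
    then have "x U k = x V k" using UV by (intro ternary_digits_unique[of "x U" "Re l" "x V"]) (auto simp: x_def)
    then show ?thesis by (auto simp: x_def split: if_splits)
  qed
  have "\<exists>m. q * c n m = q" for n
  proof -
    obtain m where m: "q * c n m \<noteq> 0" using cover q by blast
    have cP: "projection (c n m)" using c by blast
    obtain V where V: "V \<in> clop (q * c n m)" using m clop_nonempty projection_mult[OF q(1) cP] by blast
    then have "V \<in> clop q" "V \<in> clop (c n m)" using clop_mult[OF q(1) cP] by auto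
    have "clop q \<subseteq> clop (c n m)"
    proof
      fix U assume U: "U \<in> clop q"
      have "g (prod_encode (n, m)) = c n m" by (simp add: g_def)
      then show "U \<in> clop (c n m)" using same[OF U \<open>V \<in> clop q\<close>, of "prod_encode (n, m)"] U \<open>V \<in> clop (c n m)\<close>
        by (auto simp: clop_def)
    qed
    then have "q * c n m = q" using clop_subset_iff[OF q(1) cP] by blast
    then show ?thesis by blast
  qed
  then obtain \<phi> where "\<And>n. q * c n (\<phi> n) = q" by metis
  then show "\<exists>\<phi> q. projection q \<and> q \<noteq> 0 \<and> q * d = q \<and> (\<forall>n. q * c n (\<phi> n) = q)" using q by blast
qed

section \<open>Non-zero derivations\<close>

lemma nonzero_below:
  assumes e: "projection e" and z: "E e * z \<noteq> 0"
  obtains r c where "projection r" "r \<noteq> 0" "r * e = r" "c > 0"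
    "\<forall>q\<in>clop r. c \<le> cmod (ev z q) \<and> cmod (ev z q) \<le> 1 / c"
proof -
  obtain f c where f: "projection f" "f \<noteq> 0" "c > 0" "\<And>q. q \<in> clop f \<Longrightarrow> c \<le> cmod (ev (E e * z) q)"
    "\<And>q. q \<in> clop f \<Longrightarrow> cmod (ev (E e * z) q) \<le> 1 / c"
    using nonzero_locally_bounded_below[OF z] by metis
  have "\<forall>\<^sub>F q in generic. ev (E e * z) q = (if e \<in> q then ev z q else 0)"
    using ev_mult[of "E e" z] eventually_ev_E_projection[OF e] by eventually_elim simp
  then obtain r where r: "projection r" "r \<noteq> 0" "r * f = r"
    "\<forall>q\<in>clop r. ev (E e * z) q = (if e \<in> q then ev z q else 0)" using f(1,2) unfolding eventually_generic by blast
  have rf: "clop r \<subseteq> clop f" using r f clop_subset_iff by blast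
  have eq: "e \<in> q \<and> ev (E e * z) q = ev z q" if q: "q \<in> clop r" for q
  proof -
    have "c \<le> cmod (ev (E e * z) q)" using f q rf by blast
    then have "ev (E e * z) q \<noteq> 0" using f by auto
    then show ?thesis using r q by (auto split: if_splits)
  qed
  have "clop r \<subseteq> clop e" using eq by (auto simp: clop_def)
  then have "r * e = r" using r e clop_subset_iff by blast
  moreover have "c \<le> cmod (ev z q) \<and> cmod (ev z q) \<le> 1 / c" if q: "q \<in> clop r" for q
    using f(4)[of q] f(5)[of q] eq[OF q] rf q by auto
  ultimately show ?thesis using that r f by blast
qed

text \<open>This ring takes the role of the field of constants.\<close>

definition locally_const :: "'a::comm_awstar_algebra aff \<Rightarrow> bool"
  where "locally_const z \<longleftrightarrow> (\<forall>e. projection e \<longrightarrow> e \<noteq> 0 \<longrightarrow>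
    (\<exists>r l. projection r \<and> r \<noteq> 0 \<and> r * e = r \<and> E r * z = E r * cst l))"

lemma locally_constE:
  assumes "locally_const z" "projection e" "e \<noteq> 0"
  obtains r l where "projection r" "r \<noteq> 0" "r * e = r" "E r * z = E r * cst l"
  using assms unfolding locally_const_def by blast

lemma E_absorb: "r * e = r \<Longrightarrow> E e * z = E e * w \<Longrightarrow> E r * z = E r * w"
  by (metis E_mult mult.assoc)

lemma locally_const_graph: "derivation_graph {(z, 0) | z. locally_const (z :: 'a::comm_awstar_algebra aff)}"
  unfolding derivation_graph_def
proof (intro conjI allI impI)
  fix z :: "'a aff" assume z: "z * z = z"
  have "locally_const z" unfolding locally_const_def
  proof (intro allI impI)
    fix e :: 'a assume e: "projection e" "e \<noteq> 0"
    show "\<exists>r l. projection r \<and> r \<noteq> 0 \<and> r * e = r \<and> E r * z = E r * cst l"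
    proof (cases "E e * z = 0")
      case True
      then show ?thesis using e by (intro exI[of _ e] exI[of _ 0]) (simp add: projection_idem)
    next
      case False
      obtain r c where r: "projection r" "r \<noteq> 0" "r * e = r" "c > 0"
        "\<forall>q\<in>clop r. c \<le> cmod (ev z q) \<and> cmod (ev z q) \<le> 1 / c" by (rule nonzero_below[OF e(1) False])
      have "E r * z = E r * cst 1" unfolding E_mult_eq_iff[OF r(1)]
        using ev_mult[of z z] ev_cst[of 1] eventually_generic_ultrafilter
      proof eventually_elim
        case (elim q)
        then have "ev z q * ev z q = ev z q" using z by simp
        moreover have "r \<in> q \<Longrightarrow> ev z q \<noteq> 0" using r(4) r(5)[rule_format, of q] elim by (auto simp: clop_def)
        ultimately show ?case using elim by auto
      qed
      then show ?thesis using r by blast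
    qed
  qed
  then show "(z, 0) \<in> {(z, 0) | z. locally_const z}" by blast
next
  fix a b c d :: "'a aff" assume "(a, b) \<in> {(z, 0) | z. locally_const z}" "(c, d) \<in> {(z, 0) | z. locally_const z}"
  then have ac: "locally_const a" "locally_const c" "b = 0" "d = 0" by auto
  have *: "\<exists>r l m. projection r \<and> r \<noteq> 0 \<and> r * e = r \<and> E r * a = E r * cst l \<and> E r * c = E r * cst m"
    if e: "projection e" "e \<noteq> 0" for e
  proof -
    obtain r l where r: "projection r" "r \<noteq> 0" "r * e = r" "E r * a = E r * cst l"
      by (rule locally_constE[OF ac(1) e])
    obtain s m where s: "projection s" "s \<noteq> 0" "s * r = s" "E s * c = E s * cst m"
      by (rule locally_constE[OF ac(2) r(1,2)])
    show ?thesis using s le_trans_mult[OF s(3) r(3)] E_absorb[OF s(3) r(4)] by blast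
  qed
  have "locally_const (a + c)" unfolding locally_const_def
  proof (intro allI impI)
    fix e :: 'a assume "projection e" "e \<noteq> 0"
    then obtain r l m where r: "projection r" "r \<noteq> 0" "r * e = r" "E r * a = E r * cst l" "E r * c = E r * cst m"
      using * by blast
    have "E r * (a + c) = E r * cst (l + m)" using r by (simp add: distrib_left cst_add)
    then show "\<exists>r l. projection r \<and> r \<noteq> 0 \<and> r * e = r \<and> E r * (a + c) = E r * cst l" using r by blast
  qed
  then show "(a + c, b + d) \<in> {(z, 0) | z. locally_const z}" using ac by simp
  have "locally_const (a * c)" unfolding locally_const_def
  proof (intro allI impI)
    fix e :: 'a assume "projection e" "e \<noteq> 0"
    then obtain r l m where r: "projection r" "r \<noteq> 0" "r * e = r" "E r * a = E r * cst l" "E r * c = E r * cst m"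
      using * by blast
    have "E r * (a * c) = (E r * a) * c" by (simp add: mult.assoc)
    also have "\<dots> = (E r * cst l) * c" by (simp only: r(4))
    also have "\<dots> = cst l * (E r * c)" by (simp only: mult_ac)
    also have "\<dots> = cst l * (E r * cst m)" by (simp only: r(5))
    also have "\<dots> = E r * cst (l * m)" by (simp only: cst_mult mult_ac)
    finally show "\<exists>r l. projection r \<and> r \<noteq> 0 \<and> r * e = r \<and> E r * (a * c) = E r * cst l" using r by blast
  qed
  then show "(a * c, a * d + b * c) \<in> {(z, 0) | z. locally_const z}" using ac by simp
next
  fix a b :: "'a aff" assume "(a, b) \<in> {(z, 0) | z. locally_const z}"
  then have ac: "locally_const a" "b = 0" by auto
  have "locally_const (- a)" unfolding locally_const_def
  proof (intro allI impI)
    fix e :: 'a assume e: "projection e" "e \<noteq> 0"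
    obtain r l where r: "projection r" "r \<noteq> 0" "r * e = r" "E r * a = E r * cst l"
      by (rule locally_constE[OF ac(1) e])
    have "E r * (- a) = E r * cst (- l)" using r by (simp add: cst_uminus)
    then show "\<exists>r l. projection r \<and> r \<noteq> 0 \<and> r * e = r \<and> E r * (- a) = E r * cst l" using r by blast
  qed
  then show "(- a, - b) \<in> {(z, 0) | z. locally_const z}" using ac by simp
qed auto

lemma cst_locally_const: "locally_const (cst c)"
  unfolding locally_const_def
proof (intro allI impI)
  fix e :: 'a assume "projection e" "e \<noteq> 0"
  then show "\<exists>r l. projection r \<and> r \<noteq> 0 \<and> r * e = r \<and> E r * cst c = E r * cst l"
    by (intro exI[of _ e] exI[of _ c]) (simp add: projection_idem)
qed

text \<open>An element that is nowhere constant below \<open>p\<close> is, on every part of \<open>p\<close>, transcendental over the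
  locally constant elements: a root of a polynomial with constant coefficients takes finitely many values.\<close>

lemma nowhere_constant_transcendental:
  fixes a :: "'a::comm_awstar_algebra"
  assumes p: "projection p"
    and nc: "\<And>q l. projection q \<Longrightarrow> q \<noteq> 0 \<Longrightarrow> q * p = q \<Longrightarrow> \<exists>U\<in>clop q. stone_iso a U \<noteq> l"
    and f: "\<And>i. locally_const (coeff f i)" and root: "poly f (E a) = 0"
  shows "E p * coeff f i = 0"
proof (rule ccontr)
  assume nz: "E p * coeff f i \<noteq> 0"
  obtain r c where r: "projection r" "r \<noteq> 0" "r * p = r" "c > 0"
    "\<forall>q\<in>clop r. c \<le> cmod (ev (coeff f i) q) \<and> cmod (ev (coeff f i) q) \<le> 1 / c"
    by (rule nonzero_below[OF p nz]) 
  have "\<exists>s l. projection s \<and> s \<noteq> 0 \<and> s * r = s \<and> (\<forall>j<n. E s * coeff f j = E s * cst (l j))" for n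
  proof (induction n)
    case 0 then show ?case using r by (intro exI[of _ r]) (simp add: projection_idem)
  next
    case (Suc n)
    then obtain s l where s: "projection s" "s \<noteq> 0" "s * r = s" "\<forall>j<n. E s * coeff f j = E s * cst (l j)" by blast
    obtain t m where t: "projection t" "t \<noteq> 0" "t * s = t" "E t * coeff f n = E t * cst m"
      by (rule locally_constE[OF f s(1,2)])
    have "\<forall>j<Suc n. E t * coeff f j = E t * cst ((l(n := m)) j)"
    proof (intro allI impI)
      fix j assume j: "j < Suc n"
      show "E t * coeff f j = E t * cst ((l(n := m)) j)"
      proof (cases "j = n")
        case False
        then have "E s * coeff f j = E s * cst (l j)" using s(4) j by simp
        then have "E t * coeff f j = E t * cst (l j)" by (rule E_absorb[OF t(3)])
        then show ?thesis using False by simp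
      qed (use t in simp)
    qed
    then show ?case
      by (intro exI[of _ t] exI[of _ "l(n := m)"] conjI t(1,2) le_trans_mult[OF t(3) s(3)])
  qed
  then obtain s l where s: "projection s" "s \<noteq> 0" "s * r = s" "\<forall>j<Suc (degree f). E s * coeff f j = E s * cst (l j)" by blast
  have ev_l: "\<forall>\<^sub>F q in generic. \<forall>j\<in>{..degree f}. s \<in> q \<longrightarrow> ev (coeff f j) q = l j"
  proof (rule eventually_ball_finite, simp, intro ballI)
    fix j assume "j \<in> {..degree f}"
    then have "E s * coeff f j = E s * cst (l j)" using s(4) by auto
    then have "\<forall>\<^sub>F q in generic. s \<in> q \<longrightarrow> ev (coeff f j) q = ev (cst (l j)) q" using E_mult_eq_iff[OF s(1)] by blast
    then show "\<forall>\<^sub>F q in generic. s \<in> q \<longrightarrow> ev (coeff f j) q = l j" using ev_cst[of "l j"] by eventually_elim auto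
  qed
  have "\<forall>\<^sub>F q in generic. s \<in> q \<longrightarrow> (\<forall>j\<le>degree f. ev (coeff f j) q = l j) \<and> (\<Sum>j\<le>degree f. l j * stone_iso a q ^ j) = 0"
    using ev_l ev_poly[of f "E a"] ev_zero eventually_ev_E[of a]
  proof eventually_elim
    case (elim q)
    then show ?case using root by auto
  qed
  then obtain t where t: "projection t" "t \<noteq> 0" "t * s = t" and
    tq: "\<forall>q\<in>clop t. s \<in> q \<longrightarrow> (\<forall>j\<le>degree f. ev (coeff f j) q = l j) \<and> (\<Sum>j\<le>degree f. l j * stone_iso a q ^ j) = 0"
    using s(1,2) unfolding eventually_generic by blast
  have ts: "clop t \<subseteq> clop s" "clop t \<subseteq> clop r"
    using clop_subset_iff t s r le_trans_mult[OF t(3) s(3)] by blast+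
  obtain U where U: "U \<in> clop t" using t clop_nonempty by blast
  have deg: "i \<le> degree f"
  proof (rule ccontr)
    assume "\<not> i \<le> degree f"
    then show False using nz by (simp add: coeff_eq_0)
  qed
  have "l i \<noteq> 0"
  proof -
    have "ev (coeff f i) U = l i" using tq U ts deg by (auto simp: clop_def)
    then show ?thesis using r(4) r(5)[rule_format, of U] ts U by auto
  qed
  define F where "F = (\<Sum>j\<le>degree f. monom (l j) j)"
  have "coeff F i = l i" using deg by (simp add: F_def coeff_sum)
  then have F0: "F \<noteq> 0" using \<open>l i \<noteq> 0\<close> by auto
  define R where "R = {x. poly F x = 0}"
  have fin: "finite R" unfolding R_def using F0 by (rule poly_roots_finite)
  have inR: "stone_iso a q \<in> R" if q: "q \<in> clop t" for q
    using tq q ts by (auto simp: R_def F_def poly_sum poly_monom clop_def)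
  have u: "ultrafilter U" "t \<in> U" using U by (auto simp: clop_def)
  have "open (- (R - {stone_iso a U}))" using fin by (intro open_Compl finite_imp_closed) auto
  then have "\<forall>\<^sub>F y in nhdsin stone_space U. stone_iso a y \<in> - (R - {stone_iso a U})"
    by (rule topological_tendstoD[OF stone_iso_continuous_at[OF u(1)]]) simp
  then obtain w where w: "w \<in> U" "\<forall>y\<in>clop w. stone_iso a y \<in> - (R - {stone_iso a U})"
    unfolding eventually_nhdsin_stone[OF u(1)] by blast
  have wP: "projection w" using w u ultrafilter_proj by blast
  have "w * t \<in> U" using w u ultrafilter_mult by blast
  then have wt: "w * t \<noteq> 0" using u ultrafilter_zero by metis
  have "w * t * t = w * t" using t by (simp add: mult.assoc projection_idem)
  then have "w * t * p = w * t" using le_trans_mult[OF t(3) le_trans_mult[OF s(3) r(3)]] le_trans_mult by blast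
  then obtain V where V: "V \<in> clop (w * t)" "stone_iso a V \<noteq> stone_iso a U"
    using nc[OF projection_mult[OF wP t(1)] wt] by blast
  then show False using w inR clop_mult[OF wP t(1)] by blast
qed

text \<open>Adjoin \<open>a\<close> with derivative \<open>p\<close> to the ring of locally constant elements with the zero derivation. All
  relations of \<open>a\<close> over that ring vanish on \<open>p\<close>, so nothing obstructs this value.\<close>

lemma nonzero_derivation_exists:
  fixes a :: "'a::comm_awstar_algebra"
  assumes p: "projection p"
    and nc: "\<And>q l. projection q \<Longrightarrow> q \<noteq> 0 \<Longrightarrow> q * p = q \<Longrightarrow> \<exists>U\<in>clop q. stone_iso a U \<noteq> l"
  obtains D :: "'a aff \<Rightarrow> 'a aff"
  where "\<forall>x y. D (x + y) = D x + D y" "\<forall>x y. D (x * y) = x * D y + D x * y"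
    "\<forall>c. D (cst c) = 0" "\<forall>e. e * e = e \<longrightarrow> D e = 0" "D (E a) = E p"
proof -
  define G where "G = {(z, 0 :: 'a aff) | z. locally_const (z :: 'a aff)}"
  have G: "derivation_graph G" unfolding G_def by (rule locally_const_graph)
  have rel: "poly g (E a) + poly (formal_deriv f) (E a) * E p = 0"
    if fg: "(f, g) \<in> graph_polys G" and root: "poly f (E a) = 0" for f g
  proof -
    have c: "locally_const (coeff f i)" "coeff g i = 0" for i
      using graph_polysD[OF G fg, of i] by (auto simp: G_def)
    have "g = 0" using c by (simp add: poly_eq_iff)
    have "E p * coeff f i = 0" for i
      by (rule nowhere_constant_transcendental[OF p nc c(1) root])
    then have "smult (E p) f = 0" by (simp add: poly_eq_iff)
    then have "formal_deriv (smult (E p) f) = 0" by simp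
    then have "E p * poly (formal_deriv f) (E a) = 0"
      unfolding formal_deriv_smult by (metis poly_0 poly_smult)
    then show ?thesis using \<open>g = 0\<close> by (simp add: mult.commute)
  qed
  obtain D where D: "\<And>x y. D (x + y) = D x + D y" "\<And>x y. D (x * y) = x * D y + D x * y"
    "\<And>x y. (x, y) \<in> adjoin G (E a) (E p) \<Longrightarrow> D x = y"
    using derivation_extension[OF adjoin_graph(1)[OF G rel]] by blast
  have sub: "G \<subseteq> adjoin G (E a) (E p)" by (rule adjoin_graph(2)[OF G rel])
  show ?thesis
  proof (rule that)
    show "\<forall>x y. D (x + y) = D x + D y" "\<forall>x y. D (x * y) = x * D y + D x * y" using D(1,2) by blast+
    show "\<forall>c. D (cst c) = 0"
    proof
      show "D (cst c) = 0" for c using sub cst_locally_const[of c] by (intro D(3)) (auto simp: G_def)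
    qed
    show "\<forall>e. e * e = e \<longrightarrow> D e = 0"
    proof (intro allI impI)
      show "D e = 0" if "e * e = e" for e using sub graph_idem[OF G that] by (intro D(3)) auto
    qed
    show "D (E a) = E p" by (rule D(3)[OF adjoin_graph(3)[OF G rel]])
  qed
qed

section \<open>Gluing along disjoint families\<close>

text \<open>A maximal disjoint subfamily of a dense family still meets every part of \<open>e\<close>.\<close>

lemma disjoint_refinement:
  fixes C :: "'a::comm_awstar_algebra set"
  assumes C: "\<And>p. p \<in> C \<Longrightarrow> projection p \<and> p \<noteq> 0"
    and dense: "\<And>r. projection r \<Longrightarrow> r \<noteq> 0 \<Longrightarrow> r * e = r \<Longrightarrow> \<exists>p\<in>C. p * r = p"
  obtains S where "S \<subseteq> C" "\<forall>p\<in>S. \<forall>q\<in>S. p \<noteq> q \<longrightarrow> p * q = 0"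
    "\<forall>r. projection r \<longrightarrow> r \<noteq> 0 \<longrightarrow> r * e = r \<longrightarrow> (\<exists>p\<in>S. r * p \<noteq> 0)"
proof -
  define X where "X = {S. S \<subseteq> C \<and> (\<forall>p\<in>S. \<forall>q\<in>S. p \<noteq> q \<longrightarrow> p * q = 0)}"
  have "\<exists>M\<in>X. \<forall>H\<in>X. M \<subseteq> H \<longrightarrow> H = M"
  proof (rule subset_Zorn_nonempty)
    show "X \<noteq> {}" by (auto simp: X_def)
    fix K assume K: "K \<noteq> {}" "subset.chain X K"
    have sub: "K \<subseteq> X" using K by (auto simp: subset_chain_def)
    have "p * q = 0" if pq: "p \<in> \<Union>K" "q \<in> \<Union>K" "p \<noteq> q" for p q
    proof -
      obtain H L where *: "H \<in> K" "p \<in> H" "L \<in> K" "q \<in> L" using pq by blast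
      then have "H \<subseteq> L \<or> L \<subseteq> H" using K(2) by (auto simp: subset_chain_def)
      then obtain M where "M \<in> K" "p \<in> M" "q \<in> M" using * by blast
      then show ?thesis using sub pq(3) by (auto simp: X_def)
    qed
    then show "\<Union>K \<in> X" using sub by (auto simp: X_def)
  qed
  then obtain S where S: "S \<in> X" and max: "\<And>H. H \<in> X \<Longrightarrow> S \<subseteq> H \<Longrightarrow> H = S" by blast
  show ?thesis
  proof (rule that[of S])
    show "S \<subseteq> C" "\<forall>p\<in>S. \<forall>q\<in>S. p \<noteq> q \<longrightarrow> p * q = 0" using S by (auto simp: X_def)
    show "\<forall>r. projection r \<longrightarrow> r \<noteq> 0 \<longrightarrow> r * e = r \<longrightarrow> (\<exists>p\<in>S. r * p \<noteq> 0)"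
    proof (intro allI impI, rule ccontr)
      fix r assume r: "projection r" "r \<noteq> 0" "r * e = r"
      assume n: "\<not> (\<exists>p\<in>S. r * p \<noteq> 0)"
      obtain p where p: "p \<in> C" "p * r = p" using dense[OF r] by blast
      have z: "p * q = 0" if "q \<in> S" for q
      proof -
        have "p * q = p * (r * q)" using p(2) by (simp add: mult.assoc[symmetric])
        then show ?thesis using n that by auto
      qed
      have "insert p S \<in> X" using S p z by (auto simp: X_def mult.commute)
      then have "p \<in> S" using max by blast
      then have "r * p = 0" using n by blast
      then show False using p C by (auto simp: mult.commute)
    qed
  qed
qed

text \<open>Generic properties are local, so an uncountable cover does no harm.\<close>

lemma generic_on_cover:
  assumes S: "\<And>p. p \<in> S \<Longrightarrow> projection p" and e: "projection e"
    and cover: "\<And>r. projection r \<Longrightarrow> r \<noteq> 0 \<Longrightarrow> r * e = r \<Longrightarrow> \<exists>p\<in>S. r * p \<noteq> 0"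
    and P: "\<And>p. p \<in> S \<Longrightarrow> \<forall>\<^sub>F q in generic. p \<in> q \<longrightarrow> P q"
  shows "\<forall>\<^sub>F q in generic. e \<in> q \<longrightarrow> P q"
  unfolding eventually_generic
proof (intro allI impI)
  fix r :: 'a assume r: "projection r" "r \<noteq> 0"
  show "\<exists>s. projection s \<and> s \<noteq> 0 \<and> s * r = s \<and> (\<forall>q\<in>clop s. e \<in> q \<longrightarrow> P q)"
  proof (cases "r * e = 0")
    case True
    have "e \<notin> q" if q: "q \<in> clop r" for q
    proof
      assume "e \<in> q"
      then have "r * e \<in> q" using q by (auto simp: clop_def intro: ultrafilter_mult)
      then show False using True q by (auto simp: clop_def ultrafilter_zero)
    qed
    then show ?thesis using r by (intro exI[of _ r]) (auto simp: projection_idem)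
  next
    case False
    have re: "projection (r * e)" "r * e * e = r * e" using r e by (simp_all add: projection_mult mult.assoc projection_idem)
    obtain p where p: "p \<in> S" "r * e * p \<noteq> 0" using cover[OF re(1) False re(2)] by blast
    have pp: "projection p" "projection (r * e * p)" using p S re projection_mult by auto
    obtain s where s: "projection s" "s \<noteq> 0" "s * (r * e * p) = s" "\<forall>q\<in>clop s. p \<in> q \<longrightarrow> P q"
      using P[OF p(1)] pp(2) p(2) unfolding eventually_generic by blast
    have "r * e * p * p = r * e * p" "r * e * p * r = r * e * p" using pp r by (simp_all add: mult_ac projection_idem)
    then have sp: "s * p = s" "s * r = s" using s(3) le_trans_mult by blast+
    then have "P q" if "q \<in> clop s" for q using s(4) that clop_subset_iff[OF s(1) pp(1)] by (auto simp: clop_def)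
    then show ?thesis using s sp by blast
  qed
qed

text \<open>A generic bound holds at every point by continuity; hence \<open>z\<close> is finite everywhere and lies in \<open>C(Q)\<close>.\<close>

lemma bounded_in_algebra:
  assumes b: "\<forall>\<^sub>F q in generic. cmod (ev z q) \<le> B"
  obtains a where "z = E a"
proof -
  have C: "fst (rep_aff z) \<in> C_infty" "snd (rep_aff z) \<in> C_infty"
    using rep_aff_in[of z] by (auto simp: S_alg_def mem_Times_iff)
  have bound: "\<bar>x q\<bar> \<le> ereal B"
    if x: "x \<in> C_infty" and le: "\<forall>\<^sub>F q in generic. \<bar>x q\<bar> \<le> ereal B" and q: "ultrafilter q" for x q
  proof (rule generic_le_imp_le[OF _ _ q le])
    show "((\<lambda>q. \<bar>x q\<bar>) \<longlongrightarrow> \<bar>x q\<bar>) (nhdsin stone_space q)"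
      using x q by (intro tendsto_abs_ereal) (auto simp: C_infty_iff)
  qed simp
  have "\<forall>\<^sub>F q in generic. \<bar>fst (rep_aff z) q\<bar> \<le> ereal B \<and> \<bar>snd (rep_aff z) q\<bar> \<le> ereal B"
    using b S_alg_finite[OF rep_aff_in[of z]]
  proof eventually_elim
    case (elim q)
    have "\<bar>real_of_ereal (fst (rep_aff z) q)\<bar> \<le> B" "\<bar>real_of_ereal (snd (rep_aff z) q)\<bar> \<le> B"
      using elim(1) abs_Re_le_cmod[of "ev z q"] abs_Im_le_cmod[of "ev z q"] by (auto simp: ev_def val_def)
    then show ?case using elim(2) by (auto simp: finite_at_def)
  qed
  then have "\<forall>\<^sub>F q in generic. \<bar>fst (rep_aff z) q\<bar> \<le> ereal B" "\<forall>\<^sub>F q in generic. \<bar>snd (rep_aff z) q\<bar> \<le> ereal B"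
    by (auto elim: eventually_mono)
  then have fin: "\<bar>fst (rep_aff z) q\<bar> \<noteq> \<infinity>" "\<bar>snd (rep_aff z) q\<bar> \<noteq> \<infinity>" if "ultrafilter q" for q
    using bound[OF C(1) _ that] bound[OF C(2) _ that] by auto
  have "(ev z \<longlongrightarrow> ev z q) (nhdsin stone_space q)" if q: "ultrafilter q" for q
  proof -
    have l: "((\<lambda>y. real_of_ereal (x y)) \<longlongrightarrow> real_of_ereal (x q)) (nhdsin stone_space q)"
      if x: "x \<in> C_infty" "\<bar>x q\<bar> \<noteq> \<infinity>" for x
      using x q by (intro lim_real_of_ereal) (auto simp: C_infty_iff ereal_real')
    show ?thesis unfolding ev_def val_def by (intro tendsto_Complex l C fin[OF q])
  qed
  then obtain a where a: "\<And>q. ultrafilter q \<Longrightarrow> stone_iso a q = ev z q"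
    using stone_iso_surjective[of "ev z"] by blast
  have "z = E a"
    by (rule aff_eqI, use eventually_generic_ultrafilter in eventually_elim) (simp add: a ev_E)
  then show ?thesis by (rule that)
qed

section \<open>Derivations on an ideal\<close>

definition solid_closed :: "'a::comm_awstar_algebra aff set \<Rightarrow> bool"
  where "solid_closed Z \<longleftrightarrow> (\<forall>x\<in>Z. \<forall>y. (\<forall>\<^sub>F q in generic. cmod (ev y q) \<le> cmod (ev x q)) \<longrightarrow> y \<in> Z)"

context
  fixes I :: "'a::comm_awstar_algebra set" and d :: "'a \<Rightarrow> 'a aff"
  assumes I: "ideal_of I"
    and d_add: "\<And>x y. x \<in> I \<Longrightarrow> y \<in> I \<Longrightarrow> d (x + y) = d x + d y"
    and d_scale: "\<And>c x. x \<in> I \<Longrightarrow> d (c *\<^sub>C x) = cst c * d x"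
    and d_mult: "\<And>x y. x \<in> I \<Longrightarrow> y \<in> I \<Longrightarrow> d (x * y) = d x * E y + E x * d y"
    and d_band: "\<And>e x. projection e \<Longrightarrow> x \<in> I \<Longrightarrow> E e * E x = 0 \<Longrightarrow> E e * d x = 0"
begin

lemma ideal_mult: "x \<in> I \<Longrightarrow> a * x \<in> I" using I by (auto simp: ideal_of_def)
lemma ideal_add: "x \<in> I \<Longrightarrow> y \<in> I \<Longrightarrow> x + y \<in> I" using I by (auto simp: ideal_of_def)
lemma ideal_scale: "x \<in> I \<Longrightarrow> c *\<^sub>C x \<in> I" using I by (auto simp: ideal_of_def)

text \<open>Both summands of \<open>d x = d (e x) + d ((1 - e) x)\<close> stay on their side of \<open>e\<close>.\<close>

lemma d_projection:
  assumes e: "projection e" and x: "x \<in> I" shows "d (e * x) = E e * d x"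
proof -
  have e': "projection (1 - e)" by (rule projection_compl[OF e])
  have 1: "E (1 - e) * d (e * x) = 0"
  proof (rule d_band[OF e' ideal_mult[OF x]])
    have "(1 - e) * (e * x) = 0" using e by (simp add: left_diff_distrib)
    then show "E (1 - e) * E (e * x) = 0" by (metis E_mult E_zero)
  qed
  have 2: "E e * d ((1 - e) * x) = 0"
  proof (rule d_band[OF e ideal_mult[OF x]])
    have "e * ((1 - e) * x) = 0" using e by (simp add: left_diff_distrib right_diff_distrib)
    then show "E e * E ((1 - e) * x) = 0" by (metis E_mult E_zero)
  qed
  have "x = e * x + (1 - e) * x" by (simp add: algebra_simps)
  then have "d x = d (e * x) + d ((1 - e) * x)" using d_add[OF ideal_mult[OF x] ideal_mult[OF x]] by metis
  then have "E e * d x = E e * d (e * x)" using 2 by (simp add: distrib_left)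
  also have "\<dots> = d (e * x)" using 1 by (simp add: E_diff E_one algebra_simps)
  finally show ?thesis by simp
qed

lemma d_nonzero_region:
  assumes x: "x \<in> I" and nz: "d x \<noteq> 0"
  obtains e c where "projection e" "e \<noteq> 0" "c > 0"
    "\<forall>q\<in>clop e. c \<le> cmod (stone_iso x q) \<and> c \<le> cmod (ev (d x) q)"
proof -
  obtain f c where f: "projection f" "f \<noteq> 0" "c > 0" "\<And>q. q \<in> clop f \<Longrightarrow> c \<le> cmod (ev (d x) q)"
    using nonzero_locally_bounded_below[OF nz] by metis
  have "E f * E x \<noteq> 0"
  proof
    assume "E f * E x = 0"
    then have "E f * d x = 0" by (rule d_band[OF f(1) x])
    then have "\<forall>\<^sub>F q in generic. f \<in> q \<longrightarrow> ev (d x) q = 0" using E_mult_eq_0_iff[OF f(1)] by blast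
    then obtain q where "q \<in> clop f" "f \<in> q \<longrightarrow> ev (d x) q = 0" using generic_point f(1,2) by blast
    then show False using f(3) f(4)[of q] by (auto simp: clop_def)
  qed
  then obtain e k where e: "projection e" "e \<noteq> 0" "e * f = e" "k > 0"
    "\<forall>q\<in>clop e. k \<le> cmod (ev (E x) q) \<and> cmod (ev (E x) q) \<le> 1 / k"
    by (rule nonzero_below[OF f(1)])
  have ef: "clop e \<subseteq> clop f" using e f clop_subset_iff by blast
  show ?thesis
  proof (rule that[of e "min c k"])
    show "\<forall>q\<in>clop e. min c k \<le> cmod (stone_iso x q) \<and> min c k \<le> cmod (ev (d x) q)"
    proof
      fix q assume q: "q \<in> clop e"
      then have "k \<le> cmod (stone_iso x q)" using e(5) by (auto simp: clop_def ev_E)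
      moreover have "c \<le> cmod (ev (d x) q)" using f(4) ef q by blast
      ultimately show "min c k \<le> cmod (stone_iso x q) \<and> min c k \<le> cmod (ev (d x) q)" by auto
    qed
  qed (use e f in auto)
qed

context
  fixes x :: 'a and e :: 'a and c :: real
  assumes x: "x \<in> I" and e: "projection e" "e \<noteq> 0" and c: "c > 0"
    and low: "\<forall>q\<in>clop e. c \<le> cmod (stone_iso x q) \<and> c \<le> cmod (ev (d x) q)"
begin

text \<open>If \<open>x = l\<close> on \<open>q\<close>, then \<open>q x\<^sup>2 = l q x\<close>. Differentiating gives \<open>2 l = l\<close> where \<open>d x \<noteq> 0\<close>, although \<open>l \<noteq> 0\<close>. The
  element \<open>q x\<close> is used because \<open>q\<close> itself need not belong to the ideal.\<close>

lemma nowhere_constant: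
  assumes q: "projection q" "q \<noteq> 0" "q * e = q" shows "\<exists>U\<in>clop q. stone_iso x U \<noteq> l"
proof (rule ccontr)
  assume "\<not> ?thesis"
  then have l: "\<And>U. U \<in> clop q \<Longrightarrow> stone_iso x U = l" by blast
  have qx: "q * x = l *\<^sub>C q"
  proof (rule stone_iso_eqI)
    fix U :: "'a set" assume U: "ultrafilter U"
    show "stone_iso (q * x) U = stone_iso (l *\<^sub>C q) U"
      using l[of U] U q by (simp add: stone_iso_mult[OF U] stone_iso_scaleC[OF U] stone_iso_projection[OF U] clop_def)
  qed
  have "x * (q * x) = l *\<^sub>C (q * x)"
  proof -
    have "x * (q * x) = x * (q * (q * x))" using q by simp
    also have "\<dots> = (q * x) * (q * x)" by (simp add: mult_ac)
    also have "\<dots> = l *\<^sub>C (q * (q * x))" by (subst qx) (simp add: scaleC_mult_left)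
    finally show ?thesis using q by simp
  qed
  then have "d (x * (q * x)) = d (l *\<^sub>C (q * x))" by simp
  then have "d x * E (q * x) + E x * (E q * d x) = cst l * (E q * d x)"
    using d_mult[OF x ideal_mult[OF x]] d_scale[OF ideal_mult[OF x]] d_projection[OF q(1) x] by simp
  then have eq: "E q * (d x * E x + E x * d x) = E q * (cst l * d x)"
    by (simp add: E_mult distrib_left mult_ac)
  then have "\<forall>\<^sub>F U in generic. q \<in> U \<longrightarrow> ev (d x * E x + E x * d x) U = ev (cst l * d x) U"
    using E_mult_eq_iff[OF q(1)] by blast
  then have "\<forall>\<^sub>F U in generic. q \<in> U \<longrightarrow> ev (d x) U * stone_iso x U + stone_iso x U * ev (d x) U = l * ev (d x) U"
    using ev_add[of "d x * E x" "E x * d x"] ev_mult[of "d x" "E x"] ev_mult[of "E x" "d x"]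
      ev_mult[of "cst l" "d x"] ev_cst[of l] eventually_ev_E[of x]
    by eventually_elim auto
  then obtain U where U: "U \<in> clop q" "q \<in> U \<longrightarrow> ev (d x) U * stone_iso x U + stone_iso x U * ev (d x) U = l * ev (d x) U"
    using generic_point q by blast
  have "clop q \<subseteq> clop e" using q e clop_subset_iff by blast
  then have "U \<in> clop e" using U by blast
  then have "c \<le> cmod (stone_iso x U)" "c \<le> cmod (ev (d x) U)" using low by auto
  then have "c \<le> cmod l" "c \<le> cmod (ev (d x) U)" using l[OF U(1)] by auto
  then have "l \<noteq> 0" "ev (d x) U \<noteq> 0" using c by auto
  moreover have "l * ev (d x) U = 0" using U l[OF U(1)] by (auto simp: clop_def algebra_simps)
  ultimately show False by simp
qed

text \<open>Subtracting from \<open>x\<close> a locally constant approximation and multiplying the small difference by a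
  locally constant large factor keeps it bounded, but multiplies the derivative by the large factor.\<close>

lemma derivative_dominates:
  obtains b where "b \<in> I" "\<forall>\<^sub>F q in generic. e \<in> q \<longrightarrow> cmod (ev f q) \<le> cmod (ev (d b) q)"
proof -
  \<comment> \<open>\<open>n\<close> is the large factor and \<open>l\<close> the approximation on \<open>p\<close>. Both summands of \<open>2 x - l = x + (x - l)\<close> matter: since \<open>1 / n \<le> c / 2\<close>, this element is at least \<open>c / 2\<close>, so \<open>d (n (x - l) x) = n (2 x - l) d x\<close> is at least \<open>n c\<^sup>2 / 2\<close>\<close>
  define good where "good = (\<lambda>p n l. real n \<ge> 2 / c \<and> (\<forall>q\<in>clop p. cmod (stone_iso x q - l) \<le> 1 / real n
    \<and> cmod (ev f q) \<le> real n * c * c / 2))"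
  define K where "K = {p. projection p \<and> p \<noteq> 0 \<and> p * e = p \<and> (\<exists>n l. good p n l)}"
  have dense: "\<exists>p\<in>K. p * r = p" if r: "projection r" "r \<noteq> 0" "r * e = r" for r
  proof -
    obtain s where s: "projection s" "s \<noteq> 0" "s * r = s" "\<forall>q\<in>clop s. (ev f \<longlongrightarrow> ev f q) (nhdsin stone_space q)"
      using ev_continuous_at[of f] r unfolding eventually_generic by blast
    obtain U where U: "U \<in> clop s" using s clop_nonempty by blast
    then have u: "ultrafilter U" "s \<in> U" by (auto simp: clop_def)
    obtain n :: nat where n: "real n \<ge> max (2 / c) ((cmod (ev f U) + 1) * 2 / (c * c))" using real_arch_simple by blast
    have n0: "real n > 0" using n c by (meson divide_pos_pos less_le_trans max.boundedE zero_less_numeral)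
    have fn: "cmod (ev f U) + 1 \<le> real n * c * c / 2"
    proof -
      have "(cmod (ev f U) + 1) * 2 / (c * c) \<le> real n" using n by simp
      then have "(cmod (ev f U) + 1) * 2 \<le> real n * (c * c)" using c by (simp add: pos_divide_le_eq)
      then show ?thesis by (simp add: mult.assoc)
    qed
    have "\<forall>\<^sub>F y in nhdsin stone_space U. dist (ev f y) (ev f U) < 1 \<and> dist (stone_iso x y) (stone_iso x U) < 1 / real n"
      using s(4) U stone_iso_continuous_at[OF u(1), of x] n0 by (intro eventually_conj tendstoD) auto
    then obtain t where t: "t \<in> U"
      "\<forall>y\<in>clop t. dist (ev f y) (ev f U) < 1 \<and> dist (stone_iso x y) (stone_iso x U) < 1 / real n"
      unfolding eventually_nhdsin_stone[OF u(1)] by blast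
    have tP: "projection t" using t u ultrafilter_proj by blast
    define p where "p = t * s"
    have "p \<in> U" using t u ultrafilter_mult p_def by blast
    then have p0: "p \<noteq> 0" using u ultrafilter_zero by metis
    have pP: "projection p" unfolding p_def by (rule projection_mult[OF tP s(1)])
    have "p * s = p" using s by (simp add: p_def mult.assoc projection_idem)
    then have pr: "p * r = p" using s(3) le_trans_mult by blast
    have "good p n (stone_iso x U)"
      unfolding good_def
    proof (intro conjI ballI)
      show "real n \<ge> 2 / c" using n by simp
      fix q assume "q \<in> clop p"
      then have q: "q \<in> clop t" using clop_mult[OF tP s(1)] p_def by blast
      then show "cmod (stone_iso x q - stone_iso x U) \<le> 1 / real n" using t(2) by (simp add: dist_norm less_imp_le)
      have "cmod (ev f q) \<le> cmod (ev f U) + 1"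
        using t(2) q norm_triangle_ineq2[of "ev f q" "ev f U"] by (fastforce simp: dist_norm)
      then show "cmod (ev f q) \<le> real n * c * c / 2" using fn by linarith
    qed
    then show ?thesis using pP p0 pr le_trans_mult[OF pr r(3)] by (auto simp: K_def)
  qed
  have KP: "projection p \<and> p \<noteq> 0" if "p \<in> K" for p using that by (simp add: K_def)
  obtain S where S: "S \<subseteq> K" and disj: "\<forall>p\<in>S. \<forall>q\<in>S. p \<noteq> q \<longrightarrow> p * q = 0"
    and cover: "\<forall>r. projection r \<longrightarrow> r \<noteq> 0 \<longrightarrow> r * e = r \<longrightarrow> (\<exists>p\<in>S. r * p \<noteq> 0)"
    by (rule disjoint_refinement[OF KP dense])
  have SP: "projection p" "p * e = p" if "p \<in> S" for p using that S by (auto simp: K_def)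
  have "\<forall>p\<in>S. \<exists>n l. good p n l" using S by (auto simp: K_def)
  then obtain n l where nl: "\<And>p. p \<in> S \<Longrightarrow> good p (n p) (l p)" by metis
  obtain z where z: "\<forall>p\<in>S. E p * z = E p * (cst (of_nat (n p)) * (E x - cst (l p)))"
    by (rule glue_disjoint[of S]) (use SP(1) disj in auto)
  \<comment> \<open>gluing says nothing outside the cover; there the element is set to zero\<close>
  define w where "w = E e * z"
  have w: "E p * w = E p * (cst (of_nat (n p)) * (E x - cst (l p)))" if p: "p \<in> S" for p
  proof -
    have "E p * w = E p * z" unfolding w_def using SP(2)[OF p] by (metis E_mult mult.assoc)
    then show ?thesis using z p by simp
  qed
  have npos: "real (n p) > 0" if "p \<in> S" for p
    using nl[OF that] c unfolding good_def by (meson divide_pos_pos less_le_trans zero_less_numeral)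
  have "\<forall>\<^sub>F q in generic. e \<in> q \<longrightarrow> cmod (ev w q) \<le> 1"
  proof (rule generic_on_cover[OF SP(1) e(1) cover[rule_format]])
    fix p assume p: "p \<in> S"
    have "\<forall>\<^sub>F q in generic. p \<in> q \<longrightarrow> ev w q = ev (cst (of_nat (n p)) * (E x - cst (l p))) q"
      using w[OF p] E_mult_eq_iff[OF SP(1)[OF p]] by blast
    then show "\<forall>\<^sub>F q in generic. p \<in> q \<longrightarrow> cmod (ev w q) \<le> 1"
      using ev_mult[of "cst (of_nat (n p))" "E x - cst (l p)"] ev_diff[of "E x" "cst (l p)"] ev_cst[of "l p"]
        ev_cst[of "of_nat (n p)"] eventually_ev_E[of x] eventually_generic_ultrafilter
    proof eventually_elim
      case (elim q)
      show ?case
      proof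
        assume "p \<in> q"
        then have "ev w q = of_nat (n p) * (stone_iso x q - l p)" using elim by simp
        moreover have "cmod (stone_iso x q - l p) \<le> 1 / real (n p)"
          using nl[OF p] elim \<open>p \<in> q\<close> by (auto simp: good_def clop_def)
        ultimately have "cmod (ev w q) \<le> real (n p) * (1 / real (n p))"
          by (simp only: norm_mult norm_of_nat) (intro mult_left_mono, auto)
        then show "cmod (ev w q) \<le> 1" using npos[OF p] by simp
      qed
    qed
  qed
  moreover have "\<forall>\<^sub>F q in generic. e \<notin> q \<longrightarrow> ev w q = 0"
    using ev_mult[of "E e" z] eventually_ev_E_projection[OF e(1)] by eventually_elim (auto simp: w_def)
  ultimately have "\<forall>\<^sub>F q in generic. cmod (ev w q) \<le> 1" by eventually_elim auto
  then obtain a where a: "w = E a" by (rule bounded_in_algebra)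
  define b where "b = a * x"
  have "\<forall>\<^sub>F q in generic. e \<in> q \<longrightarrow> cmod (ev f q) \<le> cmod (ev (d b) q)"
  proof (rule generic_on_cover[OF SP(1) e(1) cover[rule_format]])
    fix p assume p: "p \<in> S"
    have "E (p * a) = E (of_nat (n p) *\<^sub>C (p * x + (- l p) *\<^sub>C p))"
      using w[OF p] by (simp add: a E_mult E_scaleC E_add cst_uminus algebra_simps)
    then have pa: "p * a = of_nat (n p) *\<^sub>C (p * x + (- l p) *\<^sub>C p)" by (simp only: E_eq_iff)
    have px: "p * x \<in> I" by (rule ideal_mult[OF x])
    have "p * b = (p * a) * x" by (simp add: b_def mult.assoc)
    also have "\<dots> = of_nat (n p) *\<^sub>C (x * (p * x) + (- l p) *\<^sub>C (p * x))"
      unfolding pa by (simp add: scaleC_mult_left scaleC_mult_right distrib_right distrib_left mult_ac)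
    finally have "d (p * b) = cst (of_nat (n p)) * ((d x * E (p * x) + E x * d (p * x)) + cst (- l p) * d (p * x))"
      using d_scale[OF ideal_add[OF ideal_mult[OF px] ideal_scale[OF px]]] d_add[OF ideal_mult[OF px] ideal_scale[OF px]]
        d_mult[OF x px] d_scale[OF px] by simp
    then have "E p * d b = E p * (cst (of_nat (n p)) * (d x * (E x + E x + cst (- l p))))"
      using d_projection[OF SP(1)[OF p] x] d_projection[OF SP(1)[OF p] ideal_mult[OF x, of a]]
      by (simp add: b_def E_mult algebra_simps)
    then have "\<forall>\<^sub>F q in generic. p \<in> q \<longrightarrow> ev (d b) q = ev (cst (of_nat (n p)) * (d x * (E x + E x + cst (- l p)))) q"
      using E_mult_eq_iff[OF SP(1)[OF p]] by blast
    then show "\<forall>\<^sub>F q in generic. p \<in> q \<longrightarrow> cmod (ev f q) \<le> cmod (ev (d b) q)"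
      using ev_mult[of "cst (of_nat (n p))" "d x * (E x + E x + cst (- l p))"] ev_mult[of "d x" "E x + E x + cst (- l p)"]
        ev_add[of "E x + E x" "cst (- l p)"] ev_add[of "E x" "E x"] ev_cst[of "- l p"]
        ev_cst[of "of_nat (n p)"] eventually_ev_E[of x] eventually_generic_ultrafilter
    proof eventually_elim
      case (elim q)
      show ?case
      proof
        assume pq: "p \<in> q"
        then have qp: "q \<in> clop p" using elim by (simp add: clop_def)
        then have qe: "q \<in> clop e" using SP[OF p] e clop_subset_iff by blast
        have g: "cmod (stone_iso x q - l p) \<le> 1 / real (n p)" "cmod (ev f q) \<le> real (n p) * c * c / 2" "2 / c \<le> real (n p)"
          using nl[OF p] qp by (auto simp: good_def)
        have "1 / real (n p) \<le> c / 2" using g(3) c npos[OF p] by (simp add: field_simps)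
        then have "c / 2 \<le> c - cmod (stone_iso x q - l p)" using g(1) by linarith
        also have "\<dots> \<le> cmod (stone_iso x q) - cmod (stone_iso x q - l p)" using low qe by auto
        also have "\<dots> \<le> cmod (stone_iso x q + (stone_iso x q - l p))"
          using norm_diff_ineq[of "stone_iso x q" "stone_iso x q - l p"] by simp
        finally have h: "c / 2 \<le> cmod (stone_iso x q + stone_iso x q - l p)" by (simp add: add_diff_eq)
        have dbq: "cmod (ev (d b) q) = real (n p) * (cmod (ev (d x) q) * cmod (stone_iso x q + stone_iso x q - l p))"
          using elim pq by (simp add: norm_mult)
        have "real (n p) * (c * (c / 2)) \<le> real (n p) * (cmod (ev (d x) q) * cmod (stone_iso x q + stone_iso x q - l p))"
          using h low qe c by (intro mult_left_mono mult_mono) auto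
        then show "cmod (ev f q) \<le> cmod (ev (d b) q)" using g(2) dbq by (simp add: mult.assoc)
      qed
    qed
  qed
  then show ?thesis using that[of b] ideal_mult[OF x] by (simp add: b_def)
qed

end

lemma nonzero_derivation_large_target:
  assumes Z: "solid_closed Z" and dZ: "\<And>x. x \<in> I \<Longrightarrow> d x \<in> Z"
    and x: "x \<in> I" "d x \<noteq> 0"
  obtains e where "projection e" "e \<noteq> 0" "\<forall>f. E e * f \<in> Z"
    "\<forall>q l. projection q \<longrightarrow> q \<noteq> 0 \<longrightarrow> q * e = q \<longrightarrow> (\<exists>U\<in>clop q. stone_iso x U \<noteq> l)"
    "\<forall>g. projection g \<longrightarrow> g * e = g \<longrightarrow> g \<noteq> 0 \<longrightarrow> E g * E x \<noteq> 0 \<and> E g * d x \<noteq> 0"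
proof -
  obtain e c where e: "projection e" "e \<noteq> 0" "c > 0"
    "\<forall>q\<in>clop e. c \<le> cmod (stone_iso x q) \<and> c \<le> cmod (ev (d x) q)" by (rule d_nonzero_region[OF x])
  show ?thesis
  proof (rule that[OF e(1,2)])
    show "\<forall>f. E e * f \<in> Z"
    proof
      fix f
      obtain b where b: "b \<in> I" "\<forall>\<^sub>F q in generic. e \<in> q \<longrightarrow> cmod (ev f q) \<le> cmod (ev (d b) q)"
        by (rule derivative_dominates[OF x(1) e])
      have "\<forall>\<^sub>F q in generic. cmod (ev (E e * f) q) \<le> cmod (ev (d b) q)"
        using b(2) ev_mult[of "E e" f] eventually_ev_E_projection[OF e(1)] by eventually_elim auto
      then show "E e * f \<in> Z" using Z dZ[OF b(1)] unfolding solid_closed_def by blast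
    qed
    show "\<forall>q l. projection q \<longrightarrow> q \<noteq> 0 \<longrightarrow> q * e = q \<longrightarrow> (\<exists>U\<in>clop q. stone_iso x U \<noteq> l)"
      using nowhere_constant[OF x(1) e] by blast
    show "\<forall>g. projection g \<longrightarrow> g * e = g \<longrightarrow> g \<noteq> 0 \<longrightarrow> E g * E x \<noteq> 0 \<and> E g * d x \<noteq> 0"
    proof (intro allI impI conjI notI)
      fix g assume g: "projection g" "g * e = g" "g \<noteq> 0" and "E g * E x = 0"
      have ge: "clop g \<subseteq> clop e" using g e clop_subset_iff by blast
      from \<open>E g * E x = 0\<close> obtain q where "q \<in> clop g" "g \<in> q \<longrightarrow> ev (E x) q = 0"
        using E_mult_eq_0_iff[OF g(1)] generic_point g by blast
      then have "stone_iso x q = 0" "q \<in> clop e" using ge by (auto simp: clop_def ev_E)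
      then show False using e(3,4) by auto
    next
      fix g assume g: "projection g" "g * e = g" "g \<noteq> 0" and "E g * d x = 0"
      have ge: "clop g \<subseteq> clop e" using g e clop_subset_iff by blast
      from \<open>E g * d x = 0\<close> obtain q where "q \<in> clop g" "g \<in> q \<longrightarrow> ev (d x) q = 0"
        using E_mult_eq_0_iff[OF g(1)] generic_point g by blast
      then have "ev (d x) q = 0" "q \<in> clop e" using ge by (auto simp: clop_def)
      then show False using e(3,4) by auto
    qed
  qed
qed

end

text \<open>A projection on which \<open>x\<close> is not constant contains two points, which a projection separates; so every part of
  \<open>e\<close> splits and one can peel off pieces for ever.\<close>

lemma infinite_disjoint_sequence:
  fixes e :: "'a::comm_awstar_algebra"
  assumes e: "projection e" "e \<noteq> 0"
    and nc: "\<And>q l. projection q \<Longrightarrow> q \<noteq> 0 \<Longrightarrow> q * e = q \<Longrightarrow> \<exists>U\<in>clop q. stone_iso x U \<noteq> l"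
  obtains s :: "nat \<Rightarrow> 'a" where "\<And>n. projection (s n)" "\<And>n. s n \<noteq> 0" "\<And>n. s n * e = s n"
    "\<And>m n. m \<noteq> n \<Longrightarrow> s m * s n = 0"
proof -
  define P where "P = (\<lambda>q. projection q \<and> q \<noteq> 0 \<and> q * e = q)"
  have split: "\<exists>r. P r \<and> r * q = r \<and> q - r \<noteq> 0" if q: "P q" for q
  proof -
    obtain U where U: "U \<in> clop q" using q clop_nonempty P_def by blast
    obtain V where V: "V \<in> clop q" "stone_iso x V \<noteq> stone_iso x U" using nc[of q "stone_iso x U"] q P_def by blast
    have uv: "ultrafilter U" "ultrafilter V" "q \<in> U" "q \<in> V" using U V by (auto simp: clop_def)
    have qP: "projection q" using q P_def by blast
    have "U \<noteq> V" using V by auto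
    then obtain t where t: "projection t" "t \<in> U" "t \<notin> V"
    proof -
      assume *: "\<And>t. projection t \<Longrightarrow> t \<in> U \<Longrightarrow> t \<notin> V \<Longrightarrow> thesis"
      consider t where "t \<in> U" "t \<notin> V" | t where "t \<notin> U" "t \<in> V" using \<open>U \<noteq> V\<close> by blast
      then show thesis
      proof cases
        case 1 then show ?thesis using * uv ultrafilter_proj by blast
      next
        case (2 t)
        then have tP: "projection t" using uv ultrafilter_proj by blast
        then show ?thesis using *[of "1 - t"] 2 uv ultrafilter_compl projection_compl by blast
      qed
    qed
    define r where "r = q * t"
    have "r \<in> U" using t uv ultrafilter_mult r_def by blast
    then have "r \<noteq> 0" using uv ultrafilter_zero by metis
    moreover have "r \<notin> V" using t uv ultrafilter_mult_iff[OF uv(2) qP t(1)] by (simp add: r_def)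
    then have "q - r \<noteq> 0" using uv by auto
    moreover have "projection r" using qP t projection_mult r_def by blast
    moreover have rq: "r * q = r" using qP by (simp add: r_def mult_ac)
    moreover have "r * e = r" using le_trans_mult[OF rq] q P_def by blast
    ultimately show ?thesis unfolding P_def by blast
  qed
  have "\<exists>f. \<forall>n. P (f n) \<and> (f (Suc n) * f n = f (Suc n) \<and> f n - f (Suc n) \<noteq> 0)"
  proof (rule dependent_nat_choice)
    show "\<exists>x. P x" using e by (auto simp: P_def projection_idem)
  qed (use split in blast)
  then obtain f where f: "\<And>n. P (f n)" "\<And>n. f (Suc n) * f n = f (Suc n)" "\<And>n. f n - f (Suc n) \<noteq> 0" by blast
  have fm: "f (n + k) * f n = f (n + k)" for n k
  proof (induction k)
    case 0 then show ?case using f(1)[of n] by (simp add: P_def projection_idem)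
  next
    case (Suc k) then show ?case using le_trans_mult[OF f(2)[of "n + k"]] by simp
  qed
  define s where "s = (\<lambda>n. f n - f (Suc n))"
  have lt: "s m * s n = 0" if "m < n" for m n
  proof -
    obtain k where k: "n = Suc m + k" using \<open>m < n\<close> less_iff_Suc_add by auto
    have "s n * f (Suc m) = s n"
      using fm[of "Suc m" k] fm[of "Suc m" "Suc k"] by (simp add: s_def k left_diff_distrib)
    moreover have "f (Suc m) * s m = 0"
      using f(2)[of m] f(1)[of "Suc m"] by (simp add: s_def right_diff_distrib P_def projection_idem)
    ultimately show ?thesis by (metis mult.assoc mult.commute mult_zero_right)
  qed
  show ?thesis
  proof (rule that[of s])
    show "projection (s n)" for n
      unfolding s_def using f by (intro projection_diff) (auto simp: P_def)
    show "s n \<noteq> 0" for n using f(3) by (simp add: s_def)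
    show "s n * e = s n" for n using f(1)[of n] f(1)[of "Suc n"] by (simp add: s_def P_def left_diff_distrib)
    show "s m * s n = 0" if "m \<noteq> n" for m n
      using lt[of m n] lt[of n m] that by (metis mult.commute nat_neq_iff)
  qed
qed

lemma glue_sequence:
  fixes s :: "nat \<Rightarrow> 'a::comm_awstar_algebra"
  assumes s: "\<And>n. projection (s n)" "\<And>n. s n \<noteq> 0" "\<And>m n. m \<noteq> n \<Longrightarrow> s m * s n = 0"
  obtains z where "\<And>n. E (s n) * z = E (s n) * cst (\<alpha> n)"
proof -
  have inj: "inj s"
  proof (rule injI)
    fix m n assume "s m = s n"
    then show "m = n" using s(3)[of m n] projection_idem[OF s(1)[of n]] s(2)[of n] by metis
  qed
  have A: "projection e" if "e \<in> range s" for e using that s(1) by blast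
  have B: "e * d = 0" if ed: "e \<in> range s" "d \<in> range s" "e \<noteq> d" for e d
  proof -
    obtain m n where "e = s m" "d = s n" using ed by blast
    then show ?thesis using s(3)[of m n] ed(3) by auto
  qed
  obtain z where z: "\<forall>e\<in>range s. E e * z = E e * cst (\<alpha> (inv s e))"
    by (rule glue_disjoint[OF A B])
  have "E (s n) * z = E (s n) * cst (\<alpha> (inv s (s n)))" for n using z by blast
  then have "E (s n) * z = E (s n) * cst (\<alpha> n)" for n by (simp only: inv_f_f[OF inj])
  then show ?thesis by (rule that)
qed

section \<open>Atoms\<close>

lemma bottom_projections:
  assumes p: "projection p" shows "\<bottom>\<^bsub>projections {p * a | a. True}\<^esub> = 0"
proof -
  let ?L = "projections {p * a | a. True}"
  have c: "carrier ?L = {e. projection e \<and> e * p = e}" by (rule carrier_projections[OF p])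
  have l: "least ?L 0 (carrier ?L)" unfolding least_def le_projections c by auto
  have "x = 0" if "least ?L x (carrier ?L)" for x
    using that l unfolding least_def le_projections by (metis le_antisym)
  then show ?thesis unfolding bottom_def by (intro some_equality l)
qed

definition minimal_projection :: "'a::comm_awstar_algebra \<Rightarrow> bool"
  where "minimal_projection a \<longleftrightarrow> projection a \<and> a \<noteq> 0 \<and> (\<forall>c. projection c \<longrightarrow> c * a = c \<longrightarrow> c = 0 \<or> c = a)"

lemma atomic_projections_iff:
  assumes p: "projection p"
  shows "atomic (projections {p * a | a. True}) \<longleftrightarrow>
    (\<forall>b. projection b \<longrightarrow> b \<noteq> 0 \<longrightarrow> b * p = b \<longrightarrow> (\<exists>a. minimal_projection a \<and> a * b = a))"
proof -
  define L where "L = projections {p * a | a. True}"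
  have c: "carrier L = {e. projection e \<and> e * p = e}" unfolding L_def by (rule carrier_projections[OF p])
  have le: "e \<sqsubseteq>\<^bsub>L\<^esub> f \<longleftrightarrow> e * f = e" for e f by (simp add: L_def)
  have bot: "\<bottom>\<^bsub>L\<^esub> = 0" unfolding L_def by (rule bottom_projections[OF p])
  have at: "atom L a \<longleftrightarrow> minimal_projection a \<and> a * p = a" for a
    unfolding atom_def bot le c minimal_projection_def using le_trans_mult by blast
  have "atomic L \<longleftrightarrow> (\<forall>b. projection b \<longrightarrow> b \<noteq> 0 \<longrightarrow> b * p = b \<longrightarrow> (\<exists>a. minimal_projection a \<and> a * b = a))"
    unfolding atomic_def at bot le c using le_trans_mult by blast
  then show ?thesis by (simp add: L_def)
qed

text \<open>An atom lies below some member of each cover.\<close>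

lemma atomic_imp_sigma_distributive:
  assumes p: "projection p" and at: "atomic (projections {p * a | a. True})"
  shows "sigma_distributive (projections {p * a | a. True})"
  unfolding sigma_distributive_iff_refinable[OF p]
proof (intro allI impI)
  fix d :: 'a assume d: "projection d" "d \<noteq> 0" "d * p = d"
  then obtain a where a: "minimal_projection a" "a * d = a"
    using at unfolding atomic_projections_iff[OF p] by blast
  have aP: "projection a" "a \<noteq> 0" using a by (auto simp: minimal_projection_def)
  show "refinable d"
    unfolding refinable_def
  proof (intro allI impI)
    fix c :: "nat \<Rightarrow> nat \<Rightarrow> 'a"
    assume c: "\<forall>n m. projection (c n m)"
      and cover: "\<forall>n e. projection e \<longrightarrow> e \<noteq> 0 \<longrightarrow> e * d = e \<longrightarrow> (\<exists>m. e * c n m \<noteq> 0)"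
    have "\<exists>m. a * c n m = a" for n
    proof -
      obtain m where m: "a * c n m \<noteq> 0" using cover aP a(2) by blast
      have "projection (a * c n m)" using aP c projection_mult by blast
      moreover have "a * c n m * a = a * c n m" using aP by (simp add: mult_ac projection_idem)
      ultimately have "a * c n m = a" using a(1) m unfolding minimal_projection_def by blast
      then show ?thesis by blast
    qed
    then obtain \<phi> where "\<And>n. a * c n (\<phi> n) = a" by metis
    then show "\<exists>\<phi> q. projection q \<and> q \<noteq> 0 \<and> q * d = q \<and> (\<forall>n. q * c n (\<phi> n) = q)" using aP a(2) by blast
  qed
qed

section \<open>Representations as von Neumann algebras\<close>

lemma cinner_add_right: "cinner x (y + z) = cinner x y + cinner x (z :: 'h::complex_hilbert)"
  by (metis cinner_add_left cinner_commute complex_cnj_add)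

lemma cinner_zero_left: "cinner 0 (y :: 'h::complex_hilbert) = 0"
  using cinner_add_left[of 0 0 y] by simp

lemma norm_add_orthogonal:
  assumes "cinner x (y :: 'h::complex_hilbert) = 0" shows "(norm (x + y))\<^sup>2 = (norm x)\<^sup>2 + (norm y)\<^sup>2"
proof -
  have "cinner y x = 0" using assms cinner_commute[of y x] by simp
  then have "cinner (x + y) (x + y) = cinner x x + cinner y y"
    using assms by (simp add: cinner_add_left cinner_add_right)
  then show ?thesis unfolding cinner_self by (simp only: of_real_add[symmetric] of_real_eq_iff)
qed

lemma bounded_linear_scaleC: "bounded_linear (\<lambda>x :: 'h::complex_banach. c *\<^sub>C x)"
proof (rule bounded_linear_intro[of _ "cmod c"])
  show "c *\<^sub>C (r *\<^sub>R x) = r *\<^sub>R (c *\<^sub>C x)" for r and x :: 'h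
    by (simp add: scaleC_of_real[symmetric] scaleC_scaleC mult.commute)
qed (auto simp: scaleC_add_right norm_scaleC mult.commute)

context
  fixes \<pi> :: "'a::comm_awstar_algebra \<Rightarrow> ('h::complex_hilbert \<Rightarrow>\<^sub>L 'h)" and M :: "('h \<Rightarrow>\<^sub>L 'h) set"
  assumes M: "von_neumann_algebra M" and \<pi>: "star_iso_onto \<pi> M"
begin

abbreviation A :: "'a \<Rightarrow> 'h \<Rightarrow> 'h" where "A a \<equiv> blinfun_apply (\<pi> a)"

lemma A_add: "A (a + b) v = A a v + A b v"
  using \<pi> by (simp add: star_iso_onto_def blinfun.add_left)

lemma A_mult: "A (a * b) v = A a (A b v)"
  using \<pi> by (simp add: star_iso_onto_def)

lemma A_zero: "A 0 v = 0" using A_add[of 0 0 v] by simp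

lemma A_diff: "A (a - b) v = A a v - A b v" using A_add[of "a - b" b v] by simp

lemma A_eqI: "(\<And>v. A a v = A b v) \<Longrightarrow> a = b"
proof -
  assume "\<And>v. A a v = A b v"
  then have "\<pi> a = \<pi> b" by (rule blinfun_eqI)
  then show "a = b" using \<pi> by (auto simp: star_iso_onto_def bij_betw_def dest: injD)
qed

lemma A_adjoint: "projection e \<Longrightarrow> cinner (A e x) y = cinner x (A e y)"
  using \<pi> unfolding star_iso_onto_def is_adjoint_def by (metis projection_star)

lemma A_orthogonal: "projection e \<Longrightarrow> e * f = 0 \<Longrightarrow> cinner (A e v) (A f w) = 0"
  using A_adjoint[of e v "A f w"] A_mult[of e f w] A_zero[of w] cinner_commute[of v 0] cinner_zero_left[of v] by simp

lemma norm_A_add: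
  "projection e \<Longrightarrow> e * f = 0 \<Longrightarrow> (norm (A (e + f) v))\<^sup>2 = (norm (A e v))\<^sup>2 + (norm (A f v))\<^sup>2"
  unfolding A_add by (rule norm_add_orthogonal[OF A_orthogonal])

lemma norm_A_le:
  assumes e: "projection e" shows "norm (A e v) \<le> norm v"
proof -
  have "cinner (A e v) (v - A e v) = 0"
    using A_adjoint[OF e, of v "v - A e v"] A_mult[of e e v] cinner_commute[of v 0] cinner_zero_left[of v]
    by (simp add: blinfun.diff_right projection_idem[OF e])
  from norm_add_orthogonal[OF this] have "(norm (A e v))\<^sup>2 \<le> (norm v)\<^sup>2" by simp
  then show ?thesis by (rule power2_le_imp_le) simp
qed

lemma norm_A_mono:
  assumes "projection e" "projection f" "e * f = e" shows "norm (A e v) \<le> norm (A f v)"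
  using norm_A_le[OF assms(1), of "A f v"] assms(3) A_mult[of e f v] by simp

text \<open>The net of the operators \<open>\<pi> e\<close> converges strongly; its limit commutes with the commutant of \<open>M\<close>,
  so that it is \<open>\<pi> t\<close> for some \<open>t\<close>, and \<open>t\<close> is the supremum.\<close>

lemma normality:
  assumes J: "\<And>e. e \<in> J \<Longrightarrow> projection e" "J \<noteq> {}"
    and dir: "\<And>e f. e \<in> J \<Longrightarrow> f \<in> J \<Longrightarrow> e + f - e * f \<in> J"
    and bound: "\<And>e. e \<in> J \<Longrightarrow> norm (A e h) \<le> C"
  shows "norm (A (psup J) h) \<le> C"
proof -
  \<comment> \<open>the filter of the net \<open>J\<close>, directed by its joins\<close>
  define F where "F = (INF e\<in>J. principal {f \<in> J. e * f = e})"
  have evF: "eventually P F \<longleftrightarrow> (\<exists>e\<in>J. \<forall>f\<in>J. e * f = e \<longrightarrow> P f)" for P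
  proof -
    have "eventually P F \<longleftrightarrow> (\<exists>e\<in>J. eventually P (principal {f \<in> J. e * f = e}))"
      unfolding F_def
    proof (rule eventually_INF_base[OF J(2)])
      fix e f assume ef: "e \<in> J" "f \<in> J"
      define g where "g = e + f - e * f"
      have "e * g = e" "f * g = f" using J(1)[OF ef(1)] J(1)[OF ef(2)] by (simp_all add: g_def algebra_simps projection_idem)
      then have "{k \<in> J. g * k = g} \<subseteq> {k \<in> J. e * k = e} \<inter> {k \<in> J. f * k = f}"
        using le_trans_mult[of e g] le_trans_mult[of f g] by blast
      then show "\<exists>x\<in>J. principal {k \<in> J. x * k = x} \<le> inf (principal {k \<in> J. e * k = e}) (principal {k \<in> J. f * k = f})"
        using dir[OF ef] by (intro bexI[of _ g]) (auto simp: g_def)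
    qed
    then show ?thesis by (auto simp: eventually_principal)
  qed
  have nb: "F \<noteq> bot"
  proof
    assume "F = bot"
    then obtain e where "e \<in> J" "\<forall>f\<in>J. e * f = e \<longrightarrow> False" using evF[of "\<lambda>_. False"] by auto
    then show False using J(1) projection_idem by blast
  qed
  have "\<exists>l. ((\<lambda>e. A e v) \<longlongrightarrow> l) F" for v
  proof -
    define N where "N = (\<lambda>e. (norm (A e v))\<^sup>2) ` J"
    have bdd: "bdd_above N" unfolding N_def
      using norm_A_le[OF J(1)] by (intro bdd_aboveI[of _ "(norm v)\<^sup>2"]) (auto intro: power_mono)
    have "cauchy_filter (filtermap (\<lambda>e. A e v) F)"
      unfolding cauchy_filter_metric_filtermap
    proof (intro allI impI)
      fix r :: real assume r: "r > 0"
      have "Sup N - (r / 2)\<^sup>2 < Sup N" using r by simp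
      then obtain y where "y \<in> N" "Sup N - (r / 2)\<^sup>2 < y"
        using less_cSup_iff[OF _ bdd] J(2) N_def by blast
      then obtain e where e: "e \<in> J" "Sup N - (r / 2)\<^sup>2 < (norm (A e v))\<^sup>2" by (auto simp: N_def)
      have near: "norm (A f v - A e v) < r / 2" if f: "f \<in> J" "e * f = e" for f
      proof -
        have "e * (f - e) = 0" using f J(1)[OF e(1)] by (simp add: right_diff_distrib projection_idem)
        then have "(norm (A f v))\<^sup>2 = (norm (A e v))\<^sup>2 + (norm (A (f - e) v))\<^sup>2"
          using norm_A_add[OF J(1)[OF e(1)], of "f - e" v] by simp
        moreover have "(norm (A f v))\<^sup>2 \<le> Sup N" using f bdd by (intro cSup_upper) (auto simp: N_def)
        ultimately have "(norm (A (f - e) v))\<^sup>2 < (r / 2)\<^sup>2" using e(2) by linarith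
        then have "norm (A (f - e) v) < r / 2" by (rule power2_less_imp_less) (use r in simp)
        then show ?thesis by (simp add: A_diff)
      qed
      show "\<exists>P. eventually P F \<and> (\<forall>x y. P x \<and> P y \<longrightarrow> dist (A x v) (A y v) < r)"
      proof (intro exI[of _ "\<lambda>f. norm (A f v - A e v) < r / 2"] conjI allI impI)
        show "\<forall>\<^sub>F f in F. norm (A f v - A e v) < r / 2" unfolding evF using e near by blast
        fix x y assume "norm (A x v - A e v) < r / 2 \<and> norm (A y v - A e v) < r / 2"
        then show "dist (A x v) (A y v) < r"
          using dist_triangle2[of "A x v" "A y v" "A e v"] by (simp add: dist_norm)
      qed
    qed
    moreover have "complete (UNIV :: 'h set)" by (rule complete_UNIV)
    ultimately show ?thesis
      using complete_uniform[where S="UNIV :: 'h set"] nb by (auto simp: filterlim_def filtermap_bot_iff)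
  qed
  then obtain T where T: "\<And>v. ((\<lambda>e. A e v) \<longlongrightarrow> T v) F" by metis
  have Teq: "T v = l" if "((\<lambda>e. A e v) \<longlongrightarrow> l) F" for v l
    using tendsto_unique[OF nb T that] .
  have bl: "bounded_linear T"
  proof (rule bounded_linear_intro[of _ 1])
    show "T (x + y) = T x + T y" for x y
      by (rule Teq) (simp add: blinfun.add_right tendsto_add T)
    show "T (r *\<^sub>R x) = r *\<^sub>R T x" for r x
      by (rule Teq) (simp add: blinfun.scaleR_right tendsto_scaleR T)
    show "norm (T x) \<le> norm x * 1" for x
    proof (rule tendsto_upperbound[OF tendsto_norm[OF T] _ nb])
      show "\<forall>\<^sub>F e in F. norm (A e x) \<le> norm x * 1" unfolding evF using J norm_A_le by fastforce
    qed
  qed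
  define B where "B = Blinfun T"
  have B: "blinfun_apply B v = T v" for v unfolding B_def by (simp add: bounded_linear_Blinfun_apply[OF bl])
  have ops: "\<pi> e \<in> complex_ops" for e
    using M \<pi> unfolding von_neumann_algebra_def star_iso_onto_def bij_betw_def by blast
  have "B \<in> complex_ops"
    unfolding complex_ops_def
  proof (intro CollectI allI)
    fix c and x :: 'h
    have "((\<lambda>e. A e (c *\<^sub>C x)) \<longlongrightarrow> c *\<^sub>C T x) F"
      using bounded_linear.tendsto[OF bounded_linear_scaleC T] ops by (simp add: complex_ops_def)
    then show "blinfun_apply B (c *\<^sub>C x) = c *\<^sub>C blinfun_apply B x" unfolding B by (rule Teq)
  qed
  moreover have "B o\<^sub>L R = R o\<^sub>L B" if R: "R \<in> commutant M" for R
  proof (rule blinfun_eqI)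
    fix v
    have "\<pi> e \<in> M" for e using \<pi> unfolding star_iso_onto_def bij_betw_def by blast
    then have com: "R o\<^sub>L \<pi> e = \<pi> e o\<^sub>L R" for e using R by (auto simp: commutant_def)
    have c: "blinfun_apply R (A e v) = A e (blinfun_apply R v)" for e
      using arg_cong[OF com[of e], of "\<lambda>S. blinfun_apply S v"] by simp
    have "((\<lambda>e. blinfun_apply R (A e v)) \<longlongrightarrow> blinfun_apply R (T v)) F"
      by (intro tendsto_intros T)
    then show "blinfun_apply (B o\<^sub>L R) v = blinfun_apply (R o\<^sub>L B) v"
      using Teq by (simp add: B c)
  qed
  ultimately have "B \<in> commutant (commutant M)" by (auto simp: commutant_def)
  then have "B \<in> M" using M by (simp add: von_neumann_algebra_def)
  then obtain t where "\<pi> t = B" using \<pi> unfolding star_iso_onto_def bij_betw_def by (metis imageE)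
  then have t: "A t v = T v" for v using B by simp
  define r where "r = psup J"
  have te: "t * e = e" if e: "e \<in> J" for e
  proof (rule A_eqI)
    fix v
    have "\<forall>\<^sub>F f in F. A f (A e v) = A e v"
      unfolding evF using e by (intro bexI[of _ e]) (auto simp: A_mult[symmetric] mult.commute)
    then have "T (A e v) = A e v" by (intro Teq tendsto_eventually)
    then show "A (t * e) v = A e v" by (simp add: A_mult t)
  qed
  have re: "e * r = e" if "e \<in> J" for e unfolding r_def using that by (rule psup_upper)
  have "e * (t - r) = 0" if e: "e \<in> J" for e
    using te[OF e] re[OF e] by (simp add: right_diff_distrib mult.commute[of e t])
  then have "r * (t - r) = 0" unfolding r_def psup(2) by blast
  then have rt: "r * t = r" unfolding r_def using psup(1)[of J] by (simp add: right_diff_distrib projection_idem)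
  have "t * r = t"
  proof (rule A_eqI)
    fix v
    have "\<forall>\<^sub>F f in F. A f (A r v) = A f v"
      unfolding evF using J re by (auto simp: A_mult[symmetric])
    then have "((\<lambda>f. A f (A r v)) \<longlongrightarrow> T v) F" using T[of v] by (simp add: tendsto_cong)
    then show "A (t * r) v = A t v" unfolding A_mult t by (rule Teq)
  qed
  then have "t = r" using rt by (simp add: mult.commute)
  moreover have "norm (T h) \<le> C"
  proof (rule tendsto_upperbound[OF tendsto_norm[OF T] _ nb])
    show "\<forall>\<^sub>F e in F. norm (A e h) \<le> C" unfolding evF using J bound by blast
  qed
  ultimately show ?thesis using t r_def by metis
qed

lemma sum_disjoint_norms:
  assumes "finite S" "\<And>e. e \<in> S \<Longrightarrow> projection e" "\<And>e f. e \<in> S \<Longrightarrow> f \<in> S \<Longrightarrow> e \<noteq> f \<Longrightarrow> e * f = 0"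
  shows "projection (\<Sum>S) \<and> (norm (A (\<Sum>S) h))\<^sup>2 = (\<Sum>e\<in>S. (norm (A e h))\<^sup>2)"
  using assms
proof (induction S rule: finite_induct)
  case empty then show ?case by (simp add: A_zero)
next
  case (insert e S)
  have IH: "projection (\<Sum>S)" "(norm (A (\<Sum>S) h))\<^sup>2 = (\<Sum>e\<in>S. (norm (A e h))\<^sup>2)" using insert by auto
  have z: "e * \<Sum>S = 0" unfolding sum_distrib_left using insert by (intro sum.neutral) auto
  have "projection (e + \<Sum>S)" using projection_join[OF _ IH(1), of e] insert z by simp
  then show ?case using norm_A_add[OF _ z] insert IH by simp
qed

text \<open>Suppose that no atom lies below \<open>b\<close>, and take a vector that \<open>b\<close> does not annihilate. By \<open>normality\<close> the
  supremum of the null projections of its measure \<open>\<mu>\<close> is a null projection; outside it, \<open>\<mu>\<close> is strictly positive, and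
  repeated splitting yields parts of small measure below everything.\<close>

lemma sigma_distributive_imp_atomic:
  fixes p :: 'a
  assumes p: "projection p" and sd: "sigma_distributive (projections {p * a | a. True})"
  shows "atomic (projections {p * a | a. True})"
  unfolding atomic_projections_iff[OF p]
proof (intro allI impI, rule ccontr)
  fix b :: 'a assume b: "projection b" "b \<noteq> 0" "b * p = b"
    and no: "\<not> (\<exists>a. minimal_projection a \<and> a * b = a)"
  obtain h where h: "A b h \<noteq> 0"
  proof -
    have "\<exists>h. A b h \<noteq> A 0 h" using A_eqI b(2) by blast
    then show ?thesis using that by (auto simp: A_zero)
  qed
  define \<mu> where "\<mu> = (\<lambda>e. (norm (A e h))\<^sup>2)"
  have mono: "\<mu> e \<le> \<mu> f" if "projection e" "projection f" "e * f = e" for e f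
    unfolding \<mu>_def using norm_A_mono[OF that] by (simp add: power_mono)
  define J where "J = {e. projection e \<and> A e h = 0}"
  have "norm (A (psup J) h) \<le> 0"
  proof (rule normality)
    show "J \<noteq> {}" using A_zero by (auto simp: J_def intro!: exI[of _ 0])
    show "e + f - e * f \<in> J" if "e \<in> J" "f \<in> J" for e f
      using that by (simp add: J_def projection_join A_add A_diff A_mult)
  qed (auto simp: J_def)
  then have Jh: "A (psup J) h = 0" by simp
  define d where "d = b * (1 - psup J)"
  have dP: "projection d" using b by (simp add: d_def projection_mult projection_compl psup)
  have db: "d * b = d" using b by (simp add: d_def mult_ac projection_idem)
  have "A d h = A b h" using Jh by (simp add: d_def right_diff_distrib A_diff A_mult)
  then have d0: "d \<noteq> 0" using h A_zero by auto
  have faithful: "\<mu> e > 0" if e: "projection e" "e * d = e" "e \<noteq> 0" for e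
  proof -
    have "A e h \<noteq> 0"
    proof
      assume "A e h = 0"
      then have "e * psup J = e" using e by (intro psup_upper) (simp add: J_def)
      then have "e * d = e * psup J * (b * (1 - psup J))" by (simp add: d_def)
      also have "\<dots> = e * b * (psup J * (1 - psup J))" by (simp only: mult_ac)
      also have "\<dots> = 0" by (simp add: right_diff_distrib projection_idem psup)
      finally show False using e by simp
    qed
    then show ?thesis by (simp add: \<mu>_def)
  qed
  have halve: "\<exists>f. projection f \<and> f \<noteq> 0 \<and> f * e = f \<and> \<mu> f \<le> (norm h)\<^sup>2 / 2 ^ n"
    if e: "projection e" "e \<noteq> 0" "e * d = e" for e n
  proof (induction n)
    case 0
    have "\<mu> e \<le> (norm h)\<^sup>2" unfolding \<mu>_def using norm_A_le[OF e(1)] by (simp add: power_mono)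
    then show ?case using e by (intro exI[of _ e]) (simp add: projection_idem)
  next
    case (Suc n)
    then obtain f where f: "projection f" "f \<noteq> 0" "f * e = f" "\<mu> f \<le> (norm h)\<^sup>2 / 2 ^ n" by blast
    have "f * b = f" using le_trans_mult[OF f(3) le_trans_mult[OF e(3) db]] .
    then obtain g where g: "projection g" "g * f = g" "g \<noteq> 0" "g \<noteq> f"
      using no f unfolding minimal_projection_def by blast
    have fg: "projection (f - g)" "f - g \<noteq> 0" using g projection_diff[OF g(1) f(1) g(2)] by auto
    have gfg: "g * (f - g) = 0" using g by (simp add: right_diff_distrib projection_idem)
    have "\<mu> f = \<mu> g + \<mu> (f - g)" using norm_A_add[OF g(1) gfg, of h] by (simp add: \<mu>_def)
    then have "\<mu> g \<le> \<mu> f / 2 \<or> \<mu> (f - g) \<le> \<mu> f / 2" by linarith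
    moreover have "\<mu> f / 2 \<le> (norm h)\<^sup>2 / 2 ^ Suc n" using f(4) by simp
    moreover have "g * e = g" using le_trans_mult[OF g(2) f(3)] .
    moreover have "(f - g) * e = f - g" using f(3) \<open>g * e = g\<close> by (simp add: left_diff_distrib)
    ultimately show ?case using g fg by (meson order_trans)
  qed
  define K where "K = (\<lambda>n. {f. projection f \<and> f \<noteq> 0 \<and> f * d = f \<and> \<mu> f \<le> (norm h)\<^sup>2 / 2 ^ n})"
  have "\<exists>S. S \<subseteq> K n \<and> countable S \<and>
      (\<forall>r. projection r \<longrightarrow> r \<noteq> 0 \<longrightarrow> r * d = r \<longrightarrow> (\<exists>q\<in>S. r * q \<noteq> 0))" for n
  proof -
    have KP: "q \<in> K n \<Longrightarrow> projection q \<and> q \<noteq> 0" for q by (simp add: K_def)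
    have dense: "\<exists>q\<in>K n. q * r = q" if r: "projection r" "r \<noteq> 0" "r * d = r" for r
      using halve[OF r, of n] le_trans_mult[OF _ r(3)] by (auto simp: K_def)
    obtain S where S: "S \<subseteq> K n" and disj: "\<forall>q\<in>S. \<forall>q'\<in>S. q \<noteq> q' \<longrightarrow> q * q' = 0"
      and cover: "\<forall>r. projection r \<longrightarrow> r \<noteq> 0 \<longrightarrow> r * d = r \<longrightarrow> (\<exists>q\<in>S. r * q \<noteq> 0)"
      by (rule disjoint_refinement[OF KP dense])
    have SP: "projection q" "q * d = q" "q \<noteq> 0" if "q \<in> S" for q using S that by (auto simp: K_def)
    have "\<mu> summable_on S"
    proof (rule nonneg_bdd_above_summable_on)
      show "0 \<le> \<mu> x" for x by (simp add: \<mu>_def)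
      show "bdd_above (sum \<mu> ` {F. F \<subseteq> S \<and> finite F})"
      proof (rule bdd_aboveI2)
        fix F assume F: "F \<in> {F. F \<subseteq> S \<and> finite F}"
        have s: "projection (\<Sum>F) \<and> (norm (A (\<Sum>F) h))\<^sup>2 = (\<Sum>e\<in>F. (norm (A e h))\<^sup>2)"
          using F SP(1) disj by (intro sum_disjoint_norms) auto
        then have "sum \<mu> F = (norm (A (\<Sum>F) h))\<^sup>2" by (simp add: \<mu>_def)
        also have "\<dots> \<le> (norm h)\<^sup>2" using s norm_A_le by (intro power_mono) auto
        finally show "sum \<mu> F \<le> (norm h)\<^sup>2" .
      qed
    qed
    then have "(\<lambda>q. norm (\<mu> q)) summable_on S" by (simp add: \<mu>_def)
    then have "countable {q \<in> S. \<mu> q \<noteq> 0}" by (rule abs_summable_countable)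
    moreover have "{q \<in> S. \<mu> q \<noteq> 0} = S" using faithful SP by force
    ultimately show ?thesis using S cover by auto
  qed
  then obtain S where S: "\<And>n. S n \<subseteq> K n" "\<And>n. countable (S n)"
    "\<And>n r. projection r \<Longrightarrow> r \<noteq> 0 \<Longrightarrow> r * d = r \<Longrightarrow> \<exists>q\<in>S n. r * q \<noteq> 0" by metis
  have S0: "S n \<noteq> {}" for n using S(3)[OF dP d0] dP by (auto simp: projection_idem)
  define c where "c = (\<lambda>n. from_nat_into (S n))"
  have cS: "c n m \<in> S n" for n m unfolding c_def using S0 by (rule from_nat_into)
  then have cK: "c n m \<in> K n" for n m using S(1) by blast
  have "refinable d"
    using sd le_trans_mult[OF db b(3)] dP d0 unfolding sigma_distributive_iff_refinable[OF p] by blast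
  moreover have "\<forall>n m. projection (c n m)" using cK by (simp add: K_def)
  moreover have "\<forall>n e. projection e \<longrightarrow> e \<noteq> 0 \<longrightarrow> e * d = e \<longrightarrow> (\<exists>m. e * c n m \<noteq> 0)"
  proof (intro allI impI)
    fix n and e :: 'a assume "projection e" "e \<noteq> 0" "e * d = e"
    then obtain q where q: "q \<in> S n" "e * q \<noteq> 0" using S(3) by blast
    then obtain m where "c n m = q" unfolding c_def using from_nat_into_surj[OF S(2)] by blast
    then show "\<exists>m. e * c n m \<noteq> 0" using q by blast
  qed
  ultimately obtain \<phi> q where q: "projection q" "q \<noteq> 0" "q * d = q" "\<And>n. q * c n (\<phi> n) = q"
    unfolding refinable_def by blast
  have small: "\<mu> q \<le> (norm h)\<^sup>2 / 2 ^ n" for n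
    using mono[OF q(1) _ q(4)[of n]] cK[of n "\<phi> n"] by (auto simp: K_def intro: order_trans)
  have "\<mu> q > 0" using faithful q by blast
  then obtain n where "(norm h)\<^sup>2 / \<mu> q < 2 ^ n" using real_arch_pow[of 2] by auto
  then have "(norm h)\<^sup>2 / 2 ^ n < \<mu> q" using \<open>\<mu> q > 0\<close> by (simp add: field_simps)
  then show False using small[of n] by simp
qed

end

section \<open>Band preserving derivations\<close>

context
  fixes I :: "'a::comm_awstar_algebra set" and Y :: "'a meas set" and \<delta> :: "'a \<Rightarrow> 'a meas"
  assumes Y: "Y \<subseteq> S_alg" and der: "derivation I Y \<delta>" and bp: "band_preserving I \<delta>" and I: "ideal_of I"
begin

lemma rep_derivation: "x \<in> I \<Longrightarrow> rep_aff (Abs_aff (\<delta> x)) = \<delta> x"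
  using der Y by (auto simp: derivation_def intro!: Abs_aff_inverse)

lemma derivation_add: "x \<in> I \<Longrightarrow> y \<in> I \<Longrightarrow> Abs_aff (\<delta> (x + y)) = Abs_aff (\<delta> x) + Abs_aff (\<delta> y)"
  using der by (simp add: derivation_def rep_derivation plus_aff_def)

lemma derivation_scale: "x \<in> I \<Longrightarrow> Abs_aff (\<delta> (c *\<^sub>C x)) = cst c * Abs_aff (\<delta> x)"
  using der rep_scale[of c "Abs_aff (\<delta> x)"] rep_aff_inverse[of "cst c * Abs_aff (\<delta> x)"]
  by (simp add: derivation_def rep_derivation)

lemma derivation_mult:
  "x \<in> I \<Longrightarrow> y \<in> I \<Longrightarrow> Abs_aff (\<delta> (x * y)) = Abs_aff (\<delta> x) * E y + E x * Abs_aff (\<delta> y)"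
  using der rep_add[of "Abs_aff (\<delta> x) * E y" "E x * Abs_aff (\<delta> y)"]
    rep_aff_inverse[of "Abs_aff (\<delta> x) * E y + E x * Abs_aff (\<delta> y)"]
  by (simp add: derivation_def rep_derivation rep_mult rep_E)

lemma derivation_band:
  assumes e: "projection e" and x: "x \<in> I" and z: "E e * E x = 0"
  shows "E e * Abs_aff (\<delta> x) = 0"
proof -
  have "e * supp (emb x) = 0" using z supp_mult_eq_0_iff[OF e, of "E x"] by (simp add: rep_E)
  moreover have "supp (\<delta> x) * supp (emb x) = supp (\<delta> x)" using bp x by (simp add: band_preserving_def)
  ultimately have "e * supp (\<delta> x) = 0" by (metis mult.assoc mult.commute mult_zero_right)
  then show ?thesis using supp_mult_eq_0_iff[OF e, of "Abs_aff (\<delta> x)"] x by (simp add: rep_derivation)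
qed

text \<open>The element \<open>x\<close> with \<open>\<delta> x \<noteq> 0\<close> witnesses both bounds on \<open>e\<close>: it is non-zero on every part of \<open>e\<close>, and so is \<open>\<delta> x\<close>.\<close>

lemma nonzero_derivation_region:
  assumes Z: "solid_closed {z. rep_aff z \<in> Y}" and nz: "nonzero_on I \<delta>"
  obtains e x where "projection e" "e \<noteq> 0" "e * supp_set (emb ` I) = e" "e * supp_set Y = e"
    "\<forall>f. rep_aff (E e * f) \<in> Y"
    "\<forall>q l. projection q \<longrightarrow> q \<noteq> 0 \<longrightarrow> q * e = q \<longrightarrow> (\<exists>U\<in>clop q. stone_iso x U \<noteq> l)"
proof -
  define d where "d = (\<lambda>x. Abs_aff (\<delta> x))"
  have rd: "rep_aff (d x) = \<delta> x" if "x \<in> I" for x using rep_derivation[OF that] by (simp add: d_def)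
  obtain x where x: "x \<in> I" "\<delta> x \<noteq> S_zero" using nz by (auto simp: nonzero_on_def)
  then have dx: "d x \<noteq> 0" using rd[OF x(1)] rep_zero by metis
  have dZ: "d y \<in> {z. rep_aff z \<in> Y}" if "y \<in> I" for y using that rd der by (simp add: derivation_def)
  have d: "x \<in> I \<Longrightarrow> y \<in> I \<Longrightarrow> d (x + y) = d x + d y" "x \<in> I \<Longrightarrow> d (c *\<^sub>C x) = cst c * d x"
    "x \<in> I \<Longrightarrow> y \<in> I \<Longrightarrow> d (x * y) = d x * E y + E x * d y"
    "projection e \<Longrightarrow> x \<in> I \<Longrightarrow> E e * E x = 0 \<Longrightarrow> E e * d x = 0" for x y c e
    unfolding d_def by (fact derivation_add derivation_scale derivation_mult derivation_band)+
  obtain e where e: "projection e" "e \<noteq> 0" and large: "\<forall>f. E e * f \<in> {z. rep_aff z \<in> Y}"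
    and nc: "\<forall>q l. projection q \<longrightarrow> q \<noteq> 0 \<longrightarrow> q * e = q \<longrightarrow> (\<exists>U\<in>clop q. stone_iso x U \<noteq> l)"
    and full: "\<forall>g. projection g \<longrightarrow> g * e = g \<longrightarrow> g \<noteq> 0 \<longrightarrow> E g * E x \<noteq> 0 \<and> E g * d x \<noteq> 0"
    by (rule nonzero_derivation_large_target[OF I d Z dZ x(1) dx])
  have below: "e * s = e" if s: "projection s" and n: "\<And>g. projection g \<Longrightarrow> g * e = g \<Longrightarrow> g * s = 0 \<Longrightarrow> g = 0" for s
  proof -
    have "e * (1 - s) = 0"
    proof (rule n)
      show "projection (e * (1 - s))" by (rule projection_mult[OF e(1) projection_compl[OF s]])
      show "e * (1 - s) * e = e * (1 - s)" using e by (simp add: mult_ac projection_idem)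
      show "e * (1 - s) * s = 0" using s by (simp add: mult.assoc left_diff_distrib projection_idem)
    qed
    then show ?thesis by (simp add: le_iff_compl)
  qed
  have emb: "emb ` I \<subseteq> S_alg" using emb_in_S_alg by blast
  show ?thesis
  proof (rule that[OF e])
    show "e * supp_set (emb ` I) = e"
    proof (rule below[OF supp_set_projection[OF emb]])
      fix g assume g: "projection g" "g * e = g" "g * supp_set (emb ` I) = 0"
      have "rep_aff (E x) \<in> emb ` I" using x by (simp add: rep_E)
      then have "E g * E x = 0" using supp_set_mult_eq_0_iff[OF emb g(1)] g(3) by blast
      then show "g = 0" using full g by blast
    qed
    show "e * supp_set Y = e"
    proof (rule below[OF supp_set_projection[OF Y]])
      fix g assume g: "projection g" "g * e = g" "g * supp_set Y = 0"
      have "rep_aff (d x) \<in> Y" using dZ[OF x(1)] by simp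
      then have "E g * d x = 0" using supp_set_mult_eq_0_iff[OF Y g(1)] g(3) by blast
      then show "g = 0" using full g by blast
    qed
  qed (use large nc in auto)
qed

end

lemma sigma_distributive_mono:
  assumes "projection p" "projection e" "e * p = e" "sigma_distributive (projections {p * a | a. True})"
  shows "sigma_distributive (projections {e * a | a. True})"
  using assms le_trans_mult[OF _ assms(3)] unfolding sigma_distributive_iff_refinable[OF assms(1)]
    sigma_distributive_iff_refinable[OF assms(2)] by blast

lemma nowhere_constant_not_sigma_distributive:
  assumes e: "projection e" "e \<noteq> 0"
    and nc: "\<forall>q l. projection q \<longrightarrow> q \<noteq> 0 \<longrightarrow> q * e = q \<longrightarrow> (\<exists>U\<in>clop q. stone_iso x U \<noteq> l)"
  shows "\<not> sigma_distributive (projections {e * a | a. True})"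
proof
  assume "sigma_distributive (projections {e * a | a. True})"
  then have "refinable e" using sigma_distributive_iff_refinable[OF e(1)] e by (simp add: projection_idem)
  then obtain q l where "projection q" "q \<noteq> 0" "q * e = q" "\<And>U. U \<in> clop q \<Longrightarrow> stone_iso x U = l"
    using refinable_imp_locally_constant[OF e(1), of x] by metis
  then show False using nc by blast
qed

text \<open>The derivation is \<open>x \<mapsto> p D x\<close> with \<open>D\<close> from \<open>nonzero_derivation_exists\<close>. It does not vanish on \<open>I\<close>: otherwise
  \<open>p D (a x) = 0\<close> would give \<open>d x = 0\<close> for all \<open>x\<close> in \<open>I\<close>, while \<open>d\<close> is below the support of \<open>I\<close>.\<close>

lemma band_preserving_derivation_exists:
  fixes I :: "'a::comm_awstar_algebra set"
  assumes I: "ideal_of I" and p: "projection p" "p * supp_set (emb ` I) = p"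
    and nsd: "\<not> sigma_distributive (projections {p * a | a. True})"
    and Y: "\<And>f. rep_aff (E p * f) \<in> Y"
  shows "\<exists>\<delta>. derivation I Y \<delta> \<and> band_preserving I \<delta> \<and> nonzero_on I \<delta>"
proof -
  obtain d where d: "projection d" "d \<noteq> 0" "d * p = d" "\<not> refinable d"
    using nsd unfolding sigma_distributive_iff_refinable[OF p(1)] by blast
  have "\<not> (\<forall>a. \<exists>q l. projection q \<and> q \<noteq> 0 \<and> q * d = q \<and> (\<forall>U\<in>clop q. stone_iso a U = l))"
  proof
    assume h: "\<forall>a. \<exists>q l. projection q \<and> q \<noteq> 0 \<and> q * d = q \<and> (\<forall>U\<in>clop q. stone_iso a U = l)"
    have "refinable d" by (rule locally_constant_imp_refinable[OF d(1) h[rule_format]])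
    then show False using d(4) by blast
  qed
  then obtain a where "\<forall>q l. \<not> (projection q \<and> q \<noteq> 0 \<and> q * d = q \<and> (\<forall>U\<in>clop q. stone_iso a U = l))"
    by blast
  then have a: "\<exists>U\<in>clop q. stone_iso a U \<noteq> l" if "projection q" "q \<noteq> 0" "q * d = q" for q l
    using that by blast
  obtain D :: "'a aff \<Rightarrow> 'a aff"
    where D': "\<forall>x y. D (x + y) = D x + D y" "\<forall>x y. D (x * y) = x * D y + D x * y"
      "\<forall>c. D (cst c) = 0" "\<forall>e. e * e = e \<longrightarrow> D e = 0" "D (E a) = E d"
    by (rule nonzero_derivation_exists[OF d(1) a])
  note D = D'(1-4)[rule_format] D'(5)
  define \<delta> where "\<delta> = (\<lambda>x. rep_aff (E p * D (E x)))"
  have Iops: "x + y \<in> I" "c *\<^sub>C x \<in> I" "z * x \<in> I" if "x \<in> I" "y \<in> I" for x y z c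
    using I that by (auto simp: ideal_of_def)
  have "derivation I Y \<delta>"
    unfolding derivation_def
  proof (intro conjI ballI allI)
    fix x y c assume xy: "x \<in> I"
    show "\<delta> x \<in> Y" unfolding \<delta>_def by (rule Y)
    show "\<delta> (c *\<^sub>C x) = S_scale c (\<delta> x)"
      unfolding \<delta>_def rep_scale[symmetric] by (simp add: E_scaleC D mult_ac)
    show "\<delta> (x + y) = S_add (\<delta> x) (\<delta> y)"
      unfolding \<delta>_def rep_add[symmetric] by (simp add: E_add D distrib_left)
    show "\<delta> (x * y) = S_add (S_mult (\<delta> x) (emb y)) (S_mult (emb x) (\<delta> y))"
      unfolding \<delta>_def rep_E[symmetric] rep_mult[symmetric] rep_add[symmetric]
      by (simp add: E_mult D algebra_simps)
  qed
  moreover have "band_preserving I \<delta>"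
    unfolding band_preserving_def
  proof (intro ballI)
    fix x assume x: "x \<in> I"
    define s where "s = supp (emb x)"
    have s: "projection s" unfolding s_def rep_E[symmetric] by (rule supp_projection)
    have s': "projection (1 - s)" by (rule projection_compl[OF s])
    have "(1 - s) * s = 0" using s by (simp add: left_diff_distrib projection_idem)
    then have z: "E (1 - s) * E x = 0" using supp_mult_eq_0_iff[OF s', of "E x"] by (simp add: s_def rep_E)
    have "D (E (1 - s) * E x) = E (1 - s) * D (E x)"
      using D(2)[of "E (1 - s)" "E x"] D(4)[of "E (1 - s)"] E_idem[OF s'] by simp
    moreover have "D 0 = 0" using D(4)[of 0] by simp
    ultimately have "E (1 - s) * D (E x) = 0" using z by simp
    then have "E (1 - s) * (E p * D (E x)) = 0" by (metis mult.left_commute mult_zero_right)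
    then have "(1 - s) * supp (\<delta> x) = 0" using supp_mult_eq_0_iff[OF s', of "E p * D (E x)"] by (simp add: \<delta>_def)
    then have "supp (\<delta> x) * s = supp (\<delta> x)" by (simp add: algebra_simps)
    then show "supp (\<delta> x) \<sqsubseteq>\<^bsub>projections UNIV\<^esub> supp (emb x)" by (simp add: s_def)
  qed
  moreover have "nonzero_on I \<delta>"
  proof (rule ccontr)
    assume "\<not> nonzero_on I \<delta>"
    then have z: "E p * D (E x) = 0" if "x \<in> I" for x
      using that rep_zero unfolding nonzero_on_def \<delta>_def by (metis rep_aff_inject)
    have emb: "emb ` I \<subseteq> S_alg" using emb_in_S_alg by blast
    have "E d * E x = 0" if x: "x \<in> I" for x
    proof -
      have "0 = E p * D (E (a * x))" using z Iops(3)[OF x x] by simp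
      also have "\<dots> = E a * (E p * D (E x)) + E p * E d * E x" by (simp add: E_mult D algebra_simps)
      also have "\<dots> = E (p * d) * E x" using z[OF x] by (simp add: E_mult)
      finally show ?thesis using d(3) by (simp add: mult.commute)
    qed
    then have "\<forall>w. rep_aff w \<in> emb ` I \<longrightarrow> E d * w = 0" by (metis imageE rep_E rep_aff_inject)
    then have "d * supp_set (emb ` I) = 0" using supp_set_mult_eq_0_iff[OF emb d(1)] by blast
    moreover have "d * supp_set (emb ` I) = d" using le_trans_mult[OF d(3) p(2)] .
    ultimately show False using d(2) by simp
  qed
  ultimately show ?thesis by blast
qed

text \<open>Take disjoint pieces \<open>s n\<close> of \<open>e\<close> and glue the constants \<open>\<alpha> n\<close> on them. The result is unbounded for \<open>\<alpha> n = n\<close>, and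
  with \<open>\<alpha> n = n / N (s n)\<close> monotonicity would make its quasi-norm at least \<open>n\<close> for every \<open>n\<close>.\<close>

lemma no_large_corner_if_quasi_normed_or_bounded:
  fixes Y :: "'a::comm_awstar_algebra meas set"
  assumes e: "projection e" "e \<noteq> 0" and large: "\<forall>f. rep_aff (E e * f) \<in> Y"
    and nc: "\<forall>q l. projection q \<longrightarrow> q \<noteq> 0 \<longrightarrow> q * e = q \<longrightarrow> (\<exists>U\<in>clop q. stone_iso x U \<noteq> l)"
  shows "\<not> ((\<exists>N. quasi_norm Y N \<and> monotone_norm Y N) \<or> Y \<subseteq> range emb)"
proof
  assume hyp: "(\<exists>N. quasi_norm Y N \<and> monotone_norm Y N) \<or> Y \<subseteq> range emb"
  obtain s :: "nat \<Rightarrow> 'a" where s: "\<And>n. projection (s n)" "\<And>n. s n \<noteq> 0" "\<And>n. s n * e = s n"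
    "\<And>m n. m \<noteq> n \<Longrightarrow> s m * s n = 0"
    using infinite_disjoint_sequence[OF e, of x] nc by metis
  have glued: "\<exists>z. rep_aff z \<in> Y \<and> (\<forall>n. E (s n) * z = E (s n) * cst (\<alpha> n))" for \<alpha>
  proof -
    obtain z where z: "\<And>n. E (s n) * z = E (s n) * cst (\<alpha> n)" using glue_sequence[of s \<alpha>] s by metis
    have "E (s n) * (E e * z) = E (s n) * cst (\<alpha> n)" for n using z[of n] s(3)[of n] by (metis E_mult mult.assoc)
    then show ?thesis using large by blast
  qed
  from hyp show False
  proof
    assume "\<exists>N. quasi_norm Y N \<and> monotone_norm Y N"
    then obtain N where N: "quasi_norm Y N" "monotone_norm Y N" by blast
    define u where "u = (\<lambda>n. rep_aff (E (s n)))"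
    have uY: "u n \<in> Y" for n
      using large s(3)[of n] unfolding u_def by (metis E_mult mult.commute)
    have Npos: "N (u n) > 0" for n
    proof -
      have "u n \<noteq> S_zero" using s(2)[of n] unfolding u_def by (metis E_eq_iff E_zero rep_aff_inject rep_zero)
      then show ?thesis using N(1) uY[of n] unfolding quasi_norm_def by (metis order_le_less)
    qed
    define \<alpha> where "\<alpha> = (\<lambda>n. complex_of_real (real n / N (u n)))"
    obtain z where z: "rep_aff z \<in> Y" "\<And>n. E (s n) * z = E (s n) * cst (\<alpha> n)" using glued by blast
    have "real n \<le> N (rep_aff z)" for n
    proof -
      have v: "rep_aff (cst (\<alpha> n) * E (s n)) \<in> Y"
        using large[rule_format, of "cst (\<alpha> n) * E (s n)"] s(3)[of n]
        by (metis E_mult mult.commute mult.left_commute)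
      have "\<forall>\<^sub>F q in generic. s n \<in> q \<longrightarrow> ev z q = ev (cst (\<alpha> n)) q"
        using z(2)[of n] E_mult_eq_iff[OF s(1)] by blast
      then have "\<forall>\<^sub>F q in generic. cmod (ev (cst (\<alpha> n) * E (s n)) q) \<le> cmod (ev z q)"
        using ev_mult[of "cst (\<alpha> n)" "E (s n)"] eventually_ev_E_projection[OF s(1)[of n]] by eventually_elim auto
      then have "S_abs_le (rep_aff (cst (\<alpha> n) * E (s n))) (rep_aff z)" by (simp add: S_abs_le_iff)
      then have "N (rep_aff (cst (\<alpha> n) * E (s n))) \<le> N (rep_aff z)"
        using N(2) z(1) v unfolding monotone_norm_def by blast
      moreover have "N (rep_aff (cst (\<alpha> n) * E (s n))) = cmod (\<alpha> n) * N (u n)"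
        using N(1) uY[of n] unfolding rep_scale u_def quasi_norm_def by blast
      moreover have "cmod (\<alpha> n) * N (u n) = real n" using Npos[of n] by (simp add: \<alpha>_def norm_divide)
      ultimately show ?thesis by simp
    qed
    moreover obtain n :: nat where "N (rep_aff z) < real n" using reals_Archimedean2 by blast
    ultimately show False by (meson leD)
  next
    assume Y: "Y \<subseteq> range emb"
    obtain z where z: "rep_aff z \<in> Y" "\<And>n. E (s n) * z = E (s n) * cst (of_nat n)"
      using glued[of of_nat] by blast
    then obtain a where a: "z = E a" using Y by (metis imageE rep_E rep_aff_inject subsetD)
    obtain B where B: "\<And>q. ultrafilter q \<Longrightarrow> cmod (stone_iso a q) \<le> B" using stone_iso_bounded[of a] by blast
    obtain n :: nat where n: "B < real n" using reals_Archimedean2 by blast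
    have "\<forall>\<^sub>F q in generic. s n \<in> q \<longrightarrow> ev z q = ev (cst (of_nat n)) q"
      using z(2)[of n] E_mult_eq_iff[OF s(1)] by blast
    then have gen: "\<forall>\<^sub>F q in generic. s n \<in> q \<longrightarrow> stone_iso a q = of_nat n"
      using ev_cst[of "of_nat n"] eventually_ev_E[of a] by eventually_elim (simp add: a)
    obtain q where q: "q \<in> clop (s n)" "s n \<in> q \<longrightarrow> stone_iso a q = of_nat n"
      by (rule generic_point[OF gen s(1,2)])
    then have "cmod (stone_iso a q) = real n" "ultrafilter q" by (auto simp: clop_def)
    then show False using B[of q] n by simp
  qed
qed

theorem theorem5p6:
  fixes I :: "'a::comm_awstar_algebra set" and Y :: "'a meas set"
  assumes "ideal_of I" and "solid_space Y"
  defines "sI \<equiv> supp_set (emb ` I)" and "sY \<equiv> supp_set Y"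
  shows
    "(sigma_distributive (projections {sI * a | a. True}) \<longleftrightarrow>
        \<not> (\<exists>\<delta>. derivation I S_alg \<delta> \<and> band_preserving I \<delta> \<and> nonzero_on I \<delta>)) \<and>
     ((\<exists>(M :: ('h::complex_hilbert \<Rightarrow>\<^sub>L 'h) set) (\<pi> :: 'a \<Rightarrow> ('h \<Rightarrow>\<^sub>L 'h)).
          von_neumann_algebra M \<and> star_iso_onto \<pi> M) \<longrightarrow>
        (atomic (projections {sI * a | a. True}) \<longleftrightarrow>
          \<not> (\<exists>\<delta>. derivation I S_alg \<delta> \<and> band_preserving I \<delta> \<and> nonzero_on I \<delta>))) \<and>
     ((\<exists>\<delta>. derivation I Y \<delta> \<and> band_preserving I \<delta> \<and> nonzero_on I \<delta>) \<longleftrightarrow>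
        (\<exists>p. projection p \<and> p \<noteq> 0 \<and> p \<sqsubseteq>\<^bsub>projections UNIV\<^esub> sI * sY \<and>
          S_mult (emb p) ` Y = S_mult (emb p) ` S_alg \<and>
          \<not> sigma_distributive (projections {p * a | a. True}))) \<and>
     ((\<exists>N. quasi_norm Y N \<and> monotone_norm Y N) \<or> Y \<subseteq> range emb \<longrightarrow>
        (\<forall>\<delta>. derivation I Y \<delta> \<and> band_preserving I \<delta> \<longrightarrow> (\<forall>x\<in>I. \<delta> x = S_zero)))"
proof -
  have I: "ideal_of I" and YS: "Y \<subseteq> S_alg" using assms(1,2) by (auto simp: solid_space_def)
  have solid: "rep_aff y \<in> Y"
    if "rep_aff x \<in> Y" "\<forall>\<^sub>F q in generic. cmod (ev y q) \<le> cmod (ev x q)" for x y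
    using assms(2) that unfolding solid_space_def S_abs_le_iff[symmetric] by (meson rep_aff_in)
  then have solidY: "solid_closed {z. rep_aff z \<in> Y}" unfolding solid_closed_def by blast
  have solidS: "solid_closed {z :: 'a aff. rep_aff z \<in> S_alg}" unfolding solid_closed_def by simp
  have sI: "projection sI" unfolding sI_def by (rule supp_set_projection) (use emb_in_S_alg in blast)
  have sY: "projection sY" unfolding sY_def by (rule supp_set_projection[OF YS])
  let ?D = "\<lambda>Y. \<exists>\<delta>. derivation I Y \<delta> \<and> band_preserving I \<delta> \<and> nonzero_on I \<delta>"
  have one: "sigma_distributive (projections {sI * a | a. True}) \<longleftrightarrow> \<not> ?D S_alg"
  proof
    assume sd: "sigma_distributive (projections {sI * a | a. True})"
    show "\<not> ?D S_alg"
    proof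
      assume "?D S_alg"
      then obtain \<delta> where \<delta>: "derivation I S_alg \<delta>" "band_preserving I \<delta>" "nonzero_on I \<delta>" by blast
      obtain e x where e: "projection e" "e \<noteq> 0" "e * supp_set (emb ` I) = e"
        "e * supp_set (S_alg :: 'a meas set) = e" "\<forall>f. rep_aff (E e * f) \<in> S_alg"
        "\<forall>q l. projection q \<longrightarrow> q \<noteq> 0 \<longrightarrow> q * e = q \<longrightarrow> (\<exists>U\<in>clop q. stone_iso x U \<noteq> l)"
        by (rule nonzero_derivation_region[OF order_refl \<delta>(1,2) I solidS \<delta>(3)])
      show False
        using nowhere_constant_not_sigma_distributive[OF e(1,2,6)] sigma_distributive_mono[OF sI e(1) _ sd] e(3)
        by (simp add: sI_def)
    qed
  next
    assume "\<not> ?D S_alg"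
    then show "sigma_distributive (projections {sI * a | a. True})"
      using band_preserving_derivation_exists[OF I sI, of S_alg] projection_idem[OF sI]
      unfolding sI_def[symmetric] by auto
  qed
  have vN: "atomic (projections {sI * a | a. True}) \<longleftrightarrow> \<not> ?D S_alg"
    if "\<exists>(M :: ('h \<Rightarrow>\<^sub>L 'h) set) (\<pi> :: 'a \<Rightarrow> ('h \<Rightarrow>\<^sub>L 'h)). von_neumann_algebra M \<and> star_iso_onto \<pi> M"
    using one that atomic_imp_sigma_distributive[OF sI] sigma_distributive_imp_atomic[OF _ _ sI] by blast
  have two: "?D Y \<longleftrightarrow> (\<exists>p. projection p \<and> p \<noteq> 0 \<and> p \<sqsubseteq>\<^bsub>projections UNIV\<^esub> sI * sY \<and>
      S_mult (emb p) ` Y = S_mult (emb p) ` S_alg \<and> \<not> sigma_distributive (projections {p * a | a. True}))"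
  proof
    assume "?D Y"
    then obtain \<delta> where \<delta>: "derivation I Y \<delta>" "band_preserving I \<delta>" "nonzero_on I \<delta>" by blast
    obtain e x where e: "projection e" "e \<noteq> 0" "e * supp_set (emb ` I) = e"
      "e * supp_set Y = e" "\<forall>f. rep_aff (E e * f) \<in> Y"
      "\<forall>q l. projection q \<longrightarrow> q \<noteq> 0 \<longrightarrow> q * e = q \<longrightarrow> (\<exists>U\<in>clop q. stone_iso x U \<noteq> l)"
      by (rule nonzero_derivation_region[OF YS \<delta>(1,2) I solidY \<delta>(3)])
    have "e * (sI * sY) = e" using e(3,4) by (simp add: sI_def sY_def mult.assoc[symmetric])
    moreover have "S_mult (emb e) ` S_alg \<subseteq> S_mult (emb e) ` Y"
    proof
      fix w assume "w \<in> S_mult (emb e) ` S_alg"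
      then obtain f where f: "w = S_mult (emb e) (rep_aff f)" by (metis Abs_aff_inverse imageE)
      have "w = S_mult (emb e) (rep_aff (E e * f))"
        unfolding f rep_E[symmetric] rep_mult[symmetric] E_proj_mult[OF e(1)] ..
      then show "w \<in> S_mult (emb e) ` Y" using e(5) by blast
    qed
    then have "S_mult (emb e) ` Y = S_mult (emb e) ` S_alg" using YS by blast
    ultimately show "\<exists>p. projection p \<and> p \<noteq> 0 \<and> p \<sqsubseteq>\<^bsub>projections UNIV\<^esub> sI * sY \<and>
      S_mult (emb p) ` Y = S_mult (emb p) ` S_alg \<and> \<not> sigma_distributive (projections {p * a | a. True})"
      using e(1,2) nowhere_constant_not_sigma_distributive[OF e(1,2,6)] by (intro exI[of _ e]) simp
  next
    assume "\<exists>p. projection p \<and> p \<noteq> 0 \<and> p \<sqsubseteq>\<^bsub>projections UNIV\<^esub> sI * sY \<and>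
      S_mult (emb p) ` Y = S_mult (emb p) ` S_alg \<and> \<not> sigma_distributive (projections {p * a | a. True})"
    then obtain p where p: "projection p" "p * (sI * sY) = p" "S_mult (emb p) ` Y = S_mult (emb p) ` S_alg"
      "\<not> sigma_distributive (projections {p * a | a. True})" by auto
    have psI: "p * supp_set (emb ` I) = p"
      using p(2) le_trans_mult[of p "sI * sY" sI] sI by (simp add: sI_def[symmetric] mult_ac projection_idem)
    have "rep_aff (E p * f) \<in> Y" for f
    proof -
      have "S_mult (emb p) (rep_aff f) \<in> S_mult (emb p) ` Y" unfolding p(3) by simp
      then obtain w where w: "w \<in> Y" "S_mult (emb p) (rep_aff f) = S_mult (emb p) w" by blast
      then obtain g where g: "w = rep_aff g" using YS by (metis Abs_aff_inverse subsetD)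
      have "rep_aff (E p * f) = rep_aff (E p * g)" using w(2) by (simp add: rep_mult rep_E g)
      moreover have "\<forall>\<^sub>F q in generic. cmod (ev (E p * g) q) \<le> cmod (ev g q)"
        using ev_mult[of "E p" g] eventually_ev_E_projection[OF p(1)] by eventually_elim auto
      ultimately show ?thesis using solid w(1) g by metis
    qed
    then show "?D Y" by (rule band_preserving_derivation_exists[OF I p(1) psI p(4)])
  qed
  have three: "\<forall>x\<in>I. \<delta> x = S_zero"
    if hyp: "(\<exists>N. quasi_norm Y N \<and> monotone_norm Y N) \<or> Y \<subseteq> range emb"
      and \<delta>: "derivation I Y \<delta>" "band_preserving I \<delta>" for \<delta>
  proof (rule ccontr)
    assume "\<not> (\<forall>x\<in>I. \<delta> x = S_zero)"
    then have nz: "nonzero_on I \<delta>" by (auto simp: nonzero_on_def)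
    obtain e x where e: "projection e" "e \<noteq> 0" "e * supp_set (emb ` I) = e"
      "e * supp_set Y = e" "\<forall>f. rep_aff (E e * f) \<in> Y"
      "\<forall>q l. projection q \<longrightarrow> q \<noteq> 0 \<longrightarrow> q * e = q \<longrightarrow> (\<exists>U\<in>clop q. stone_iso x U \<noteq> l)"
      by (rule nonzero_derivation_region[OF YS \<delta> I solidY nz])
    show False using no_large_corner_if_quasi_normed_or_bounded[OF e(1,2,5,6)] hyp by blast
  qed
  show ?thesis
  proof (intro conjI impI allI one two)
    show "atomic (projections {sI * a | a. True}) \<longleftrightarrow> \<not> ?D S_alg"
      if "\<exists>(M :: ('h \<Rightarrow>\<^sub>L 'h) set) (\<pi> :: 'a \<Rightarrow> ('h \<Rightarrow>\<^sub>L 'h)). von_neumann_algebra M \<and> star_iso_onto \<pi> M"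
      using that by (rule vN)
    show "\<forall>x\<in>I. \<delta> x = S_zero"
      if "(\<exists>N. quasi_norm Y N \<and> monotone_norm Y N) \<or> Y \<subseteq> range emb"
        and "derivation I Y \<delta> \<and> band_preserving I \<delta>" for \<delta>
      using three that by blast
  qed
qed

end
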